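(* Let $P_\lambda$ and $P_\mu$ be Poisson PP distributions with sigma-finite intensity measures $\lambda$ and $\mu$ on a measurable space $(S,\mathcal S)$. Then for every $\alpha\in(0,\infty)$ the R\'enyi divergence of order $\alpha$ is given by the Tsallis divergence of the intensity measures: $$R_\alpha(P_\lambda\|P_\mu)=T_\alpha(\lambda\|\mu).$$ If $T_\alpha(\lambda\|\mu)<\infty$ for some $\alpha>0$, then also $R_0(P_\lambda\|P_\mu)=T_0(\lambda\|\mu)$.
   Context: Point patterns: $N(S)$ is the set of measures on $(S,\mathcal S)$ that can be written as a countable sum of integer-valued finite measures, equipped with the sigma-algebra $\mathcal N(S)$ generated by the evaluation maps $\eta\mapsto\eta(B)$, $B\in\mathcal S$. Poisson PP distribution: for a sigma-finite measure $\lambda$ on $(S,\mathcal S)$, $P_\lambda$ is the unique probability measure on $(N(S),\mathcal N(S))$ under which $\eta(B_1),\dots,\eta(B_n)$ are independent for all $n\ge1$ and mutually disjoint $B_1,\dots,B_n\in\mathcal S$, and $\eta(B)$ is Poisson distributed with mean $\lambda(B)$ for every $B\in\mathcal S$ (with $\mathrm{Poi}(0)=\delta_0$, $\mathrm{Poi}(\infty)=\delta_\infty$). Conventions: for $\alpha>1$, $f^\alpha g^{1-\alpha}$ is read as $\frac{f^\alpha}{g^{\alpha-1}}$; $\frac00=0$ and $\frac t0=\infty$ for $t>0$; $t\log\frac t0=\infty$ for $t>0$; $0\log\frac0t=0$ for $t\ge0$. Tsallis divergence of sigma-finite measures $\lambda,\mu$ with densities $f,g$ with respect to a sigma-finite measure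 $\nu$ (the value does not depend on the choice of $f,g,\nu$): $T_0(\lambda\|\mu)=\mu\{f=0\}$; $T_\alpha(\lambda\|\mu)=\int_S\frac{\alpha f+(1-\alpha)g-f^\alpha g^{1-\alpha}}{1-\alpha}\,d\nu$ for $\alpha\notin\{0,1\}$; $T_1(\lambda\|\mu)=\int_S\left(f\log\frac fg+g-f\right)d\nu$. R\'enyi divergence of probability measures $P,Q$ with densities $p,q$ with respect to a sigma-finite measure $m$ (the value does not depend on the choice), with the same conventions: $R_0(P\|Q)=-\log Q(p>0)$; $R_\alpha(P\|Q)=\frac1{\alpha-1}\log\int p^\alpha q^{1-\alpha}\,dm$ for $\alpha\notin\{0,1\}$; $R_1(P\|Q)=\int p\log\frac pq\,dm$. *)

theory Defs
  imports "HOL-Probability.Probability"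
begin

section \<open>Point patterns and Poisson point processes\<close>

definition point_patterns :: "'a measure \<Rightarrow> 'a measure set" where
  "point_patterns S = {\<eta>. sets \<eta> = sets S \<and>
     (\<exists>\<kappa> :: nat \<Rightarrow> 'a measure.
        (\<forall>i. sets (\<kappa> i) = sets S \<and> finite_measure (\<kappa> i) \<and> (\<forall>B\<in>sets S. emeasure (\<kappa> i) B \<in> \<nat>)) \<and>
        (\<forall>B\<in>sets S. emeasure \<eta> B = (\<Sum>i. emeasure (\<kappa> i) B)))}"

text \<open>Only the sigma-algebra of \<open>point_pattern_algebra S\<close> matters; as in
  \<^const>\<open>subprob_algebra\<close>, it is carried by a measure with irrelevant values.\<close>

definition point_pattern_algebra :: "'a measure \<Rightarrow> 'a measure measure" where
  "point_pattern_algebra S =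
     (SUP B\<in>sets S. vimage_algebra (point_patterns S) (\<lambda>\<eta>. emeasure \<eta> B) borel)"

lemma space_point_pattern_algebra: "space (point_pattern_algebra S) = point_patterns S"
  by (auto simp: point_pattern_algebra_def space_Sup_eq_UN)

lemma measurable_point_pattern_eval:
  "B \<in> sets S \<Longrightarrow> (\<lambda>\<eta>. emeasure \<eta> B) \<in> borel_measurable (point_pattern_algebra S)"
  by (auto intro!: measurable_Sup1 measurable_vimage_algebra1 simp: point_pattern_algebra_def)

definition poisson_ennreal :: "ennreal \<Rightarrow> ennreal measure" where
  "poisson_ennreal m =
     (if m = \<infinity> then return borel \<infinity>
      else if m = 0 then return borel 0
      else distr (measure_pmf (poisson_pmf (enn2real m))) borel of_nat)"

text \<open>\<open>poisson_pp \<Lambda> P\<close> states that \<open>P\<close> is the Poisson point pattern distribution with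
  intensity \<open>\<Lambda>\<close>; the underlying measurable space is that of \<open>\<Lambda>\<close>.\<close>

definition poisson_pp :: "'a measure \<Rightarrow> 'a measure measure \<Rightarrow> bool" where
  "poisson_pp \<Lambda> P \<longleftrightarrow>
     sets P = sets (point_pattern_algebra \<Lambda>) \<and> prob_space P \<and>
     (\<forall>n\<ge>1. \<forall>B :: nat \<Rightarrow> 'a set. B \<in> {1..n} \<rightarrow> sets \<Lambda> \<longrightarrow> disjoint_family_on B {1..n} \<longrightarrow>
        prob_space.indep_vars P (\<lambda>_. borel) (\<lambda>i \<eta>. emeasure \<eta> (B i)) {1..n}) \<and>
     (\<forall>B\<in>sets \<Lambda>. distr P borel (\<lambda>\<eta>. emeasure \<eta> B) = poisson_ennreal (emeasure \<Lambda> B))"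


section \<open>Extended-real integrands and integrals\<close>

text \<open>\<open>\<infinity> - \<infinity>\<close> does not occur below: all integrands have integrable negative part.\<close>

definition ereal_integral :: "'a measure \<Rightarrow> ('a \<Rightarrow> ereal) \<Rightarrow> ereal" where
  "ereal_integral M h =
     enn2ereal (\<integral>\<^sup>+x. e2ennreal (h x) \<partial>M) - enn2ereal (\<integral>\<^sup>+x. e2ennreal (- h x) \<partial>M)"

text \<open>Logarithm on \<open>[0, \<infinity>]\<close>.\<close>

definition ln_ereal :: "ereal \<Rightarrow> ereal" where
  "ln_ereal x = (if x = \<infinity> then \<infinity> else if x \<le> 0 then - \<infinity> else ereal (ln (real_of_ereal x)))"

text \<open>The term \<open>a\<^sup>\<alpha> b\<^sup>1\<^sup>-\<^sup>\<alpha>\<close> for \<open>a, b \<ge> 0\<close> and \<open>\<alpha> > 0\<close>, \<open>\<alpha> \<noteq> 1\<close>. Division on \<^typ>\<open>ereal\<close>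
  satisfies \<open>0 / 0 = 0\<close> and \<open>t / 0 = \<infinity>\<close> for \<open>t > 0\<close>.\<close>

definition power_term :: "real \<Rightarrow> real \<Rightarrow> real \<Rightarrow> ereal" where
  "power_term \<alpha> a b =
     (if \<alpha> < 1 then ereal (a powr \<alpha> * b powr (1 - \<alpha>))
      else ereal (a powr \<alpha>) / ereal (b powr (\<alpha> - 1)))"

text \<open>The term \<open>a log (a / b)\<close> for \<open>a, b \<ge> 0\<close>.\<close>

definition log_term :: "real \<Rightarrow> real \<Rightarrow> ereal" where
  "log_term a b = (if a = 0 then 0 else if b = 0 then \<infinity> else ereal (a * ln (a / b)))"


section \<open>Divergences\<close>

definition densities_of ::
  "'a measure \<Rightarrow> 'a measure \<Rightarrow> 'a measure \<Rightarrow> ('a \<Rightarrow> real) \<Rightarrow> ('a \<Rightarrow> real) \<Rightarrow> bool" where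
  "densities_of \<Lambda> \<mu> \<nu> f g \<longleftrightarrow>
     sigma_finite_measure \<nu> \<and>
     f \<in> borel_measurable \<nu> \<and> g \<in> borel_measurable \<nu> \<and>
     (\<forall>x\<in>space \<nu>. 0 \<le> f x) \<and> (\<forall>x\<in>space \<nu>. 0 \<le> g x) \<and>
     \<Lambda> = density \<nu> (\<lambda>x. ennreal (f x)) \<and> \<mu> = density \<nu> (\<lambda>x. ennreal (g x))"

text \<open>The divergences for given densities. Orders \<open>\<alpha> < 0\<close> are not meaningful here.\<close>

definition tsallis_formula :: "real \<Rightarrow> 'a measure \<Rightarrow> ('a \<Rightarrow> real) \<Rightarrow> ('a \<Rightarrow> real) \<Rightarrow> ereal" where
  "tsallis_formula \<alpha> \<nu> f g =
     (if \<alpha> = 0 then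
        enn2ereal (emeasure (density \<nu> (\<lambda>x. ennreal (g x))) {x\<in>space \<nu>. f x = 0})
      else if \<alpha> = 1 then
        ereal_integral \<nu> (\<lambda>x. log_term (f x) (g x) + ereal (g x - f x))
      else
        ereal_integral \<nu> (\<lambda>x.
          (ereal (\<alpha> * f x + (1 - \<alpha>) * g x) - power_term \<alpha> (f x) (g x)) / ereal (1 - \<alpha>)))"

definition renyi_formula :: "real \<Rightarrow> 'a measure \<Rightarrow> ('a \<Rightarrow> real) \<Rightarrow> ('a \<Rightarrow> real) \<Rightarrow> ereal" where
  "renyi_formula \<alpha> m p q =
     (if \<alpha> = 0 then
        - ln_ereal (enn2ereal (emeasure (density m (\<lambda>x. ennreal (q x))) {x\<in>space m. 0 < p x}))
      else if \<alpha> = 1 then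
        ereal_integral m (\<lambda>x. log_term (p x) (q x))
      else
        ereal (1 / (\<alpha> - 1)) * ln_ereal (ereal_integral m (\<lambda>x. power_term \<alpha> (p x) (q x))))"

text \<open>The divergences are the common value of these formulas over all choices of a dominating
  measure and densities; \<open>tsallis_divergence_eq\<close>, \<open>renyi_divergence_eq\<close> and \<open>densities_of_exists\<close>
  below show that this value is well defined.\<close>

definition tsallis_divergence :: "real \<Rightarrow> 'a measure \<Rightarrow> 'a measure \<Rightarrow> ereal" where
  "tsallis_divergence \<alpha> \<Lambda> \<mu> =
     (THE t. \<exists>\<nu> f g. densities_of \<Lambda> \<mu> \<nu> f g \<and> t = tsallis_formula \<alpha> \<nu> f g)"

definition renyi_divergence :: "real \<Rightarrow> 'a measure \<Rightarrow> 'a measure \<Rightarrow> ereal" where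
  "renyi_divergence \<alpha> P Q =
     (THE t. \<exists>m p q. densities_of P Q m p q \<and> t = renyi_formula \<alpha> m p q)"


section \<open>Well-definedness\<close>

lemma densities_of_exists:
  assumes "sigma_finite_measure \<Lambda>" "sigma_finite_measure \<mu>" and sets_eq: "sets \<Lambda> = sets \<mu>"
  shows "\<exists>\<nu> f g. densities_of \<Lambda> \<mu> \<nu> f g"
proof -
  interpret L: sigma_finite_measure \<Lambda> by fact
  interpret M: sigma_finite_measure \<mu> by fact
  have space_eq: "space \<mu> = space \<Lambda>"
    using sets_eq by (metis sets_eq_imp_space_eq)
  define \<nu> where "\<nu> = measure_of (space \<Lambda>) (sets \<Lambda>) (\<lambda>A. emeasure \<Lambda> A + emeasure \<mu> A)"
  have sets_nu[simp]: "sets \<nu> = sets \<Lambda>" and space_nu[simp]: "space \<nu> = space \<Lambda>"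
    by (simp_all add: \<nu>_def)
  have em: "emeasure \<nu> A = emeasure \<Lambda> A + emeasure \<mu> A" if "A \<in> sets \<Lambda>" for A
    unfolding \<nu>_def
  proof (rule emeasure_measure_of_sigma)
    show "A \<in> sets \<Lambda>" by fact
    show "sigma_algebra (space \<Lambda>) (sets \<Lambda>)" ..
    show "positive (sets \<Lambda>) (\<lambda>A. emeasure \<Lambda> A + emeasure \<mu> A)"
      by (simp add: positive_def)
    show "countably_additive (sets \<Lambda>) (\<lambda>A. emeasure \<Lambda> A + emeasure \<mu> A)"
      unfolding countably_additive_def
    proof (intro allI impI)
      fix A :: "nat \<Rightarrow> 'a set"
      assume A: "range A \<subseteq> sets \<Lambda>" "disjoint_family A"
      have "(\<Sum>i. emeasure \<Lambda> (A i) + emeasure \<mu> (A i)) = (\<Sum>i. emeasure \<Lambda> (A i)) + (\<Sum>i. emeasure \<mu> (A i))"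
        by (rule suminf_add[symmetric]) auto
      also have "\<dots> = emeasure \<Lambda> (\<Union>(range A)) + emeasure \<mu> (\<Union>(range A))"
        using A sets_eq by (simp add: suminf_emeasure)
      finally show "(\<Sum>i. emeasure \<Lambda> (A i) + emeasure \<mu> (A i)) = emeasure \<Lambda> (\<Union>(range A)) + emeasure \<mu> (\<Union>(range A))" .
    qed
  qed
  have sf: "sigma_finite_measure \<nu>"
  proof
    obtain A :: "nat \<Rightarrow> 'a set" where A: "range A \<subseteq> sets \<Lambda>" "(\<Union>i. A i) = space \<Lambda>" "\<And>i. emeasure \<Lambda> (A i) \<noteq> \<infinity>"
      using L.sigma_finite by blast
    obtain B :: "nat \<Rightarrow> 'a set" where B: "range B \<subseteq> sets \<mu>" "(\<Union>i. B i) = space \<mu>" "\<And>i. emeasure \<mu> (B i) \<noteq> \<infinity>"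
      using M.sigma_finite by blast
    let ?C = "(\<lambda>(i, j). A i \<inter> B j) ` (UNIV :: (nat \<times> nat) set)"
    have s: "A i \<in> sets \<Lambda>" "B i \<in> sets \<Lambda>" "A i \<in> sets \<mu>" "B i \<in> sets \<mu>" for i
      using A(1) B(1) sets_eq by auto
    have "\<Union>?C = (\<Union>i. A i) \<inter> (\<Union>j. B j)" by auto
    then have "\<Union>?C = space \<nu>" using A(2) B(2) space_eq by simp
    moreover have "emeasure \<nu> a \<noteq> \<infinity>" if "a \<in> ?C" for a
    proof -
      from that obtain i j where a: "a = A i \<inter> B j" by auto
      have "emeasure \<Lambda> a \<le> emeasure \<Lambda> (A i)" "emeasure \<mu> a \<le> emeasure \<mu> (B j)"
        unfolding a using s by (auto intro!: emeasure_mono)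
      then show ?thesis using A(3)[of i] B(3)[of j] s
        by (subst em) (auto simp: a top_unique)
    qed
    ultimately show "\<exists>C. countable C \<and> C \<subseteq> sets \<nu> \<and> \<Union>C = space \<nu> \<and> (\<forall>a\<in>C. emeasure \<nu> a \<noteq> \<infinity>)"
      using s by (intro exI[of _ ?C]) auto
  qed
  interpret N: sigma_finite_measure \<nu> by fact
  have ac: "absolutely_continuous \<nu> \<Lambda>" "absolutely_continuous \<nu> \<mu>"
    using sets_eq by (auto simp: absolutely_continuous_def null_sets_def em)
  define f where "f = (\<lambda>x. enn2real (RN_deriv \<nu> \<Lambda> x))"
  define g where "g = (\<lambda>x. enn2real (RN_deriv \<nu> \<mu> x))"
  have f: "f \<in> borel_measurable \<nu>" "AE x in \<nu>. RN_deriv \<nu> \<Lambda> x = ennreal (f x)" "\<And>x. 0 \<le> f x"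
    using N.RN_deriv_finite[OF L.sigma_finite_measure_axioms ac(1)]
    by (auto simp: f_def less_top)
  have g: "g \<in> borel_measurable \<nu>" "AE x in \<nu>. RN_deriv \<nu> \<mu> x = ennreal (g x)" "\<And>x. 0 \<le> g x"
    using N.RN_deriv_finite[OF M.sigma_finite_measure_axioms ac(2)] sets_eq
    by (auto simp: g_def less_top)
  have "\<Lambda> = density \<nu> (RN_deriv \<nu> \<Lambda>)" using N.density_RN_deriv[OF ac(1)] by simp
  also have "\<dots> = density \<nu> (\<lambda>x. ennreal (f x))" using f by (intro density_cong) auto
  finally have 1: "\<Lambda> = density \<nu> (\<lambda>x. ennreal (f x))" .
  have "\<mu> = density \<nu> (RN_deriv \<nu> \<mu>)" using N.density_RN_deriv[OF ac(2)] sets_eq by simp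
  also have "\<dots> = density \<nu> (\<lambda>x. ennreal (g x))" using g by (intro density_cong) auto
  finally have 2: "\<mu> = density \<nu> (\<lambda>x. ennreal (g x))" .
  show ?thesis
    using sf f g 1 2 unfolding densities_of_def by blast
qed

text \<open>Integrals of positively homogeneous functions of the densities do not depend on their
  choice.\<close>

lemma homogeneous_nn_integral_unique:
  fixes \<Psi> :: "real \<Rightarrow> real \<Rightarrow> ennreal"
  assumes d: "densities_of \<Lambda> \<mu> \<nu> f g" and d': "densities_of \<Lambda> \<mu> \<nu>' f' g'"
  assumes meas: "case_prod \<Psi> \<in> borel_measurable (borel \<Otimes>\<^sub>M borel)"
  assumes zero: "\<Psi> 0 0 = 0"
  assumes hom: "\<And>c a b. c > 0 \<Longrightarrow> a \<ge> 0 \<Longrightarrow> b \<ge> 0 \<Longrightarrow> \<Psi> (c * a) (c * b) = ennreal c * \<Psi> a b"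
  shows "(\<integral>\<^sup>+x. \<Psi> (f x) (g x) \<partial>\<nu>) = (\<integral>\<^sup>+x. \<Psi> (f' x) (g' x) \<partial>\<nu>')"
proof -
  define \<rho> where "\<rho> = (\<lambda>\<nu> f g. density \<nu> (\<lambda>x :: 'a. ennreal (f x + g x)))"
  have meas2: "(\<lambda>x. \<Psi> (u x) (v x)) \<in> borel_measurable M"
    if "u \<in> borel_measurable M" "v \<in> borel_measurable M" for u v and M :: "'a measure"
    using measurable_compose[OF measurable_Pair[OF that] meas] by simp
  have *: "(\<integral>\<^sup>+x. \<Psi> (f x) (g x) \<partial>\<nu>) = (\<integral>\<^sup>+x. \<Psi> (f x / (f x + g x)) (g x / (f x + g x)) \<partial>\<rho> \<nu> f g)"
    "density (\<rho> \<nu> f g) (\<lambda>x. ennreal (f x / (f x + g x))) = \<Lambda>"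
    "density (\<rho> \<nu> f g) (\<lambda>x. ennreal (g x / (f x + g x))) = \<mu>"
    "sets (\<rho> \<nu> f g) = sets \<Lambda>"
    "\<And>A. A \<in> sets \<Lambda> \<Longrightarrow> emeasure (\<rho> \<nu> f g) A = emeasure \<Lambda> A + emeasure \<mu> A"
    "sigma_finite_measure (\<rho> \<nu> f g)"
    "(\<lambda>x. f x / (f x + g x)) \<in> borel_measurable \<Lambda>" "(\<lambda>x. g x / (f x + g x)) \<in> borel_measurable \<Lambda>"
    if "densities_of \<Lambda> \<mu> \<nu> f g" for \<nu> f g
  proof -
    from that have [measurable]: "f \<in> borel_measurable \<nu>" "g \<in> borel_measurable \<nu>"
      and pos: "\<And>x. x \<in> space \<nu> \<Longrightarrow> 0 \<le> f x" "\<And>x. x \<in> space \<nu> \<Longrightarrow> 0 \<le> g x"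
      and L: "\<Lambda> = density \<nu> (\<lambda>x. ennreal (f x))" and M: "\<mu> = density \<nu> (\<lambda>x. ennreal (g x))"
      and sf: "sigma_finite_measure \<nu>"
      by (auto simp: densities_of_def)
    have m[measurable]: "(\<lambda>x. \<Psi> (f x / (f x + g x)) (g x / (f x + g x))) \<in> borel_measurable \<nu>"
      by (intro meas2) auto
    have "\<Psi> (f x) (g x) = ennreal (f x + g x) * \<Psi> (f x / (f x + g x)) (g x / (f x + g x))"
      if "x \<in> space \<nu>" for x
    proof (cases "f x + g x = 0")
      case True
      then have "f x = 0" "g x = 0" using pos[OF that] by auto
      then show ?thesis using zero by simp
    next
      case False
      then have "f x + g x > 0" using pos[OF that] by simp
      then show ?thesis
        using hom[of "f x + g x" "f x / (f x + g x)" "g x / (f x + g x)"] pos[OF that] by simp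
    qed
    then show "(\<integral>\<^sup>+x. \<Psi> (f x) (g x) \<partial>\<nu>) = (\<integral>\<^sup>+x. \<Psi> (f x / (f x + g x)) (g x / (f x + g x)) \<partial>\<rho> \<nu> f g)"
      unfolding \<rho>_def by (subst nn_integral_density) (auto intro!: nn_integral_cong)
    have e: "ennreal (f x + g x) * ennreal (f x / (f x + g x)) = ennreal (f x)"
      "ennreal (f x + g x) * ennreal (g x / (f x + g x)) = ennreal (g x)" if "x \<in> space \<nu>" for x
    proof -
      have "f x + g x = 0 \<longleftrightarrow> f x = 0 \<and> g x = 0"
        using pos[OF that] by auto
      then have "(f x + g x) * (f x / (f x + g x)) = f x" "(f x + g x) * (g x / (f x + g x)) = g x"
        by auto
      then show "ennreal (f x + g x) * ennreal (f x / (f x + g x)) = ennreal (f x)"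
        "ennreal (f x + g x) * ennreal (g x / (f x + g x)) = ennreal (g x)"
        using pos[OF that] by (metis ennreal_mult add_nonneg_nonneg divide_nonneg_nonneg)+
    qed
    show "density (\<rho> \<nu> f g) (\<lambda>x. ennreal (f x / (f x + g x))) = \<Lambda>"
      unfolding \<rho>_def L by (subst density_density_eq) (auto intro!: density_cong simp: e)
    show "density (\<rho> \<nu> f g) (\<lambda>x. ennreal (g x / (f x + g x))) = \<mu>"
      unfolding \<rho>_def M by (subst density_density_eq) (auto intro!: density_cong simp: e)
    show "sets (\<rho> \<nu> f g) = sets \<Lambda>" by (simp add: \<rho>_def L)
    show "(\<lambda>x. f x / (f x + g x)) \<in> borel_measurable \<Lambda>" "(\<lambda>x. g x / (f x + g x)) \<in> borel_measurable \<Lambda>"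
      unfolding L by simp_all
    show "emeasure (\<rho> \<nu> f g) A = emeasure \<Lambda> A + emeasure \<mu> A" if "A \<in> sets \<Lambda>" for A
    proof -
      have A[measurable]: "A \<in> sets \<nu>" using that by (simp add: L)
      have "emeasure (\<rho> \<nu> f g) A = (\<integral>\<^sup>+x. ennreal (f x) * indicator A x + ennreal (g x) * indicator A x \<partial>\<nu>)"
        unfolding \<rho>_def using pos
        by (subst emeasure_density) (auto intro!: nn_integral_cong simp: ennreal_plus distrib_right)
      also have "\<dots> = emeasure \<Lambda> A + emeasure \<mu> A"
        unfolding L M by (subst nn_integral_add) (auto simp: emeasure_density)
      finally show ?thesis .
    qed
    show "sigma_finite_measure (\<rho> \<nu> f g)"
      unfolding \<rho>_def by (subst sigma_finite_measure.sigma_finite_iff_density_finite[OF sf]) auto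
  qed
  note a = *[OF d] and b = *[OF d']
  have r: "\<rho> \<nu>' f' g' = \<rho> \<nu> f g"
    by (rule measure_eqI) (use a(4,5) b(4,5) in auto)
  interpret R: sigma_finite_measure "\<rho> \<nu> f g" by (fact a(6))
  have [measurable]: "(\<lambda>x. f x / (f x + g x)) \<in> borel_measurable (\<rho> \<nu> f g)"
    "(\<lambda>x. g x / (f x + g x)) \<in> borel_measurable (\<rho> \<nu> f g)"
    "(\<lambda>x. f' x / (f' x + g' x)) \<in> borel_measurable (\<rho> \<nu> f g)"
    "(\<lambda>x. g' x / (f' x + g' x)) \<in> borel_measurable (\<rho> \<nu> f g)"
    using a(4,7,8) b(7,8) by (simp_all cong: measurable_cong_sets)
  have sp: "space \<nu> = space (\<rho> \<nu> f g)" "space \<nu>' = space (\<rho> \<nu> f g)"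
    unfolding r[symmetric] by (simp_all add: \<rho>_def) (metis r \<rho>_def space_density)
  have pos: "0 \<le> f x / (f x + g x)" "0 \<le> g x / (f x + g x)"
    "0 \<le> f' x / (f' x + g' x)" "0 \<le> g' x / (f' x + g' x)" if "x \<in> space (\<rho> \<nu> f g)" for x
    using that d d' unfolding densities_of_def sp by auto
  have "AE x in \<rho> \<nu> f g. ennreal (f x / (f x + g x)) = ennreal (f' x / (f' x + g' x))"
    by (rule R.density_unique) (use a(2) b(2) r in auto)
  moreover have "AE x in \<rho> \<nu> f g. ennreal (g x / (f x + g x)) = ennreal (g' x / (f' x + g' x))"
    by (rule R.density_unique) (use a(3) b(3) r in auto)
  ultimately have "AE x in \<rho> \<nu> f g. \<Psi> (f x / (f x + g x)) (g x / (f x + g x)) =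
      \<Psi> (f' x / (f' x + g' x)) (g' x / (f' x + g' x))"
    using AE_space by eventually_elim (use pos in \<open>simp del: divide_nonneg_nonneg\<close>)
  then show ?thesis
    unfolding a(1) b(1) r by (rule nn_integral_cong_AE)
qed

lemma homogeneous_ereal_integral_unique:
  fixes \<Phi> :: "real \<Rightarrow> real \<Rightarrow> ereal"
  assumes d: "densities_of \<Lambda> \<mu> \<nu> f g" "densities_of \<Lambda> \<mu> \<nu>' f' g'"
  assumes meas[measurable]: "case_prod \<Phi> \<in> borel_measurable (borel \<Otimes>\<^sub>M borel)"
  assumes zero: "\<Phi> 0 0 = 0"
  assumes hom: "\<And>c a b. c > 0 \<Longrightarrow> a \<ge> 0 \<Longrightarrow> b \<ge> 0 \<Longrightarrow> \<Phi> (c * a) (c * b) = ereal c * \<Phi> a b"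
  shows "ereal_integral \<nu> (\<lambda>x. \<Phi> (f x) (g x)) = ereal_integral \<nu>' (\<lambda>x. \<Phi> (f' x) (g' x))"
proof -
  have e: "e2ennreal (ereal c * x) = ennreal c * e2ennreal x" if "c > 0" for c x
    using that
  proof (cases x)
    case (real r)
    then show ?thesis using that
      by (cases "r \<ge> 0") (simp_all add: ennreal_mult ennreal_neg mult_nonneg_nonpos)
  next
    case PInf
    then show ?thesis using that by (simp add: ennreal_mult_top)
  next
    case MInf
    then show ?thesis using that by (simp add: e2ennreal_neg)
  qed
  have meas': "case_prod (\<lambda>a b. e2ennreal (\<Phi> a b)) \<in> borel_measurable (borel \<Otimes>\<^sub>M borel)"
    "case_prod (\<lambda>a b. e2ennreal (- \<Phi> a b)) \<in> borel_measurable (borel \<Otimes>\<^sub>M borel)"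
    using meas by (simp_all add: case_prod_beta')
  have "(\<integral>\<^sup>+x. e2ennreal (\<Phi> (f x) (g x)) \<partial>\<nu>) = (\<integral>\<^sup>+x. e2ennreal (\<Phi> (f' x) (g' x)) \<partial>\<nu>')"
    by (rule homogeneous_nn_integral_unique[OF d meas'(1)]) (simp_all add: zero hom e e2ennreal_neg)
  moreover have "(\<integral>\<^sup>+x. e2ennreal (- \<Phi> (f x) (g x)) \<partial>\<nu>) = (\<integral>\<^sup>+x. e2ennreal (- \<Phi> (f' x) (g' x)) \<partial>\<nu>')"
    by (rule homogeneous_nn_integral_unique[OF d meas'(2)])
      (simp_all add: zero hom e e2ennreal_neg flip: ereal_mult_minus_right)
  ultimately show ?thesis by (simp add: ereal_integral_def)
qed

lemma power_term_hom:
  assumes "c > 0" "a \<ge> 0" "b \<ge> 0"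
  shows "power_term \<alpha> (c * a) (c * b) = ereal c * power_term \<alpha> a b"
proof (cases "\<alpha> < 1")
  case True
  have "c powr \<alpha> * c powr (1 - \<alpha>) = c" using assms(1) by (simp flip: powr_add)
  moreover have "(c * a) powr \<alpha> * (c * b) powr (1 - \<alpha>) =
      (c powr \<alpha> * c powr (1 - \<alpha>)) * (a powr \<alpha> * b powr (1 - \<alpha>))"
    using assms by (simp add: powr_mult)
  ultimately have e: "(c * a) powr \<alpha> * (c * b) powr (1 - \<alpha>) = c * (a powr \<alpha> * b powr (1 - \<alpha>))"
    by (simp only:)
  show ?thesis using True unfolding power_term_def e by simp
next
  case False
  show ?thesis
  proof (cases "b = 0")
    case True
    then show ?thesis using False assms
      by (cases "a = 0") (auto simp: power_term_def)
  next
    case b: False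
    have "c powr \<alpha> / c powr (\<alpha> - 1) = c" using assms(1) by (simp flip: powr_diff)
    moreover have "(c * a) powr \<alpha> / (c * b) powr (\<alpha> - 1) =
        (c powr \<alpha> / c powr (\<alpha> - 1)) * (a powr \<alpha> / b powr (\<alpha> - 1))"
      using assms by (simp add: powr_mult)
    ultimately have e: "(c * a) powr \<alpha> / (c * b) powr (\<alpha> - 1) = c * (a powr \<alpha> / b powr (\<alpha> - 1))"
      by (simp only:)
    show ?thesis
      using False b assms e by (simp add: power_term_def)
  qed
qed

lemma log_term_hom:
  assumes "c > 0" "a \<ge> 0" "b \<ge> 0"
  shows "log_term (c * a) (c * b) = ereal c * log_term a b"
  using assms by (auto simp: log_term_def)

lemma measurable_power_term[measurable]:
  "case_prod (power_term \<alpha>) \<in> borel_measurable (borel \<Otimes>\<^sub>M borel)"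
  unfolding power_term_def case_prod_beta' divide_ereal_def by measurable

lemma measurable_log_term[measurable]:
  "case_prod log_term \<in> borel_measurable (borel \<Otimes>\<^sub>M borel)"
  unfolding log_term_def case_prod_beta' by measurable

lemma tsallis_formula_unique:
  assumes d: "densities_of \<Lambda> \<mu> \<nu> f g" "densities_of \<Lambda> \<mu> \<nu>' f' g'"
  shows "tsallis_formula \<alpha> \<nu> f g = tsallis_formula \<alpha> \<nu>' f' g'"
proof -
  consider "\<alpha> = 0" | "\<alpha> = 1" | "\<alpha> \<noteq> 0" "\<alpha> \<noteq> 1" by blast
  then show ?thesis
  proof cases
    case 1
    have *: "emeasure (density \<nu> (\<lambda>x. ennreal (g x))) {x\<in>space \<nu>. f x = 0} =
        (\<integral>\<^sup>+x. ennreal (g x) * indicator {0} (f x) \<partial>\<nu>)"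
      if "densities_of \<Lambda> \<mu> \<nu> f g" for \<nu> f g
    proof -
      have [measurable]: "f \<in> borel_measurable \<nu>" "g \<in> borel_measurable \<nu>"
        using that by (auto simp: densities_of_def)
      show ?thesis
        by (subst emeasure_density) (auto intro!: nn_integral_cong simp: indicator_def)
    qed
    have "(\<integral>\<^sup>+x. ennreal (g x) * indicator {0} (f x) \<partial>\<nu>) =
        (\<integral>\<^sup>+x. ennreal (g' x) * indicator {0} (f' x) \<partial>\<nu>')"
      by (rule homogeneous_nn_integral_unique[OF d, where \<Psi> = "\<lambda>a b. ennreal b * indicator {0} a"])
        (auto simp: ennreal_mult indicator_def mult.assoc)
    then show ?thesis using 1 *[OF d(1)] *[OF d(2)] by (simp add: tsallis_formula_def)
  next
    case 2
    have "ereal_integral \<nu> (\<lambda>x. log_term (f x) (g x) + ereal (g x - f x)) =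
        ereal_integral \<nu>' (\<lambda>x. log_term (f' x) (g' x) + ereal (g' x - f' x))"
    proof (rule homogeneous_ereal_integral_unique[OF d, where \<Phi> = "\<lambda>a b. log_term a b + ereal (b - a)"])
      fix c a b :: real assume "c > 0" "a \<ge> 0" "b \<ge> 0"
      then show "log_term (c * a) (c * b) + ereal (c * b - c * a) = ereal c * (log_term a b + ereal (b - a))"
        by (auto simp: log_term_def algebra_simps)
    qed (auto simp: log_term_def)
    then show ?thesis using 2 by (simp add: tsallis_formula_def)
  next
    case 3
    have "ereal_integral \<nu> (\<lambda>x. (ereal (\<alpha> * f x + (1 - \<alpha>) * g x) - power_term \<alpha> (f x) (g x)) / ereal (1 - \<alpha>)) =
        ereal_integral \<nu>' (\<lambda>x. (ereal (\<alpha> * f' x + (1 - \<alpha>) * g' x) - power_term \<alpha> (f' x) (g' x)) / ereal (1 - \<alpha>))"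
    proof (rule homogeneous_ereal_integral_unique[OF d,
          where \<Phi> = "\<lambda>a b. (ereal (\<alpha> * a + (1 - \<alpha>) * b) - power_term \<alpha> a b) / ereal (1 - \<alpha>)"])
      fix c a b :: real assume c: "c > 0" and ab: "a \<ge> 0" "b \<ge> 0"
      have e: "ereal (\<alpha> * (c * a) + (1 - \<alpha>) * (c * b)) = ereal c * ereal (\<alpha> * a + (1 - \<alpha>) * b)"
        by (simp add: algebra_simps)
      show "(ereal (\<alpha> * (c * a) + (1 - \<alpha>) * (c * b)) - power_term \<alpha> (c * a) (c * b)) / ereal (1 - \<alpha>) =
        ereal c * ((ereal (\<alpha> * a + (1 - \<alpha>) * b) - power_term \<alpha> a b) / ereal (1 - \<alpha>))"
        unfolding e power_term_hom[OF c ab] using c 3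
        by (cases "power_term \<alpha> a b") (auto simp: algebra_simps divide_simps)
    qed (simp_all add: divide_ereal_def power_term_def case_prod_beta')
    then show ?thesis using 3 by (simp add: tsallis_formula_def)
  qed
qed

lemma renyi_formula_unique:
  assumes d: "densities_of P Q m p q" "densities_of P Q m' p' q'"
  shows "renyi_formula \<alpha> m p q = renyi_formula \<alpha> m' p' q'"
proof -
  have *: "emeasure (density m (\<lambda>x. ennreal (q x))) {x\<in>space m. 0 < p x} =
      (\<integral>\<^sup>+x. ennreal (q x) * indicator {0<..} (p x) \<partial>m)"
    if "densities_of P Q m p q" for m p q
  proof -
    have [measurable]: "p \<in> borel_measurable m" "q \<in> borel_measurable m"
      using that by (auto simp: densities_of_def)
    show ?thesis
      by (subst emeasure_density) (auto intro!: nn_integral_cong simp: indicator_def)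
  qed
  have "(\<integral>\<^sup>+x. ennreal (q x) * indicator {0<..} (p x) \<partial>m) =
      (\<integral>\<^sup>+x. ennreal (q' x) * indicator {0<..} (p' x) \<partial>m')"
    by (rule homogeneous_nn_integral_unique[OF d, where \<Psi> = "\<lambda>a b. ennreal b * indicator {0<..} a"])
      (auto simp: ennreal_mult indicator_def mult.assoc zero_less_mult_iff)
  moreover have "ereal_integral m (\<lambda>x. log_term (p x) (q x)) = ereal_integral m' (\<lambda>x. log_term (p' x) (q' x))"
    by (rule homogeneous_ereal_integral_unique[OF d]) (simp_all add: log_term_hom, simp add: log_term_def)
  moreover have "ereal_integral m (\<lambda>x. power_term \<alpha> (p x) (q x)) = ereal_integral m' (\<lambda>x. power_term \<alpha> (p' x) (q' x))"
    by (rule homogeneous_ereal_integral_unique[OF d]) (simp_all add: power_term_hom, simp add: power_term_def)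
  ultimately show ?thesis
    using *[OF d(1)] *[OF d(2)] by (simp add: renyi_formula_def)
qed

theorem tsallis_divergence_eq:
  assumes "densities_of \<Lambda> \<mu> \<nu> f g"
  shows "tsallis_divergence \<alpha> \<Lambda> \<mu> = tsallis_formula \<alpha> \<nu> f g"
  unfolding tsallis_divergence_def
  by (rule the_equality) (use assms tsallis_formula_unique in blast)+

theorem renyi_divergence_eq:
  assumes "densities_of P Q m p q"
  shows "renyi_divergence \<alpha> P Q = renyi_formula \<alpha> m p q"
  unfolding renyi_divergence_def
  by (rule the_equality) (use assms renyi_formula_unique in blast)+

end

theory Submission
  imports Defs
begin

text \<open>
  For \<open>\<alpha> \<noteq> 1\<close> the Tsallis integrand is the supremum of linear functions (its tangents), so the
  Tsallis divergence is a supremum, over finite measurable partitions, of expressions linear in the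
  measures of the pieces. Consequently \<open>T\<^sub>\<alpha>(\<Lambda>\<parallel>\<mu>)\<close> is the supremum of \<open>\<Sum>\<^sub>j t\<^sub>\<alpha>(\<Lambda>(B\<^sub>j), \<mu>(B\<^sub>j))\<close> over finite
  families of disjoint sets \<open>B\<^sub>j\<close> of finite measure, and \<open>T\<^sub>\<alpha>(P\<^sub>\<Lambda>\<parallel>P\<^sub>\<mu>)\<close> is the supremum of the divergences
  of the joint laws of the counts \<open>\<eta>(B\<^sub>j)\<close>, because events depending on finitely many counts
  form an algebra generating the sigma-algebra of point patterns, and every event is approximated
  by them in measure. The joint laws are products of Poisson distributions, for which
  \<open>\<integral> p\<^sup>\<alpha> q\<^sup>1\<^sup>-\<^sup>\<alpha> = exp ((\<alpha> - 1) \<Sum>\<^sub>j t\<^sub>\<alpha>(\<Lambda>(B\<^sub>j), \<mu>(B\<^sub>j)))\<close>; both suprema are linked by this formula. Since no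
  likelihood ratio of the point processes is used, the singular case needs no separate treatment.
  The orders \<open>1\<close> and \<open>0\<close> are limits \<open>\<alpha> \<up> 1\<close> (monotone convergence) and \<open>\<alpha> \<down> 0\<close> (dominated
  convergence), using that the Tsallis integrand increases with \<open>\<alpha>\<close>.
\<close>

section \<open>The Tsallis integrand\<close>

text \<open>Since \<Lambda> and \<mu> may have infinite total mass, the parts of the integrand need
  not be integrable separately; the integrand is therefore kept as one nonnegative function, by
  weighted AM-GM or Bernoulli, with values in \<open>ennreal\<close>. Suprema over partitions
  compare well between spaces in terms of Tsallis integrals T, whereas independence gives a product
  formula for power integrals I. For probability measures the two are affinely related, (1 -
  \<alpha>) T + I = 1, because both densities integrate to 1; no such relation holds for \<Lambda>
  and \<mu>, so the exponential enters only on the side of the processes. Estimates are passed on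
  through tangents: being linear, they integrate exactly over a set and depend continuously on its
  measures, which allows events to be replaced by cylinders. Tangents carry the factor 1/(1 -
  \<alpha>), and exp ((\<alpha> - 1) s) is constant at \<alpha> = 1, so order 1 has to be reached as
  a limit.\<close>

text \<open>\<open>0 powr \<alpha> = 0\<close> for every \<open>\<alpha>\<close>, including \<open>\<alpha> = 0\<close>; hence \<open>tsallis_term 0 a b\<close> is \<open>b\<close> for \<open>a = 0\<close>
  and \<open>0\<close> otherwise, as order \<open>0\<close> requires.\<close>

definition power_enn :: "real \<Rightarrow> real \<Rightarrow> real \<Rightarrow> ennreal" where
  "power_enn \<alpha> a b = (if \<alpha> > 1 \<and> b = 0 \<and> a \<noteq> 0 then \<infinity> else ennreal (a powr \<alpha> * b powr (1 - \<alpha>)))"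

definition tsallis_term :: "real \<Rightarrow> real \<Rightarrow> real \<Rightarrow> ennreal" where
  "tsallis_term \<alpha> a b =
     (if \<alpha> \<ge> 1 \<and> b = 0 \<and> a \<noteq> 0 then \<infinity>
      else if \<alpha> = 1 then ennreal (a * ln (a / b) + b - a)
      else ennreal ((\<alpha> * a + (1 - \<alpha>) * b - a powr \<alpha> * b powr (1 - \<alpha>)) / (1 - \<alpha>)))"

text \<open>The tangent plane of the (positively homogeneous) Tsallis integrand along the ray \<open>a = r b\<close>.\<close>

definition tangent :: "real \<Rightarrow> real \<Rightarrow> real \<Rightarrow> real \<Rightarrow> real" where
  "tangent \<alpha> r a b = \<alpha> * (1 - r powr (\<alpha> - 1)) / (1 - \<alpha>) * a + (1 - r powr \<alpha>) * b"

lemma measurable_power_enn[measurable]: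
  "case_prod (power_enn \<alpha>) \<in> borel_measurable (borel \<Otimes>\<^sub>M borel)"
  unfolding power_enn_def case_prod_beta' by measurable

lemma measurable_tsallis_term[measurable]:
  "case_prod (tsallis_term \<alpha>) \<in> borel_measurable (borel \<Otimes>\<^sub>M borel)"
  unfolding tsallis_term_def case_prod_beta' by measurable

section \<open>Tangent planes of the Tsallis integrand\<close>

lemma weighted_am_gm:
  fixes x y :: real
  assumes "0 < t" "t < 1" "0 \<le> x" "0 \<le> y"
  shows "x powr t * y powr (1 - t) \<le> t * x + (1 - t) * y"
  using Youngs_inequality_0[of t "1 - t" x y] assms
  by (cases "x = 0 \<or> y = 0") auto

text \<open>Weighted AM-GM for \<open>u powr \<alpha>\<close> and 1 with weights 1/\<alpha> and 1 -
  1/\<alpha>, multiplied by \<alpha>.\<close>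

lemma bernoulli_powr:
  fixes u :: real
  assumes "u \<ge> 0" "\<alpha> > 1"
  shows "1 + \<alpha> * (u - 1) \<le> u powr \<alpha>"
proof -
  have "(u powr \<alpha>) powr (1 / \<alpha>) * 1 powr (1 - 1 / \<alpha>) \<le> 1 / \<alpha> * u powr \<alpha> + (1 - 1 / \<alpha>) * 1"
    using assms by (intro weighted_am_gm) auto
  then have "u \<le> 1 / \<alpha> * u powr \<alpha> + (1 - 1 / \<alpha>)"
    using assms by (simp add: powr_powr)
  then have "\<alpha> * u \<le> \<alpha> * (1 / \<alpha> * u powr \<alpha> + (1 - 1 / \<alpha>))"
    using assms by (intro mult_left_mono) auto
  also have "\<dots> = u powr \<alpha> + \<alpha> - 1"
    using assms by (simp add: algebra_simps)
  finally show ?thesis by (simp add: algebra_simps)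
qed

text \<open>The two sides differ by \<open>(?l - ?c) / (1 - \<alpha>)\<close>, where
  \<open>?l\<close> is the tangent plane of the power function \<open>?c\<close>. That function is
  concave for \<alpha> < 1 and convex for \<alpha> > 1, and the sign of 1 - \<alpha> compensates.
  \<open>fin\<close> excludes the points where the integrand is infinite.\<close>

lemma tangent_le_real:
  assumes \<alpha>: "\<alpha> > 0" "\<alpha> \<noteq> 1" and r: "r > 0" and ab: "a \<ge> 0" "b \<ge> 0" and fin: "\<not> (\<alpha> > 1 \<and> b = 0 \<and> a \<noteq> 0)"
  shows "tangent \<alpha> r a b \<le> (\<alpha> * a + (1 - \<alpha>) * b - a powr \<alpha> * b powr (1 - \<alpha>)) / (1 - \<alpha>)"
proof -
  let ?c = "a powr \<alpha> * b powr (1 - \<alpha>)"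
  let ?l = "\<alpha> * r powr (\<alpha> - 1) * a + (1 - \<alpha>) * r powr \<alpha> * b"
  have *: "(?l - ?c) / (1 - \<alpha>) \<ge> 0"
  proof (cases "\<alpha> < 1")
    case True
    \<comment> \<open>The scaling moves the equality case of AM-GM to the ray a = r b; its factors
      cancel in the geometric mean.\<close>
    have "(r powr (\<alpha> - 1) * a) powr \<alpha> * (r powr \<alpha> * b) powr (1 - \<alpha>)
        \<le> \<alpha> * (r powr (\<alpha> - 1) * a) + (1 - \<alpha>) * (r powr \<alpha> * b)"
      using True \<alpha> r ab by (intro weighted_am_gm) auto
    moreover have "(r powr (\<alpha> - 1) * a) powr \<alpha> * (r powr \<alpha> * b) powr (1 - \<alpha>) =
       (r powr ((\<alpha> - 1) * \<alpha>) * r powr (\<alpha> * (1 - \<alpha>))) * ?c"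
      using ab r by (simp add: powr_mult powr_powr)
    moreover have "r powr ((\<alpha> - 1) * \<alpha>) * r powr (\<alpha> * (1 - \<alpha>)) = 1"
      using r by (simp add: algebra_simps flip: powr_add)
    ultimately have "?c \<le> ?l" by simp
    then show ?thesis using True by simp
  next
    case False
    then have a1: "\<alpha> > 1" using \<alpha> by simp
    have "?l \<le> ?c"
    proof (cases "b = 0")
      case True
      then show ?thesis using fin a1 by auto
    next
      case b: False
      \<comment> \<open>In units of \<open>r powr \<alpha> * b\<close> both sides depend only on
        \<open>u\<close>, the ratio of a/b to the contact slope, and the claim becomes Bernoulli's
        inequality.\<close>
      define u where "u = a / (b * r)"
      have u: "u \<ge> 0" "a = u * (b * r)" using ab b r by (auto simp: u_def)
      have c: "?c = u powr \<alpha> * (r powr \<alpha> * b)"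
      proof -
        have "?c = u powr \<alpha> * r powr \<alpha> * (b powr \<alpha> * b powr (1 - \<alpha>))"
          unfolding u(2) using ab r u by (simp add: powr_mult)
        also have "b powr \<alpha> * b powr (1 - \<alpha>) = b" using ab b by (simp flip: powr_add)
        finally show ?thesis by simp
      qed
      have "r powr (\<alpha> - 1) * r = r powr \<alpha>" using r by (simp add: powr_diff)
      then have "r powr (\<alpha> - 1) * a = u * (r powr \<alpha> * b)"
        unfolding u(2) by (metis mult.assoc mult.commute)
      then have "?l = (1 + \<alpha> * (u - 1)) * (r powr \<alpha> * b)"
        by (simp add: algebra_simps)
      also have "\<dots> \<le> ?c" unfolding c
        using bernoulli_powr[OF u(1) a1] ab by (intro mult_right_mono) auto
      finally show ?thesis .
    qed
    then show ?thesis using a1 by (simp add: zero_le_divide_iff)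
  qed
  moreover have "tangent \<alpha> r a b = (\<alpha> * a + (1 - \<alpha>) * b - ?l) / (1 - \<alpha>)"
    using \<alpha> unfolding tangent_def by (simp add: field_simps)
  then have "(\<alpha> * a + (1 - \<alpha>) * b - ?c) / (1 - \<alpha>) - tangent \<alpha> r a b = (?l - ?c) / (1 - \<alpha>)"
    by (simp flip: diff_divide_distrib)
  ultimately show ?thesis by linarith
qed

lemma tangent_le:
  assumes "\<alpha> > 0" "\<alpha> \<noteq> 1" "r > 0" "a \<ge> 0" "b \<ge> 0"
  shows "ennreal (tangent \<alpha> r a b) \<le> tsallis_term \<alpha> a b"
  using tangent_le_real[OF assms] assms by (auto simp: tsallis_term_def intro!: ennreal_leI)

text \<open>The integrand has its minimum 0 on the ray a = b, so its tangent there is zero;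
  \<open>tangent_le_real\<close> at r = 1 is then nonnegativity of the integrand.\<close>

lemma tangent_1[simp]: "tangent \<alpha> 1 a b = 0"
  by (simp add: tangent_def)

lemma tsallis_numerator_nonneg:
  fixes \<alpha> a b :: real
  assumes "\<alpha> > 0" "\<alpha> \<noteq> 1" "a \<ge> 0" "b \<ge> 0" "\<not> (\<alpha> > 1 \<and> b = 0 \<and> a \<noteq> 0)"
  shows "0 \<le> (\<alpha> * a + (1 - \<alpha>) * b - a powr \<alpha> * b powr (1 - \<alpha>)) / (1 - \<alpha>)"
  using tangent_le_real[of \<alpha> 1 a b] assms by simp

text \<open>The contact slope is a/b when both are positive. On the boundary rays it degenerates, to
  0 for a = 0 and to \<infinity> for b = 0, so the value is only approached; hence the strict bound
  \<open>c\<close>.\<close>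

lemma tangent_attains:
  assumes \<alpha>: "\<alpha> > 0" "\<alpha> \<noteq> 1" and ab: "a \<ge> 0" "b \<ge> 0" and c: "ennreal c < tsallis_term \<alpha> a b"
  shows "\<exists>r>0. c < tangent \<alpha> r a b"
proof -
  consider "a = 0" "b = 0" | "a > 0" "b > 0" | "a = 0" "b > 0" | "a > 0" "b = 0" "\<alpha> < 1"
    | "a > 0" "b = 0" "\<alpha> > 1"
    using ab \<alpha> by fastforce
  then show ?thesis
  proof cases
    case 1
    then show ?thesis using c by (simp add: tsallis_term_def split: if_splits)
  next
    case 2
    have e: "(a / b) powr (\<alpha> - 1) * a = a powr \<alpha> * b powr (1 - \<alpha>)" "(a / b) powr \<alpha> * b = a powr \<alpha> * b powr (1 - \<alpha>)"
      using 2 by (simp_all add: powr_divide powr_diff field_simps)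
    have "tangent \<alpha> (a / b) a b =
       (\<alpha> * a + (1 - \<alpha>) * b - (\<alpha> * ((a / b) powr (\<alpha> - 1) * a) + (1 - \<alpha>) * ((a / b) powr \<alpha> * b))) / (1 - \<alpha>)"
      using \<alpha> unfolding tangent_def by (simp add: field_simps)
    also have "\<dots> = (\<alpha> * a + (1 - \<alpha>) * b - a powr \<alpha> * b powr (1 - \<alpha>)) / (1 - \<alpha>)"
      unfolding e by (simp add: algebra_simps)
    finally have "c < tangent \<alpha> (a / b) a b"
      using c 2 \<alpha> by (auto simp: tsallis_term_def ennreal_less_iff ennreal_less_zero_iff intro: ccontr)
        (metis ennreal_leI linorder_not_less)
    then show ?thesis using 2 by (intro exI[of _ "a / b"]) auto
  next
    case 3
    have "c < b"
      using c 3 \<alpha> by (auto simp: tsallis_term_def) (metis ennreal_leI linorder_not_less)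
    moreover have "((\<lambda>r. (1 - r powr \<alpha>) * b) \<longlongrightarrow> (1 - 0) * b) (at_right 0)"
      using \<alpha> by (intro tendsto_intros) (auto intro!: tendsto_eq_intros eventually_mono[OF eventually_at_right_less])
    ultimately have "\<forall>\<^sub>F r in at_right 0. c < (1 - r powr \<alpha>) * b"
      by (intro order_tendstoD(1)) auto
    then have "\<forall>\<^sub>F r in at_right 0. c < (1 - r powr \<alpha>) * b \<and> r > 0"
      by (intro eventually_conj eventually_at_right_less)
    then obtain r where "c < (1 - r powr \<alpha>) * b" "r > 0"
      using eventually_happens[of _ "at_right (0::real)"] by (metis (no_types, lifting) trivial_limit_at_right_real)
    then show ?thesis using 3 by (intro exI[of _ r]) (auto simp: tangent_def)
  next
    case 4
    have "c < \<alpha> * a / (1 - \<alpha>)"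
      using c 4 \<alpha> by (auto simp: tsallis_term_def) (metis ennreal_leI linorder_not_less)
    moreover have "((\<lambda>r. \<alpha> * (1 - r powr (\<alpha> - 1)) / (1 - \<alpha>) * a) \<longlongrightarrow> \<alpha> * (1 - 0) / (1 - \<alpha>) * a) at_top"
      using \<alpha> 4 by (intro tendsto_intros tendsto_neg_powr) (auto intro!: filterlim_ident)
    ultimately have "\<forall>\<^sub>F r in at_top. c < \<alpha> * (1 - r powr (\<alpha> - 1)) / (1 - \<alpha>) * a"
      by (intro order_tendstoD(1)) auto
    then have "\<forall>\<^sub>F r in at_top. c < \<alpha> * (1 - r powr (\<alpha> - 1)) / (1 - \<alpha>) * a \<and> r > 0"
      by (intro eventually_conj eventually_gt_at_top)
    then obtain r where "c < \<alpha> * (1 - r powr (\<alpha> - 1)) / (1 - \<alpha>) * a" "r > 0"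
      using eventually_happens[of _ "at_top :: real filter"] by auto
    then show ?thesis using 4 by (intro exI[of _ r]) (auto simp: tangent_def)
  next
    case 5
    \<comment> \<open>Here the tangent is unbounded in r; \<open>s\<close> and \<open>r\<close> are
      solved from requiring it to equal \<alpha> a / (\<alpha> - 1) + |c|.\<close>
    define s where "s = 1 + \<bar>c\<bar> * (\<alpha> - 1) / (\<alpha> * a)"
    have s: "s \<ge> 1" using 5 by (simp add: s_def)
    define r where "r = (s + 1) powr (1 / (\<alpha> - 1))"
    have "r powr (\<alpha> - 1) = s + 1" using 5 s by (simp add: r_def powr_powr)
    then have "tangent \<alpha> r a b = \<alpha> * s * a / (\<alpha> - 1)"
      using 5 by (simp add: tangent_def divide_simps) (simp add: algebra_simps)
    also have "\<dots> = \<alpha> * a / (\<alpha> - 1) + \<bar>c\<bar>"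
      using 5 by (simp add: s_def divide_simps)
    also have "\<dots> > c"
    proof -
      have "\<alpha> * a / (\<alpha> - 1) > 0" using 5 by simp
      then show ?thesis by linarith
    qed
    finally show ?thesis using s by (intro exI[of _ r]) (auto simp: r_def)
  qed
qed

text \<open>Continuity in r reduces to countably many slopes, as monotone convergence along an
  enumeration requires.\<close>

lemma tangent_attains_rational:
  assumes \<alpha>: "\<alpha> > 0" "\<alpha> \<noteq> 1" and ab: "a \<ge> 0" "b \<ge> 0" and c: "ennreal c < tsallis_term \<alpha> a b"
  shows "\<exists>r. r \<in> \<rat> \<and> 0 < r \<and> c < tangent \<alpha> r a b"
proof -
  obtain r0 where r0: "r0 > 0" "c < tangent \<alpha> r0 a b"
    using tangent_attains[OF assms] by auto
  have "isCont (\<lambda>r. tangent \<alpha> r a b) r0"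
    unfolding tangent_def using r0 \<alpha> by (intro continuous_intros) auto
  then have "\<forall>\<^sub>F r in at r0. c < tangent \<alpha> r a b"
    using r0(2) unfolding isCont_def by (rule order_tendstoD(1))
  then obtain d where d: "d > 0" "\<And>r. r \<noteq> r0 \<Longrightarrow> dist r r0 < d \<Longrightarrow> c < tangent \<alpha> r a b"
    unfolding eventually_at by auto
  obtain q where q: "r0 < of_rat q" "of_rat q < r0 + d"
    using of_rat_dense[of r0 "r0 + d"] d by auto
  moreover have "0 < real_of_rat q" using q r0 by linarith
  ultimately show ?thesis
    using d(2)[of "of_rat q"] by (intro exI[of _ "of_rat q"]) (auto simp: dist_real_def)
qed

lemma tsallis_term_le_if_tangent_le:
  assumes "\<alpha> > 0" "\<alpha> \<noteq> 1" "a \<ge> 0" "b \<ge> 0"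
    and "\<And>r. r \<in> \<rat> \<Longrightarrow> r > 0 \<Longrightarrow> ennreal (tangent \<alpha> r a b) \<le> K"
  shows "tsallis_term \<alpha> a b \<le> K"
proof (rule ccontr)
  assume "\<not> tsallis_term \<alpha> a b \<le> K"
  then have lt: "K < tsallis_term \<alpha> a b" by simp
  then obtain c where c: "c \<ge> 0" "K = ennreal c" by (cases K) (auto simp: less_top)
  obtain r where "r \<in> \<rat>" "0 < r" "c < tangent \<alpha> r a b"
    using tangent_attains_rational[OF assms(1-4)] lt c by auto
  with assms(5)[of r] c show False by (auto simp: ennreal_le_iff2)
qed

section \<open>Monotonicity and limits of the integrand in the order\<close>

lemma tsallis_term_mono_lt_1:
  assumes "0 \<le> \<alpha>" "\<alpha> \<le> \<beta>" "\<beta> < 1" "a \<ge> 0" "b \<ge> 0"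
  shows "tsallis_term \<alpha> a b \<le> tsallis_term \<beta> a b"
proof (cases "\<alpha> = \<beta>")
  case False
  \<comment> \<open>\<open>\<theta>\<close> solves \<beta> = \<theta> \<alpha> + (1 - \<theta>).
    With a in the role of the power term of order 1, \<open>c \<beta>\<close> is the weighted
    geometric mean of \<open>c \<alpha>\<close> and a, and AM-GM applies.\<close>
  define \<theta> where "\<theta> = (1 - \<beta>) / (1 - \<alpha>)"
  have \<theta>: "0 < \<theta>" "\<theta> < 1" "1 - \<theta> = (\<beta> - \<alpha>) / (1 - \<alpha>)" using assms False by (auto simp: \<theta>_def field_simps)
  define c where "c \<gamma> = a powr \<gamma> * b powr (1 - \<gamma>)" for \<gamma>
  have "c \<alpha> powr \<theta> * a powr (1 - \<theta>) = c \<beta>"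
  proof -
    have "(a powr \<alpha> * b powr (1 - \<alpha>)) powr \<theta> * a powr (1 - \<theta>) = a powr (\<alpha> * \<theta> + (1 - \<theta>)) * b powr ((1 - \<alpha>) * \<theta>)"
      using assms by (simp add: powr_mult powr_powr powr_add)
    moreover have p: "(1 - \<alpha>) * \<theta> = 1 - \<beta>"
      using assms by (simp add: \<theta>_def)
    moreover have "\<alpha> * \<theta> + (1 - \<theta>) = 1 - (1 - \<alpha>) * \<theta>" by (simp add: algebra_simps)
    ultimately show ?thesis by (simp add: c_def)
  qed
  with weighted_am_gm[of \<theta> "c \<alpha>" a] \<theta> assms have "c \<beta> \<le> \<theta> * c \<alpha> + (1 - \<theta>) * a"
    by (auto simp: c_def)
  then have "(1 - \<alpha>) * c \<beta> \<le> (1 - \<alpha>) * (\<theta> * c \<alpha> + (1 - \<theta>) * a)"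
    using assms by (intro mult_left_mono) auto
  also have "\<dots> = ((1 - \<alpha>) * \<theta>) * c \<alpha> + ((1 - \<alpha>) * (1 - \<theta>)) * a" by (simp add: algebra_simps)
  also have "\<dots> = (1 - \<beta>) * c \<alpha> + (\<beta> - \<alpha>) * a"
    using assms False unfolding \<theta>(3) by (simp add: \<theta>_def)
  finally have "(\<alpha> * a + (1 - \<alpha>) * b - c \<alpha>) * (1 - \<beta>) \<le> (\<beta> * a + (1 - \<beta>) * b - c \<beta>) * (1 - \<alpha>)"
    by (simp add: algebra_simps)
  then show ?thesis
    using assms False by (auto simp: tsallis_term_def c_def divide_simps mult_ac intro!: ennreal_leI)
qed simp

text \<open>For a, b > 0 the power term is a exp ((1 - \<alpha>) ln (b / a)); bounding exp x below
  by 1 + x produces the logarithm of order 1. The same bound serves orders above 1, where division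
  by 1 - \<alpha> reverses it.\<close>

lemma tsallis_term_le_1:
  assumes "0 \<le> \<alpha>" "\<alpha> < 1" "a \<ge> 0" "b \<ge> 0"
  shows "tsallis_term \<alpha> a b \<le> tsallis_term 1 a b"
proof -
  consider "b = 0" "a \<noteq> 0" | "a = 0" | "a > 0" "b > 0" using assms by fastforce
  then show ?thesis
  proof cases
    case 3
    have e: "a powr \<alpha> * b powr (1 - \<alpha>) = a * exp ((1 - \<alpha>) * ln (b / a))"
      using 3 by (simp add: powr_def ln_div algebra_simps flip: exp_add)
        (simp add: exp_diff exp_add)
    have "a * (1 + (1 - \<alpha>) * ln (b / a)) \<le> a powr \<alpha> * b powr (1 - \<alpha>)"
      unfolding e using 3 by (intro mult_left_mono exp_ge_add_one_self) auto
    then have "a - a powr \<alpha> * b powr (1 - \<alpha>) \<le> (1 - \<alpha>) * (a * ln (a / b))"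
      using 3 by (simp add: ln_div algebra_simps)
    then have "(\<alpha> * a + (1 - \<alpha>) * b - a powr \<alpha> * b powr (1 - \<alpha>)) / (1 - \<alpha>) \<le> a * ln (a / b) + b - a"
      using assms by (simp add: divide_simps algebra_simps)
    then show ?thesis using assms 3 by (auto simp: tsallis_term_def intro!: ennreal_leI)
  qed (use assms in \<open>auto simp: tsallis_term_def\<close>)
qed

lemma tsallis_term_1_le:
  assumes "\<beta> > 1" "a \<ge> 0" "b \<ge> 0"
  shows "tsallis_term 1 a b \<le> tsallis_term \<beta> a b"
proof -
  consider "b = 0" "a \<noteq> 0" | "a = 0" | "a > 0" "b > 0" using assms by fastforce
  then show ?thesis
  proof cases
    case 3
    have e: "a powr \<beta> * b powr (1 - \<beta>) = a * exp ((1 - \<beta>) * ln (b / a))"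
      using 3 by (simp add: powr_def ln_div algebra_simps flip: exp_add)
        (simp add: exp_diff exp_add)
    have "a * (1 + (1 - \<beta>) * ln (b / a)) \<le> a powr \<beta> * b powr (1 - \<beta>)"
      unfolding e using 3 by (intro mult_left_mono exp_ge_add_one_self) auto
    then have "a - a powr \<beta> * b powr (1 - \<beta>) \<le> (1 - \<beta>) * (a * ln (a / b))"
      using 3 by (simp add: ln_div algebra_simps)
    then have "(\<beta> * a + (1 - \<beta>) * b - a powr \<beta> * b powr (1 - \<beta>)) / (1 - \<beta>) \<ge> a * ln (a / b) + b - a"
      using assms by (simp add: divide_simps algebra_simps)
    then show ?thesis using assms 3 by (auto simp: tsallis_term_def intro!: ennreal_leI)
  qed (use assms in \<open>auto simp: tsallis_term_def\<close>)
qed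

text \<open>The shift by 2 starts the orders 1 - 1/(n + 2) at 1/2, inside (0, 1); their distance to
  1 is the step of the difference quotients used for order 1.\<close>

lemma filterlim_inverse_at_0: "filterlim (\<lambda>n. 1 / (real n + 2)) (at 0) sequentially"
proof (rule filterlim_atI)
  show "(\<lambda>n. 1 / (real n + 2)) \<longlonglongrightarrow> 0"
    using LIMSEQ_ignore_initial_segment[OF lim_1_over_n[where 'a = real], of 2] by (simp add: add.commute)
qed auto

text \<open>With u = b/a and s = 1/(n + 2) the integrand is b - a - a (u^s - 1) / s, where the
  difference quotient tends to ln u. For b = 0 < a it is (n + 1) a, matching the infinite value at
  order 1.\<close>

lemma tsallis_term_tendsto_1:
  assumes "a \<ge> 0" "b \<ge> 0"
  shows "(\<lambda>n. tsallis_term (1 - 1 / (real n + 2)) a b) \<longlonglongrightarrow> tsallis_term 1 a b"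
proof -
  consider "b = 0" "a > 0" | "a = 0" | "a > 0" "b > 0" using assms by fastforce
  then show ?thesis
  proof cases
    case 1
    have e: "tsallis_term (1 - 1 / (real n + 2)) a b = ennreal ((real n + 1) * a)" for n
    proof -
      have "(1 - 1 / (real n + 2)) * a / (1 / (real n + 2)) = (real n + 1) * a"
        by (simp add: field_simps)
      then show ?thesis using 1 by (simp add: tsallis_term_def)
    qed
    have "(\<lambda>n. ennreal ((real n + 1) * a)) \<longlonglongrightarrow> \<infinity>"
      unfolding infinity_ennreal_def
    proof (subst ennreal_tendsto_top_eq_at_top)
      show "LIM n sequentially. (real n + 1) * a :> at_top"
        by (intro filterlim_at_top_mult_tendsto_pos[OF tendsto_const 1(2)]
            filterlim_at_top_mono[OF filterlim_real_sequentially]) auto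
    qed
    then show ?thesis unfolding e using 1 by (simp add: tsallis_term_def)
  next
    case 2
    then show ?thesis by (simp add: tsallis_term_def)
  next
    case 3
    define u where "u = b / a"
    have u: "u > 0" using 3 by (simp add: u_def)
    have "((\<lambda>s. u powr s) has_real_derivative u powr 0 * ln u) (at 0)"
      using u by (auto intro!: derivative_eq_intros)
    then have d: "((\<lambda>s. (u powr s - 1) / s) \<longlongrightarrow> ln u) (at 0)"
      using u by (simp add: has_field_derivative_iff)
    note lim = filterlim_compose[OF d filterlim_inverse_at_0]
    have "tsallis_term (1 - 1 / (real n + 2)) a b =
        ennreal (b - a - a * ((u powr (1 / (real n + 2)) - 1) / (1 / (real n + 2))))" for n
    proof -
      define s where "s = 1 / (real n + 2)"
      have s: "s > 0" by (simp add: s_def)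
      have e: "a powr (1 - s) * b powr s = a * u powr s"
        using 3 by (simp add: u_def powr_divide powr_diff)
      have "((1 - s) * a + s * b - a * u powr s) / s = b - a - a * ((u powr s - 1) / s)"
        using s by (simp add: field_simps)
      then show ?thesis using s e unfolding s_def[symmetric] by (simp add: tsallis_term_def)
    qed
    moreover have "(\<lambda>n. ennreal (b - a - a * ((u powr (1 / (real n + 2)) - 1) / (1 / (real n + 2)))))
        \<longlonglongrightarrow> ennreal (b - a - a * ln u)"
      by (intro tendsto_ennrealI tendsto_intros lim)
    moreover have "tsallis_term 1 a b = ennreal (b - a - a * ln u)"
      using 3 by (simp add: tsallis_term_def u_def ln_div algebra_simps)
    ultimately show ?thesis by simp
  qed
qed

lemma tsallis_term_tendsto_0:
  assumes ab: "a \<ge> 0" "b \<ge> 0" and \<beta>: "\<And>n. 0 < \<beta> n" "\<And>n. \<beta> n < 1" "\<beta> \<longlonglongrightarrow> 0"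
  shows "(\<lambda>n. tsallis_term (\<beta> n) a b) \<longlonglongrightarrow> tsallis_term 0 a b"
proof -
  have "\<beta> n \<noteq> 1" "\<not> 1 \<le> \<beta> n" for n using \<beta>(2)[of n] by auto
  then have e: "tsallis_term (\<beta> n) a b =
      ennreal ((\<beta> n * a + (1 - \<beta> n) * b - a powr \<beta> n * b powr (1 - \<beta> n)) / (1 - \<beta> n))" for n
    by (simp add: tsallis_term_def)
  have lim: "(\<lambda>n. a powr \<beta> n * b powr (1 - \<beta> n)) \<longlonglongrightarrow> a powr 0 * b powr (1 - 0)"
  \<comment> \<open>\<open>powr\<close> is not continuous at (0, 0), but for a = 0 or b = 0 the
    product is constantly 0, and so is the right-hand side since
    \<open>0 powr 0 = 0\<close>.\<close>
  proof (cases "a = 0 \<or> b = 0")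
    case False
    then show ?thesis using \<beta> by (intro tendsto_intros) auto
  qed auto
  have "(\<lambda>n. tsallis_term (\<beta> n) a b) \<longlonglongrightarrow> ennreal ((0 * a + (1 - 0) * b - a powr 0 * b powr (1 - 0)) / (1 - 0))"
    unfolding e
    by (intro tendsto_ennrealI tendsto_divide tendsto_diff lim tendsto_add tendsto_mult[OF _ tendsto_const] tendsto_const \<beta>) auto
  then show ?thesis by (simp add: tsallis_term_def)
qed

section \<open>Divergences as integrals of nonnegative functions\<close>

definition tsallis_integral :: "real \<Rightarrow> 'a measure \<Rightarrow> ('a \<Rightarrow> real) \<Rightarrow> ('a \<Rightarrow> real) \<Rightarrow> ennreal" where
  "tsallis_integral \<alpha> \<nu> f g = (\<integral>\<^sup>+x. tsallis_term \<alpha> (f x) (g x) \<partial>\<nu>)"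

lemma tsallis_term_conv_ereal:
  assumes "\<alpha> > 0" "a \<ge> 0" "b \<ge> 0"
  shows "enn2ereal (tsallis_term \<alpha> a b) =
    (if \<alpha> = 1 then log_term a b + ereal (b - a)
     else (ereal (\<alpha> * a + (1 - \<alpha>) * b) - power_term \<alpha> a b) / ereal (1 - \<alpha>))"
proof (cases "\<alpha> = 1")
  case True
  have "0 \<le> a * ln (a / b) + b - a" if "a > 0" "b > 0"
  proof -
    have "ln (b / a) \<le> b / a - 1" using that by (intro ln_le_minus_one) auto
    then have "a * ln (b / a) \<le> a * (b / a - 1)" using that by (intro mult_left_mono) auto
    then show ?thesis using that by (simp add: ln_div algebra_simps)
  qed
  then show ?thesis using True assms
    by (auto simp: tsallis_term_def log_term_def enn2ereal_ennreal)
next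
  case False
  show ?thesis
  proof (cases "\<alpha> > 1 \<and> b = 0 \<and> a \<noteq> 0")
    case True
    then show ?thesis using assms by (auto simp: tsallis_term_def power_term_def)
  next
    case F: False
    have e: "power_term \<alpha> a b = ereal (a powr \<alpha> * b powr (1 - \<alpha>))"
      using F False assms by (auto simp: power_term_def powr_diff powr_minus divide_simps)
    have "tsallis_term \<alpha> a b = ennreal ((\<alpha> * a + (1 - \<alpha>) * b - a powr \<alpha> * b powr (1 - \<alpha>)) / (1 - \<alpha>))"
      using F False assms by (auto simp: tsallis_term_def)
    then show ?thesis
      using tsallis_numerator_nonneg[OF _ False assms(2,3) F] assms False
      by (simp add: e enn2ereal_ennreal)
  qed
qed

lemma ereal_integral_enn2ereal:
  assumes "\<And>x. x \<in> space M \<Longrightarrow> h x = enn2ereal (u x)"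
  shows "ereal_integral M h = enn2ereal (\<integral>\<^sup>+x. u x \<partial>M)"
proof -
  have "(\<integral>\<^sup>+x. e2ennreal (h x) \<partial>M) = (\<integral>\<^sup>+x. u x \<partial>M)"
    using assms by (intro nn_integral_cong) simp
  moreover have "(\<integral>\<^sup>+x. e2ennreal (- h x) \<partial>M) = (\<integral>\<^sup>+x. 0 \<partial>M)"
    using assms by (intro nn_integral_cong) (simp add: e2ennreal_neg)
  ultimately show ?thesis by (simp add: ereal_integral_def zero_ennreal.rep_eq)
qed

lemma tsallis_formula_conv:
  assumes "\<alpha> \<ge> 0" and [measurable]: "f \<in> borel_measurable \<nu>" "g \<in> borel_measurable \<nu>"
    and pos: "\<And>x. x \<in> space \<nu> \<Longrightarrow> 0 \<le> f x" "\<And>x. x \<in> space \<nu> \<Longrightarrow> 0 \<le> g x"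
  shows "tsallis_formula \<alpha> \<nu> f g = enn2ereal (tsallis_integral \<alpha> \<nu> f g)"
proof (cases "\<alpha> = 0")
  case True
  have "emeasure (density \<nu> (\<lambda>x. ennreal (g x))) {x \<in> space \<nu>. f x = 0} = tsallis_integral 0 \<nu> f g"
    unfolding tsallis_integral_def using pos
    by (subst emeasure_density) (auto intro!: nn_integral_cong simp: tsallis_term_def indicator_def)
  then show ?thesis using True by (simp add: tsallis_formula_def)
next
  case False
  then show ?thesis
    unfolding tsallis_formula_def tsallis_integral_def using assms(1) pos
    by (auto intro!: ereal_integral_enn2ereal simp: tsallis_term_conv_ereal)
qed

lemma tsallis_divergence_conv:
  assumes "\<alpha> \<ge> 0" "densities_of \<Lambda> \<mu> \<nu> f g"
  shows "tsallis_divergence \<alpha> \<Lambda> \<mu> = enn2ereal (tsallis_integral \<alpha> \<nu> f g)"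
  unfolding tsallis_divergence_eq[OF assms(2)]
  by (rule tsallis_formula_conv) (use assms in \<open>auto simp: densities_of_def\<close>)

lemma power_term_conv_ereal:
  assumes "a \<ge> 0" "b \<ge> 0" "\<alpha> \<noteq> 1"
  shows "power_term \<alpha> a b = enn2ereal (power_enn \<alpha> a b)"
  using assms by (auto simp: power_term_def power_enn_def enn2ereal_ennreal zero_ennreal.rep_eq powr_diff powr_minus divide_simps)

text \<open>Solving for one term would need truncated subtraction, hence the additive form. In the
  companion for \<alpha> > 1 the terms change sides with the sign of 1 - \<alpha>, and both sides
  may be infinite.\<close>

lemma power_enn_tsallis_term_lt_1:
  assumes "0 < \<alpha>" "\<alpha> < 1" "a \<ge> 0" "b \<ge> 0"
  shows "ennreal (1 - \<alpha>) * tsallis_term \<alpha> a b + power_enn \<alpha> a b = ennreal (\<alpha> * a) + ennreal ((1 - \<alpha>) * b)"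
proof -
  define t where "t = (\<alpha> * a + (1 - \<alpha>) * b - a powr \<alpha> * b powr (1 - \<alpha>)) / (1 - \<alpha>)"
  have "0 \<le> t"
    unfolding t_def using assms by (intro tsallis_numerator_nonneg) auto
  moreover have "(1 - \<alpha>) * t + a powr \<alpha> * b powr (1 - \<alpha>) = \<alpha> * a + (1 - \<alpha>) * b"
    using assms by (simp add: t_def)
  moreover have "tsallis_term \<alpha> a b = ennreal t" "power_enn \<alpha> a b = ennreal (a powr \<alpha> * b powr (1 - \<alpha>))"
    using assms by (simp_all add: tsallis_term_def power_enn_def t_def)
  ultimately show ?thesis
    using assms by (simp flip: ennreal_mult ennreal_plus)
qed

lemma power_enn_tsallis_term_gt_1:
  assumes "1 < \<alpha>" "a \<ge> 0" "b \<ge> 0"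
  shows "power_enn \<alpha> a b + ennreal ((\<alpha> - 1) * b) = ennreal (\<alpha> - 1) * tsallis_term \<alpha> a b + ennreal (\<alpha> * a)"
proof (cases "b = 0 \<and> a \<noteq> 0")
  case True
  then show ?thesis using assms by (simp add: tsallis_term_def power_enn_def ennreal_mult_top)
next
  case False
  define t where "t = (\<alpha> * a + (1 - \<alpha>) * b - a powr \<alpha> * b powr (1 - \<alpha>)) / (1 - \<alpha>)"
  have "0 \<le> t" unfolding t_def using assms False by (intro tsallis_numerator_nonneg) auto
  moreover have "a powr \<alpha> * b powr (1 - \<alpha>) + (\<alpha> - 1) * b = (\<alpha> - 1) * t + \<alpha> * a"
    using assms by (simp add: t_def field_simps)
  moreover have "tsallis_term \<alpha> a b = ennreal t" "power_enn \<alpha> a b = ennreal (a powr \<alpha> * b powr (1 - \<alpha>))"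
    using assms False by (auto simp: tsallis_term_def power_enn_def t_def)
  ultimately show ?thesis
    using assms by (simp flip: ennreal_mult ennreal_plus)
qed

locale dominated_pair =
  fixes \<Lambda> \<mu> \<nu> :: "'a measure" and f g :: "'a \<Rightarrow> real"
  assumes dens: "densities_of \<Lambda> \<mu> \<nu> f g"
begin

lemma meas_f[measurable]: "f \<in> borel_measurable \<nu>" and meas_g[measurable]: "g \<in> borel_measurable \<nu>"
  and f_nonneg: "\<And>x. x \<in> space \<nu> \<Longrightarrow> 0 \<le> f x" and g_nonneg: "\<And>x. x \<in> space \<nu> \<Longrightarrow> 0 \<le> g x"
  and L_eq: "\<Lambda> = density \<nu> (\<lambda>x. ennreal (f x))" and M_eq: "\<mu> = density \<nu> (\<lambda>x. ennreal (g x))"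
  using dens unfolding densities_of_def by blast+

lemma sets_eq[simp]: "sets \<Lambda> = sets \<nu>" "sets \<mu> = sets \<nu>"
  and space_eq[simp]: "space \<Lambda> = space \<nu>" "space \<mu> = space \<nu>"
  by (subst L_eq M_eq, simp)+

lemma emeasure_L: "C \<in> sets \<nu> \<Longrightarrow> emeasure \<Lambda> C = (\<integral>\<^sup>+x. ennreal (f x) * indicator C x \<partial>\<nu>)"
  and emeasure_M: "C \<in> sets \<nu> \<Longrightarrow> emeasure \<mu> C = (\<integral>\<^sup>+x. ennreal (g x) * indicator C x \<partial>\<nu>)"
  by (subst L_eq M_eq, simp add: emeasure_density)+

end

locale dominated_prob_pair = dominated_pair P Q m p q + P: prob_space P + Q: prob_space Q
  for P Q m :: "'a measure" and p q :: "'a \<Rightarrow> real"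
begin

lemma int_p: "(\<integral>\<^sup>+x. ennreal (p x) \<partial>m) = 1" and int_q: "(\<integral>\<^sup>+x. ennreal (q x) \<partial>m) = 1"
proof -
  have "emeasure P (space m) = (\<integral>\<^sup>+x. ennreal (p x) \<partial>m)" "emeasure Q (space m) = (\<integral>\<^sup>+x. ennreal (q x) \<partial>m)"
    by (simp_all add: emeasure_L emeasure_M cong: nn_integral_cong_simp)
  then show "(\<integral>\<^sup>+x. ennreal (p x) \<partial>m) = 1" "(\<integral>\<^sup>+x. ennreal (q x) \<partial>m) = 1"
    using P.emeasure_space_1 Q.emeasure_space_1 by simp_all
qed

lemma power_integral_lt_1:
  assumes "0 < \<alpha>" "\<alpha> < 1"
  shows "ennreal (1 - \<alpha>) * tsallis_integral \<alpha> m p q + (\<integral>\<^sup>+x. power_enn \<alpha> (p x) (q x) \<partial>m) = 1"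
proof -
  have "ennreal (1 - \<alpha>) * tsallis_integral \<alpha> m p q + (\<integral>\<^sup>+x. power_enn \<alpha> (p x) (q x) \<partial>m) =
    (\<integral>\<^sup>+x. ennreal (1 - \<alpha>) * tsallis_term \<alpha> (p x) (q x) + power_enn \<alpha> (p x) (q x) \<partial>m)"
    unfolding tsallis_integral_def by (simp add: nn_integral_add nn_integral_cmult)
  also have "\<dots> = (\<integral>\<^sup>+x. ennreal \<alpha> * ennreal (p x) + ennreal (1 - \<alpha>) * ennreal (q x) \<partial>m)"
    using assms by (intro nn_integral_cong)
      (simp add: power_enn_tsallis_term_lt_1 f_nonneg g_nonneg ennreal_mult)
  also have "\<dots> = ennreal \<alpha> + ennreal (1 - \<alpha>)"
    by (simp add: nn_integral_add nn_integral_cmult int_p int_q)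
  also have "\<dots> = 1" using assms by (simp flip: ennreal_plus)
  finally show ?thesis .
qed

lemma power_integral_gt_1:
  assumes "1 < \<alpha>"
  shows "(\<integral>\<^sup>+x. power_enn \<alpha> (p x) (q x) \<partial>m) = 1 + ennreal (\<alpha> - 1) * tsallis_integral \<alpha> m p q"
proof -
  have "(\<integral>\<^sup>+x. power_enn \<alpha> (p x) (q x) \<partial>m) + ennreal (\<alpha> - 1) =
    (\<integral>\<^sup>+x. power_enn \<alpha> (p x) (q x) + ennreal (\<alpha> - 1) * ennreal (q x) \<partial>m)"
    by (simp add: nn_integral_add nn_integral_cmult int_q)
  also have "\<dots> = (\<integral>\<^sup>+x. ennreal (\<alpha> - 1) * tsallis_term \<alpha> (p x) (q x) + ennreal \<alpha> * ennreal (p x) \<partial>m)"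
    using assms by (intro nn_integral_cong)
      (simp add: power_enn_tsallis_term_gt_1 f_nonneg g_nonneg flip: ennreal_mult)
  also have "\<dots> = ennreal (\<alpha> - 1) * tsallis_integral \<alpha> m p q + ennreal \<alpha>"
    unfolding tsallis_integral_def by (simp add: nn_integral_add nn_integral_cmult int_p)
  also have "ennreal \<alpha> = 1 + ennreal (\<alpha> - 1)"
    using assms by (simp flip: ennreal_plus ennreal_1)
  finally show ?thesis by (simp add: add_ac)
qed

lemma renyi_divergence_conv_power:
  assumes "\<alpha> > 0" "\<alpha> \<noteq> 1"
  shows "renyi_divergence \<alpha> P Q =
    ereal (1 / (\<alpha> - 1)) * ln_ereal (enn2ereal (\<integral>\<^sup>+x. power_enn \<alpha> (p x) (q x) \<partial>m))"
proof -
  have "ereal_integral m (\<lambda>x. power_term \<alpha> (p x) (q x)) = enn2ereal (\<integral>\<^sup>+x. power_enn \<alpha> (p x) (q x) \<partial>m)"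
    using assms by (intro ereal_integral_enn2ereal power_term_conv_ereal) (auto simp: f_nonneg g_nonneg)
  then show ?thesis
    unfolding renyi_divergence_eq[OF dens] using assms by (simp add: renyi_formula_def)
qed

text \<open>The two integrands differ by q - p, of integral zero, but that of the Renyi divergence
  is signed. Its negative part is at most q, hence has a finite integral that may be
  subtracted.\<close>

lemma renyi_divergence_1: "renyi_divergence 1 P Q = enn2ereal (tsallis_integral 1 m p q)"
proof -
  let ?L = "\<lambda>x. log_term (p x) (q x)"
  have t: "enn2ereal (tsallis_term 1 (p x) (q x)) = ?L x + ereal (q x - p x)" if "x \<in> space m" for x
    using that by (simp add: tsallis_term_conv_ereal f_nonneg g_nonneg)
  \<comment> \<open>Moving p and the negative part to the left leaves only nonnegative terms, so the
    identity also holds where the logarithmic term is infinite.\<close>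
  have "tsallis_term 1 (p x) (q x) + ennreal (p x) + e2ennreal (- ?L x) = e2ennreal (?L x) + ennreal (q x)"
    if x: "x \<in> space m" for x
  proof (cases "?L x")
    case (real l)
    have nn: "0 \<le> l + (q x - p x)" using t[OF x] real
      by (metis enn2ereal_nonneg ereal_less_eq(5) plus_ereal.simps(1))
    have "tsallis_term 1 (p x) (q x) = ennreal (l + (q x - p x))"
      using t[OF x] real by (metis e2ennreal_enn2ereal ennreal.abs_eq plus_ereal.simps(1) e2ennreal_ereal)
    then show ?thesis using nn f_nonneg[OF x] g_nonneg[OF x] real
      by (cases "l \<ge> 0") (simp_all add: ennreal_neg flip: ennreal_plus)
  next
    case PInf
    then have "e2ennreal (enn2ereal (tsallis_term 1 (p x) (q x))) = \<infinity>" unfolding t[OF x] by simp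
    then have "tsallis_term 1 (p x) (q x) = \<infinity>" by simp
    then show ?thesis using PInf by simp
  next
    case MInf
    then show ?thesis by (auto simp: log_term_def split: if_splits)
  qed
  then have "(\<integral>\<^sup>+x. tsallis_term 1 (p x) (q x) + ennreal (p x) + e2ennreal (- ?L x) \<partial>m) =
      (\<integral>\<^sup>+x. e2ennreal (?L x) + ennreal (q x) \<partial>m)"
    by (intro nn_integral_cong) auto
  then have eq: "tsallis_integral 1 m p q + 1 + (\<integral>\<^sup>+x. e2ennreal (- ?L x) \<partial>m) = (\<integral>\<^sup>+x. e2ennreal (?L x) \<partial>m) + 1"
    unfolding tsallis_integral_def by (simp add: nn_integral_add int_p int_q)
  have "(\<integral>\<^sup>+x. e2ennreal (- ?L x) \<partial>m) \<le> (\<integral>\<^sup>+x. ennreal (q x) \<partial>m)"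
  proof (intro nn_integral_mono)
    fix x assume x: "x \<in> space m"
    have "0 \<le> ?L x + ereal (q x - p x)" using t[OF x] by (metis enn2ereal_nonneg)
    then have "- ?L x \<le> ereal (q x)" using f_nonneg[OF x] by (cases "?L x") auto
    then show "e2ennreal (- ?L x) \<le> ennreal (q x)"
      by (metis e2ennreal_ereal e2ennreal_mono)
  qed
  then have fin: "(\<integral>\<^sup>+x. e2ennreal (- ?L x) \<partial>m) < top" using int_q by (simp add: less_top[symmetric])
     (metis ennreal_one_neq_top neq_top_trans)
  define N where "N = (\<integral>\<^sup>+x. e2ennreal (- ?L x) \<partial>m)"
  from eq have "tsallis_integral 1 m p q + N = (\<integral>\<^sup>+x. e2ennreal (?L x) \<partial>m)"
    unfolding N_def[symmetric] by (simp add: add_ac)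
  then have "enn2ereal (\<integral>\<^sup>+x. e2ennreal (?L x) \<partial>m) = enn2ereal (tsallis_integral 1 m p q) + enn2ereal N"
    by (metis plus_ennreal.rep_eq)
  moreover have "\<bar>enn2ereal N\<bar> \<noteq> \<infinity>" using fin unfolding N_def by (cases "\<integral>\<^sup>+x. e2ennreal (- ?L x) \<partial>m") auto
  ultimately have "ereal_integral m ?L = enn2ereal (tsallis_integral 1 m p q)"
    unfolding ereal_integral_def N_def[symmetric]
    by (cases "enn2ereal N"; cases "enn2ereal (tsallis_integral 1 m p q)") auto
  then show ?thesis
    unfolding renyi_divergence_eq[OF dens] by (simp add: renyi_formula_def)
qed

lemma renyi_divergence_0:
  "renyi_divergence 0 P Q = - ln_ereal (enn2ereal (1 - tsallis_integral 0 m p q))"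
proof -
  have "emeasure (density m (\<lambda>x. ennreal (q x))) {x \<in> space m. 0 < p x} + tsallis_integral 0 m p q
    = (\<integral>\<^sup>+x. ennreal (q x) * indicator {x \<in> space m. 0 < p x} x \<partial>m) + (\<integral>\<^sup>+x. tsallis_term 0 (p x) (q x) \<partial>m)"
    unfolding tsallis_integral_def by (subst emeasure_density) auto
  also have "\<dots> = (\<integral>\<^sup>+x. ennreal (q x) * indicator {x \<in> space m. 0 < p x} x + tsallis_term 0 (p x) (q x) \<partial>m)"
    by (subst nn_integral_add) auto
  also have "\<dots> = (\<integral>\<^sup>+x. ennreal (q x) \<partial>m)"
    using f_nonneg g_nonneg by (intro nn_integral_cong) (auto simp: tsallis_term_def indicator_def less_le)
  finally have "emeasure (density m (\<lambda>x. ennreal (q x))) {x \<in> space m. 0 < p x} + tsallis_integral 0 m p q = 1"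
    by (simp add: int_q)
  then have "emeasure (density m (\<lambda>x. ennreal (q x))) {x \<in> space m. 0 < p x} = 1 - tsallis_integral 0 m p q"
    by (metis ennreal_add_diff_cancel_right ennreal_add_eq_top ennreal_one_neq_top)
  then show ?thesis
    unfolding renyi_divergence_eq[OF dens] by (simp add: renyi_formula_def)
qed

end

section \<open>Variational representation\<close>

text \<open>The level sets of \<open>J\<close> split the space into finitely many measurable pieces,
  on each of which one fixed function is maximal; the functions will be tangents.\<close>

lemma ex_measurable_argmax:
  fixes u :: "nat \<Rightarrow> 'a \<Rightarrow> real"
  assumes [measurable]: "\<And>i. u i \<in> borel_measurable M"
  shows "\<exists>J\<in>measurable M (count_space UNIV).
    \<forall>x. J x \<in> {1..Suc n} \<and> (\<forall>i\<in>{1..Suc n}. u i x \<le> u (J x) x)"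
proof (induction n)
  case 0
  then show ?case by (intro bexI[of _ "\<lambda>_. 1"]) auto
next
  case (Suc n)
  then obtain J where J[measurable]: "J \<in> measurable M (count_space UNIV)"
    and J': "\<And>x. J x \<in> {1..Suc n}" "\<And>x i. i \<in> {1..Suc n} \<Longrightarrow> u i x \<le> u (J x) x" by blast
  have [measurable]: "(\<lambda>x. u (J x) x) \<in> borel_measurable M"
    by (rule measurable_compose_countable'[OF _ J]) auto
  define K where "K x = (if u (J x) x < u (Suc (Suc n)) x then Suc (Suc n) else J x)" for x
  have "K \<in> measurable M (count_space UNIV)"
    unfolding K_def by measurable
  moreover have "K x \<in> {1..Suc (Suc n)} \<and> (\<forall>i\<in>{1..Suc (Suc n)}. u i x \<le> u (K x) x)" for x
  proof (intro conjI ballI)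
    show "K x \<in> {1..Suc (Suc n)}" using J'(1)[of x] by (auto simp: K_def)
    fix i assume "i \<in> {1..Suc (Suc n)}"
    then consider "i = Suc (Suc n)" | "i \<in> {1..Suc n}" by fastforce
    then show "u i x \<le> u (K x) x"
    proof cases
      case 1
      then show ?thesis by (simp add: K_def)
    next
      case 2
      then show ?thesis using J'(2)[OF 2, of x] by (simp add: K_def)
    qed
  qed
  ultimately show ?case by blast
qed

text \<open>\<open>ennreal\<close> sends negative reals to 0, so on sums of mixed sign it is only
  subadditive; passing to positive parts makes this precise.\<close>

lemma sum_tangent_le:
  assumes "\<alpha> > 0" "\<alpha> \<noteq> 1" "\<And>j. j \<in> J \<Longrightarrow> 0 < r j" "\<And>j. j \<in> J \<Longrightarrow> 0 \<le> a j" "\<And>j. j \<in> J \<Longrightarrow> 0 \<le> b j"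
  shows "ennreal (\<Sum>j\<in>J. tangent \<alpha> (r j) (a j) (b j)) \<le> (\<Sum>j\<in>J. tsallis_term \<alpha> (a j) (b j))"
proof -
  have "ennreal (\<Sum>j\<in>J. tangent \<alpha> (r j) (a j) (b j)) \<le> ennreal (\<Sum>j\<in>J. max 0 (tangent \<alpha> (r j) (a j) (b j)))"
    by (intro ennreal_leI sum_mono) auto
  also have "\<dots> = (\<Sum>j\<in>J. ennreal (max 0 (tangent \<alpha> (r j) (a j) (b j))))"
    by (rule sum_ennreal[symmetric]) auto
  also have "\<dots> = (\<Sum>j\<in>J. ennreal (tangent \<alpha> (r j) (a j) (b j)))"
    by (intro sum.cong) (auto simp: max_def ennreal_neg)
  also have "\<dots> \<le> (\<Sum>j\<in>J. tsallis_term \<alpha> (a j) (b j))"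
    using assms by (intro sum_mono tangent_le) auto
  finally show ?thesis .
qed

lemma ex_common_exhaustion:
  assumes sf: "sigma_finite_measure \<Lambda>" "sigma_finite_measure \<mu>" and sets_eq: "sets \<mu> = sets \<Lambda>"
  obtains S :: "nat \<Rightarrow> 'a set" where "incseq S" "(\<Union>i. S i) = space \<Lambda>" "\<And>i. S i \<in> sets \<Lambda>"
    "\<And>i. emeasure \<Lambda> (S i) < \<infinity>" "\<And>i. emeasure \<mu> (S i) < \<infinity>"
proof -
  have space_eq: "space \<mu> = space \<Lambda>" by (rule sets_eq_imp_space_eq) fact
  obtain A where A: "range A \<subseteq> sets \<Lambda>" "(\<Union>i::nat. A i) = space \<Lambda>" "\<And>i. emeasure \<Lambda> (A i) \<noteq> \<infinity>" "incseq A"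
    using sigma_finite_measure.sigma_finite_incseq[OF sf(1)] by auto
  obtain B where B: "range B \<subseteq> sets \<Lambda>" "(\<Union>i::nat. B i) = space \<Lambda>" "\<And>i. emeasure \<mu> (B i) \<noteq> \<infinity>" "incseq B"
    using sigma_finite_measure.sigma_finite_incseq[OF sf(2)] sets_eq space_eq by auto
  show ?thesis
  proof (rule that[of "\<lambda>i. A i \<inter> B i"])
    have mono: "A i \<inter> B i \<subseteq> A j \<inter> B j" if "i \<le> j" for i j
      by (rule Int_mono[OF incseqD[OF A(4) that] incseqD[OF B(4) that]])
    then show "incseq (\<lambda>i. A i \<inter> B i)" by (simp add: incseq_def)
    show "(\<Union>i. A i \<inter> B i) = space \<Lambda>"
    proof
      show "(\<Union>i. A i \<inter> B i) \<subseteq> space \<Lambda>" using A(2) by auto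
      show "space \<Lambda> \<subseteq> (\<Union>i. A i \<inter> B i)"
      proof
        fix x assume x: "x \<in> space \<Lambda>"
        then obtain i j where "x \<in> A i" "x \<in> B j" using A(2) B(2) by blast
        then have "x \<in> A (max i j) \<inter> B (max i j)"
          using incseqD[OF A(4), of i "max i j"] incseqD[OF B(4), of j "max i j"] by auto
        then show "x \<in> (\<Union>i. A i \<inter> B i)" by blast
      qed
    qed
    fix i
    have s: "A i \<in> sets \<Lambda>" "B i \<in> sets \<Lambda>" using A(1) B(1) by auto
    then show "A i \<inter> B i \<in> sets \<Lambda>" by simp
    show "emeasure \<Lambda> (A i \<inter> B i) < \<infinity>" "emeasure \<mu> (A i \<inter> B i) < \<infinity>"
      using A(3)[of i] B(3)[of i] s sets_eq emeasure_mono[of "A i \<inter> B i" "A i" \<Lambda>] emeasure_mono[of "A i \<inter> B i" "B i" \<mu>]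
      by (auto simp: less_top[symmetric] top_unique)
  qed
qed

context dominated_pair
begin

lemma measurable_tangent[measurable]: "(\<lambda>x. tangent \<alpha> r (f x) (g x)) \<in> borel_measurable \<nu>"
  unfolding tangent_def by measurable

text \<open>A tangent is linear in (a, b), so integrating it over \<open>C\<close> amounts to
  evaluating it at the measures of \<open>C\<close>; their finiteness makes both parts
  integrable.\<close>

lemma has_integral_tangent:
  assumes C[measurable]: "C \<in> sets \<nu>" and fin: "emeasure \<Lambda> C < \<infinity>" "emeasure \<mu> C < \<infinity>"
  shows "has_bochner_integral \<nu> (\<lambda>x. indicator C x * tangent \<alpha> r (f x) (g x))
     (tangent \<alpha> r (measure \<Lambda> C) (measure \<mu> C))"
proof -
  have F: "has_bochner_integral \<nu> (\<lambda>x. f x * indicator C x) (measure \<Lambda> C)"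
  proof (rule has_bochner_integral_nn_integral)
    have "(\<integral>\<^sup>+x. ennreal (f x * indicator C x) \<partial>\<nu>) = (\<integral>\<^sup>+x. ennreal (f x) * indicator C x \<partial>\<nu>)"
      by (intro nn_integral_cong) (auto simp: indicator_def)
    then show "(\<integral>\<^sup>+x. ennreal (f x * indicator C x) \<partial>\<nu>) = ennreal (measure \<Lambda> C)"
      using fin by (simp add: emeasure_L[symmetric] emeasure_eq_ennreal_measure)
  qed (auto simp: f_nonneg)
  have G: "has_bochner_integral \<nu> (\<lambda>x. g x * indicator C x) (measure \<mu> C)"
  proof (rule has_bochner_integral_nn_integral)
    have "(\<integral>\<^sup>+x. ennreal (g x * indicator C x) \<partial>\<nu>) = (\<integral>\<^sup>+x. ennreal (g x) * indicator C x \<partial>\<nu>)"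
      by (intro nn_integral_cong) (auto simp: indicator_def)
    then show "(\<integral>\<^sup>+x. ennreal (g x * indicator C x) \<partial>\<nu>) = ennreal (measure \<mu> C)"
      using fin by (simp add: emeasure_M[symmetric] emeasure_eq_ennreal_measure)
  qed (auto simp: g_nonneg)
  have "has_bochner_integral \<nu> (\<lambda>x. \<alpha> * (1 - r powr (\<alpha> - 1)) / (1 - \<alpha>) * (f x * indicator C x)
      + (1 - r powr \<alpha>) * (g x * indicator C x)) (tangent \<alpha> r (measure \<Lambda> C) (measure \<mu> C))"
    unfolding tangent_def
    by (intro has_bochner_integral_add has_bochner_integral_mult_right F G)
  then show ?thesis
    by (rule has_bochner_integral_cong[THEN iffD1, rotated -1]) (auto simp: tangent_def algebra_simps)
qed

lemma tangent_measure_le: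
  assumes \<alpha>: "\<alpha> > 0" "\<alpha> \<noteq> 1" and r: "r > 0"
    and C[measurable]: "C \<in> sets \<nu>" and fin: "emeasure \<Lambda> C < \<infinity>" "emeasure \<mu> C < \<infinity>"
  shows "ennreal (tangent \<alpha> r (measure \<Lambda> C) (measure \<mu> C)) \<le> (\<integral>\<^sup>+x\<in>C. tsallis_term \<alpha> (f x) (g x) \<partial>\<nu>)"
proof -
  let ?h = "\<lambda>x. indicator C x * tangent \<alpha> r (f x) (g x)"
  have h: "integrable \<nu> ?h" "integral\<^sup>L \<nu> ?h = tangent \<alpha> r (measure \<Lambda> C) (measure \<mu> C)"
    using has_integral_tangent[OF C fin] by (auto simp: has_bochner_integral_iff)
  have "ennreal (integral\<^sup>L \<nu> ?h) \<le> ennreal (\<integral>x. max 0 (?h x) \<partial>\<nu>)"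
    using h(1) by (intro ennreal_leI integral_mono) auto
  also have "\<dots> = (\<integral>\<^sup>+x. ennreal (max 0 (?h x)) \<partial>\<nu>)"
    using h(1) by (intro nn_integral_eq_integral[symmetric]) auto
  also have "\<dots> \<le> (\<integral>\<^sup>+x\<in>C. tsallis_term \<alpha> (f x) (g x) \<partial>\<nu>)"
  proof (intro nn_integral_mono)
    fix x assume "x \<in> space \<nu>"
    then show "ennreal (max 0 (?h x)) \<le> tsallis_term \<alpha> (f x) (g x) * indicator C x"
      using tangent_le[OF \<alpha> r f_nonneg g_nonneg, of x x]
      by (auto simp: indicator_def max_def split: if_splits)
  qed
  finally show ?thesis unfolding h(2) .
qed

text \<open>Jensen's inequality for a convex, positively homogeneous integrand: every tangent
  satisfies it by linearity, and the supremum over slopes is taken last.\<close>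

lemma tsallis_measure_le:
  assumes \<alpha>: "\<alpha> > 0" "\<alpha> \<noteq> 1"
    and C: "C \<in> sets \<nu>" and fin: "emeasure \<Lambda> C < \<infinity>" "emeasure \<mu> C < \<infinity>"
  shows "tsallis_term \<alpha> (measure \<Lambda> C) (measure \<mu> C) \<le> (\<integral>\<^sup>+x\<in>C. tsallis_term \<alpha> (f x) (g x) \<partial>\<nu>)"
  using tangent_measure_le[OF \<alpha> _ C fin] by (intro tsallis_term_le_if_tangent_le \<alpha>) auto

lemma sum_tsallis_measure_le:
  fixes C :: "nat \<Rightarrow> 'a set"
  assumes \<alpha>: "\<alpha> > 0" "\<alpha> \<noteq> 1"
    and C: "\<And>j. j \<in> J \<Longrightarrow> C j \<in> sets \<nu>"
    and fin: "\<And>j. j \<in> J \<Longrightarrow> emeasure \<Lambda> (C j) < \<infinity>" "\<And>j. j \<in> J \<Longrightarrow> emeasure \<mu> (C j) < \<infinity>"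
    and J: "finite J" "disjoint_family_on C J"
  shows "(\<Sum>j\<in>J. tsallis_term \<alpha> (measure \<Lambda> (C j)) (measure \<mu> (C j))) \<le> tsallis_integral \<alpha> \<nu> f g"
proof -
  have "(\<Sum>j\<in>J. tsallis_term \<alpha> (measure \<Lambda> (C j)) (measure \<mu> (C j))) \<le>
    (\<Sum>j\<in>J. \<integral>\<^sup>+x\<in>C j. tsallis_term \<alpha> (f x) (g x) \<partial>\<nu>)"
    by (intro sum_mono tsallis_measure_le assms)
  also have "\<dots> = (\<integral>\<^sup>+x. (\<Sum>j\<in>J. tsallis_term \<alpha> (f x) (g x) * indicator (C j) x) \<partial>\<nu>)"
    using C by (intro nn_integral_sum[symmetric]) auto
  also have "\<dots> \<le> (\<integral>\<^sup>+x. tsallis_term \<alpha> (f x) (g x) \<partial>\<nu>)"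
  proof (intro nn_integral_mono)
    fix x
    have "(\<Sum>j\<in>J. indicator (C j) x) = (indicator (\<Union>j\<in>J. C j) x :: ennreal)"
      by (subst indicator_UN_disjoint[OF J]) simp
    then show "(\<Sum>j\<in>J. tsallis_term \<alpha> (f x) (g x) * indicator (C j) x) \<le> tsallis_term \<alpha> (f x) (g x)"
      by (simp add: sum_distrib_left[symmetric] indicator_def)
  qed
  finally show ?thesis by (simp add: tsallis_integral_def)
qed

text \<open>Maxima of finitely many tangents, cut off to sets of finite measure, increase to the
  integrand, and each maximum is linear on every level set of its argmax. \<open>bound\<close>
  speaks of tangents with arbitrary slopes, not of \<open>tsallis_term\<close>, since linear
  expressions survive approximation of the pieces.\<close>

lemma tsallis_integral_le:
  fixes K :: ennreal
  assumes \<alpha>: "\<alpha> > 0" "\<alpha> \<noteq> 1" and sf: "sigma_finite_measure \<Lambda>" "sigma_finite_measure \<mu>"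
    and bound: "\<And>n r C. (\<And>j. j \<in> {1..n} \<Longrightarrow> C j \<in> sets \<nu>) \<Longrightarrow> (\<And>j. j \<in> {1..n} \<Longrightarrow> emeasure \<Lambda> (C j) < \<infinity>) \<Longrightarrow>
       (\<And>j. j \<in> {1..n} \<Longrightarrow> emeasure \<mu> (C j) < \<infinity>) \<Longrightarrow> (\<And>j::nat. (0::real) < r j) \<Longrightarrow>
       disjoint_family_on C {1..n} \<Longrightarrow>
       ennreal (\<Sum>j\<in>{1..n}. tangent \<alpha> (r j) (measure \<Lambda> (C j)) (measure \<mu> (C j))) \<le> K"
  shows "tsallis_integral \<alpha> \<nu> f g \<le> K"
proof -
  obtain S :: "nat \<Rightarrow> 'a set" where S': "incseq S" "(\<Union>i. S i) = space \<nu>"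
    and S[measurable]: "\<And>i. S i \<in> sets \<nu>"
    and Sfin: "\<And>i. emeasure \<Lambda> (S i) < \<infinity>" "\<And>i. emeasure \<mu> (S i) < \<infinity>"
    using ex_common_exhaustion[OF sf] by auto
  note Sinc = incseqD[OF S'(1)]
  have SU: "\<exists>k. x \<in> S k" if "x \<in> space \<nu>" for x
    using that S'(2) by blast
  let ?Q = "\<rat> \<inter> {0::real<..}"
  have Q: "countable ?Q" "?Q \<noteq> {}" using countable_rat by (auto intro!: exI[of _ 1])
  \<comment> \<open>Index 1 carries slope 1, whose tangent is zero, so every maximum over
    \<open>{1..Suc n}\<close> is nonnegative; the positive rationals are enumerated from index 2
    on.\<close>
  define r where "r i = (if i \<le> 1 then 1 else from_nat_into ?Q (i - 2))" for i :: nat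
  have r_pos: "r i > 0" for i
    using from_nat_into[OF Q(2), of "i - 2"] by (auto simp: r_def)
  have r_all: "\<exists>i\<ge>1. s = r i" if s: "s \<in> \<rat>" "s > 0" for s
  proof -
    obtain k where "s = from_nat_into ?Q k" using from_nat_into_surj[OF Q(1), of s] s by auto
    then show ?thesis by (intro exI[of _ "k + 2"]) (auto simp: r_def)
  qed
  have r1: "r 1 = 1" by (simp add: r_def)
  define u where "u i x = tangent \<alpha> (r i) (f x) (g x)" for i x
  have [measurable]: "u i \<in> borel_measurable \<nu>" for i unfolding u_def by measurable
  obtain J where J[measurable]: "\<And>n. J n \<in> measurable \<nu> (count_space UNIV)"
    and J1: "\<And>n x. J n x \<in> {1..Suc n}" and J2: "\<And>n x i. i \<in> {1..Suc n} \<Longrightarrow> u i x \<le> u (J n x) x"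
  proof -
    have "\<forall>n. \<exists>J. J \<in> measurable \<nu> (count_space UNIV) \<and>
        (\<forall>x. J x \<in> {1..Suc n} \<and> (\<forall>i\<in>{1..Suc n}. u i x \<le> u (J x) x))"
      using ex_measurable_argmax[of u \<nu>] by (auto simp: Bex_def)
    then obtain J where "\<forall>n. J n \<in> measurable \<nu> (count_space UNIV) \<and>
        (\<forall>x. J n x \<in> {1..Suc n} \<and> (\<forall>i\<in>{1..Suc n}. u i x \<le> u (J n x) x))"
      by (rule choice[THEN exE])
    then show ?thesis by (intro that[of J]) blast+
  qed
  \<comment> \<open>Nonnegativity of the maximum makes the cutoff to the growing sets
    \<open>S n\<close> monotone in n.\<close>
  define w where "w n x = indicator (S n) x * u (J n x) x" for n x
  have u_nonneg: "0 \<le> u (J n x) x" for n x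
    using J2[of 1 n x] r1 by (simp add: u_def)
  have w_mono: "w m x \<le> w n x" if "m \<le> n" for m n x
    using that u_nonneg J1[of m x] J2[of "J m x" n x] Sinc[OF that]
    unfolding w_def by (auto simp: indicator_def)
  have wm[measurable]: "w n \<in> borel_measurable \<nu>" for n
  proof -
    have [measurable]: "(\<lambda>x. u (J n x) x) \<in> borel_measurable \<nu>"
      by (rule measurable_compose_countable'[OF _ J]) auto
    show ?thesis unfolding w_def by measurable
  qed
  have "tsallis_term \<alpha> (f x) (g x) \<le> (SUP n. ennreal (w n x))" if x: "x \<in> space \<nu>" for x
  proof (rule tsallis_term_le_if_tangent_le[OF \<alpha> f_nonneg[OF x] g_nonneg[OF x]])
    fix s :: real assume "s \<in> \<rat>" "0 < s"
    then obtain i where i: "i \<ge> 1" "s = r i" using r_all by blast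
    obtain k where k: "x \<in> S k" using SU[OF x] by blast
    define n where "n = max i k"
    have "u i x \<le> w n x" using J2[of i n x] i(1) Sinc[of k n] k by (auto simp: n_def w_def)
    then have "ennreal (tangent \<alpha> s (f x) (g x)) \<le> ennreal (w n x)" by (auto simp: u_def i intro: ennreal_leI)
    then show "ennreal (tangent \<alpha> s (f x) (g x)) \<le> (SUP n. ennreal (w n x))" by (rule SUP_upper2[rotated]) simp
  qed
  then have "tsallis_integral \<alpha> \<nu> f g \<le> (\<integral>\<^sup>+x. (SUP n. ennreal (w n x)) \<partial>\<nu>)"
    unfolding tsallis_integral_def by (intro nn_integral_mono) auto
  also have "\<dots> = (SUP n. \<integral>\<^sup>+x. ennreal (w n x) \<partial>\<nu>)"
    using w_mono by (intro nn_integral_monotone_convergence_SUP)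
      (auto simp: incseq_def le_fun_def intro!: ennreal_leI)
  also have "\<dots> \<le> K"
  proof (rule SUP_least)
    fix n
    define C where "C j = {x\<in>space \<nu>. x \<in> S n \<and> J n x = j}" for j
    have C[measurable]: "C j \<in> sets \<nu>" for j unfolding C_def by measurable
    have Cfin: "emeasure \<Lambda> (C j) < \<infinity>" "emeasure \<mu> (C j) < \<infinity>" for j
      using Sfin[of n] emeasure_mono[of "C j" "S n" \<Lambda>] emeasure_mono[of "C j" "S n" \<mu>]
      by (auto simp: C_def intro: le_less_trans)
    have "w n x = (\<Sum>j\<in>{1..Suc n}. indicator (C j) x * u j x)" if x: "x \<in> space \<nu>" for x
    proof -
      have "(\<Sum>j\<in>{1..Suc n}. indicator (C j) x * u j x) =
         (\<Sum>j\<in>{1..Suc n}. if j = J n x then indicator (S n) x * u j x else 0)"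
        using x by (intro sum.cong) (auto simp: C_def indicator_def)
      also have "\<dots> = w n x" using J1[of n x] by (subst sum.delta) (auto simp: w_def)
      finally show ?thesis ..
    qed
    then have "(\<integral>\<^sup>+x. ennreal (w n x) \<partial>\<nu>) = (\<integral>\<^sup>+x. ennreal (\<Sum>j\<in>{1..Suc n}. indicator (C j) x * u j x) \<partial>\<nu>)"
      by (intro nn_integral_cong) simp
    also have "\<dots> = ennreal (\<Sum>j\<in>{1..Suc n}. tangent \<alpha> (r j) (measure \<Lambda> (C j)) (measure \<mu> (C j)))"
    proof -
      have hb: "has_bochner_integral \<nu> (\<lambda>x. \<Sum>j\<in>{1..Suc n}. indicator (C j) x * u j x)
         (\<Sum>j\<in>{1..Suc n}. tangent \<alpha> (r j) (measure \<Lambda> (C j)) (measure \<mu> (C j)))"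
        unfolding u_def by (intro has_bochner_integral_sum has_integral_tangent C Cfin)
      have "AE x in \<nu>. 0 \<le> (\<Sum>j\<in>{1..Suc n}. indicator (C j) x * u j x)"
        using \<open>\<And>x. x \<in> space \<nu> \<Longrightarrow> w n x = _ x\<close> u_nonneg by (intro AE_I2) (metis w_def indicator_pos_le mult_nonneg_nonneg)
      with hb show ?thesis by (simp add: nn_integral_eq_integral has_bochner_integral_iff)
    qed
    also have "\<dots> \<le> K"
    proof (rule bound)
      show "disjoint_family_on C {1..Suc n}" by (auto simp: disjoint_family_on_def C_def)
    qed (rule C Cfin r_pos)+
    finally show "(\<integral>\<^sup>+x. ennreal (w n x) \<partial>\<nu>) \<le> K" .
  qed
  finally show ?thesis .
qed

end

text \<open>Data processing: preimages of disjoint sets under \<open>X\<close> are disjoint and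
  carry the image measures, so every finite disjoint family in the target is available in the
  source.\<close>

lemma tsallis_integral_distr_le:
  assumes \<alpha>: "\<alpha> > 0" "\<alpha> \<noteq> 1" and d: "dominated_prob_pair P Q m p q" and X: "X \<in> measurable m N"
    and d': "densities_of (distr P N X) (distr Q N X) m' p' q'"
  shows "tsallis_integral \<alpha> m' p' q' \<le> tsallis_integral \<alpha> m p q"
proof -
  interpret A: dominated_prob_pair P Q m p q by fact
  interpret B: dominated_pair "distr P N X" "distr Q N X" m' p' q' by unfold_locales fact
  have XP[measurable]: "X \<in> measurable P N" "X \<in> measurable Q N" using X by (auto cong: measurable_cong_sets)
  interpret P': prob_space "distr P N X" by (rule A.P.prob_space_distr) fact
  interpret Q': prob_space "distr Q N X" by (rule A.Q.prob_space_distr) fact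
  have N: "sets m' = sets N" using B.sets_eq(1) by simp
  show ?thesis
  proof (rule B.tsallis_integral_le[OF \<alpha>])
    fix n and r :: "nat \<Rightarrow> real" and C :: "nat \<Rightarrow> _"
    assume C: "\<And>j. j \<in> {1..n} \<Longrightarrow> C j \<in> sets m'" and r: "\<And>j. 0 < r j" and disj: "disjoint_family_on C {1..n}"
    let ?C = "\<lambda>j. X -` C j \<inter> space m"
    have CN: "j \<in> {1..n} \<Longrightarrow> C j \<in> sets N" for j using C N by auto
    have "ennreal (\<Sum>j\<in>{1..n}. tangent \<alpha> (r j) (measure (distr P N X) (C j)) (measure (distr Q N X) (C j)))
       = ennreal (\<Sum>j\<in>{1..n}. tangent \<alpha> (r j) (measure P (?C j)) (measure Q (?C j)))"
      using CN by (intro arg_cong[where f=ennreal] sum.cong) (auto simp: measure_distr)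
    also have "\<dots> \<le> (\<Sum>j\<in>{1..n}. tsallis_term \<alpha> (measure P (?C j)) (measure Q (?C j)))"
      using \<alpha> r by (intro sum_tangent_le) auto
    also have "\<dots> \<le> tsallis_integral \<alpha> m p q"
      using CN X disj by (intro A.sum_tsallis_measure_le[OF \<alpha>])
        (auto simp: disjoint_family_on_def A.P.emeasure_finite A.Q.emeasure_finite less_top[symmetric] intro: measurable_sets)
    finally show "ennreal (\<Sum>j\<in>{1..n}. tangent \<alpha> (r j) (measure (distr P N X) (C j)) (measure (distr Q N X) (C j))) \<le> tsallis_integral \<alpha> m p q" .
  qed (unfold_locales)
qed

section \<open>Limits of the Tsallis integral at orders 1 and 0\<close>

lemma tsallis_integral_SUP_1:
  assumes [measurable]: "f \<in> borel_measurable \<nu>" "g \<in> borel_measurable \<nu>"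
    and pos: "\<And>x. x \<in> space \<nu> \<Longrightarrow> 0 \<le> f x" "\<And>x. x \<in> space \<nu> \<Longrightarrow> 0 \<le> g x"
  shows "tsallis_integral 1 \<nu> f g = (SUP n. tsallis_integral (1 - 1 / (real n + 2)) \<nu> f g)"
    and "incseq (\<lambda>n. tsallis_integral (1 - 1 / (real n + 2)) \<nu> f g)"
proof -
  have mono: "tsallis_term (1 - 1 / (real m + 2)) a b \<le> tsallis_term (1 - 1 / (real n + 2)) a b"
    if "m \<le> n" "a \<ge> 0" "b \<ge> 0" for m n a b
    using that by (intro tsallis_term_mono_lt_1) (auto intro!: divide_left_mono)
  then show "incseq (\<lambda>n. tsallis_integral (1 - 1 / (real n + 2)) \<nu> f g)"
    unfolding tsallis_integral_def incseq_def using pos by (auto intro!: nn_integral_mono)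
  have "(\<integral>\<^sup>+x. (SUP n. tsallis_term (1 - 1 / (real n + 2)) (f x) (g x)) \<partial>\<nu>) =
     (SUP n. \<integral>\<^sup>+x. tsallis_term (1 - 1 / (real n + 2)) (f x) (g x) \<partial>\<nu>)"
    using pos by (intro nn_integral_monotone_convergence_SUP_AE AE_I2 mono) auto
  moreover have "(SUP n. tsallis_term (1 - 1 / (real n + 2)) a b) = tsallis_term 1 a b" if "a \<ge> 0" "b \<ge> 0" for a b
    by (rule LIMSEQ_unique[OF LIMSEQ_SUP tsallis_term_tendsto_1]) (use that mono in \<open>auto simp: incseq_def\<close>)
  then have "(\<integral>\<^sup>+x. (SUP n. tsallis_term (1 - 1 / (real n + 2)) (f x) (g x)) \<partial>\<nu>) = tsallis_integral 1 \<nu> f g"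
    unfolding tsallis_integral_def using pos by (intro nn_integral_cong) auto
  ultimately show "tsallis_integral 1 \<nu> f g = (SUP n. tsallis_integral (1 - 1 / (real n + 2)) \<nu> f g)"
    by (simp add: tsallis_integral_def)
qed

lemma tsallis_integral_tendsto_0:
  assumes [measurable]: "f \<in> borel_measurable \<nu>" "g \<in> borel_measurable \<nu>"
    and pos: "\<And>x. x \<in> space \<nu> \<Longrightarrow> 0 \<le> f x" "\<And>x. x \<in> space \<nu> \<Longrightarrow> 0 \<le> g x"
    and \<beta>: "0 < \<beta>" "\<beta> < 1" and fin: "tsallis_integral \<beta> \<nu> f g < \<infinity>"
  shows "(\<lambda>n. tsallis_integral (\<beta> / (real n + 1)) \<nu> f g) \<longlonglongrightarrow> tsallis_integral 0 \<nu> f g"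
  unfolding tsallis_integral_def
proof (rule nn_integral_dominated_convergence[where w = "\<lambda>x. tsallis_term \<beta> (f x) (g x)"])
  have b: "0 < \<beta> / (real n + 1)" "\<beta> / (real n + 1) \<le> \<beta>" for n using \<beta> by (auto simp: divide_simps)
  then have b1: "\<beta> / (real n + 1) < 1" for n using \<beta> by (meson le_less_trans)
  have lim: "(\<lambda>n. \<beta> / (real n + 1)) \<longlonglongrightarrow> 0"
    using tendsto_mult[OF tendsto_const[of \<beta>] LIMSEQ_inverse_real_of_nat] by (simp add: divide_inverse add.commute)
  show "AE x in \<nu>. tsallis_term (\<beta> / (real n + 1)) (f x) (g x) \<le> tsallis_term \<beta> (f x) (g x)" for n
    using pos b[of n] \<beta> by (intro AE_I2 tsallis_term_mono_lt_1) (auto intro: less_imp_le)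
  show "AE x in \<nu>. (\<lambda>n. tsallis_term (\<beta> / (real n + 1)) (f x) (g x)) \<longlonglongrightarrow> tsallis_term 0 (f x) (g x)"
    using pos b b1 lim by (intro AE_I2 tsallis_term_tendsto_0) auto
qed (use fin in \<open>auto simp: tsallis_integral_def\<close>)

section \<open>Approximation by a generating algebra\<close>

text \<open>The sets approximable for every error form a sigma-algebra containing \<open>G\<close>,
  by induction on \<open>sigma_sets\<close>. Working with the sum \<open>\<delta>\<close> of the
  measures gives one approximating set for both; finiteness enters through continuity from
  above.\<close>

lemma approx_by_generating_algebra:
  assumes P: "finite_measure P" and Q: "finite_measure Q" and sets_eq: "sets Q = sets P"
    and G: "algebra (space P) G" "sigma_sets (space P) G = sets P"
    and A: "A \<in> sets P" and e: "e > 0"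
  shows "\<exists>B\<in>G. measure P (sym_diff A B) + measure Q (sym_diff A B) < e"
proof -
  interpret P: finite_measure P by fact
  interpret Q: finite_measure Q by fact
  interpret G: algebra "space P" G by fact
  define \<delta> where "\<delta> A = measure P A + measure Q A" for A
  have GP: "B \<in> sets P" if "B \<in> G" for B using that G(2) by auto
  have mono: "\<delta> A \<le> \<delta> B" if "A \<subseteq> B" "B \<in> sets P" for A B
    using that sets_eq unfolding \<delta>_def by (intro add_mono P.finite_measure_mono Q.finite_measure_mono) auto
  have sub: "\<delta> (A \<union> B) \<le> \<delta> A + \<delta> B" if "A \<in> sets P" "B \<in> sets P" for A B
    using that sets_eq measure_Un_le[of A P B] measure_Un_le[of A Q B] unfolding \<delta>_def by auto
  have "A \<in> sigma_sets (space P) G" using A G(2) by simp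
  then have "\<forall>e>0. \<exists>B\<in>G. \<delta> (sym_diff A B) < e"
  proof induction
    case (Basic a)
    then show ?case by (intro allI impI bexI[of _ a]) (auto simp: \<delta>_def)
  next
    case Empty
    then show ?case by (intro allI impI bexI[of _ "{}"]) (auto simp: \<delta>_def)
  next
    case (Compl a)
    show ?case
    proof (intro allI impI)
      fix e :: real assume "e > 0"
      then obtain B where B: "B \<in> G" "\<delta> (sym_diff a B) < e" using Compl.IH by blast
      have "a \<subseteq> space P" "B \<subseteq> space P" using Compl.hyps B(1) G(2) sets.sets_into_space GP by blast+
      then have "sym_diff (space P - a) (space P - B) = sym_diff a B" by auto
      then show "\<exists>B\<in>G. \<delta> (sym_diff (space P - a) B) < e" using B by (intro bexI[of _ "space P - B"]) auto
    qed
  next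
    case (Union a)
    have a: "a i \<in> sets P" for i using Union.hyps G(2) by simp
    show ?case
    proof (intro allI impI)
      fix e :: real assume e: "e > 0"
      \<comment> \<open>\<open>R n\<close> is what the first n sets miss of the union; it decreases
        to the empty set, so it can be charged half of the error.\<close>
      define R where "R n = \<Union>(range a) - (\<Union>i<n. a i)" for n
      have R: "R n \<in> sets P" for n unfolding R_def using a by auto
      have Rdec: "decseq R" by (auto simp: R_def decseq_def)
      have Rint: "(\<Inter>n. R n) = {}"
      proof (rule equals0I)
        fix x assume x: "x \<in> (\<Inter>n. R n)"
        then have "x \<in> R 0" by blast
        then obtain i where "x \<in> a i" by (auto simp: R_def)
        moreover have "x \<in> R (Suc i)" using x by blast
        ultimately show False by (auto simp: R_def)
      qed
      have "(\<lambda>n. \<delta> (R n)) \<longlonglongrightarrow> measure P (\<Inter>n. R n) + measure Q (\<Inter>n. R n)"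
        unfolding \<delta>_def using R Rdec sets_eq
        by (intro tendsto_add P.finite_Lim_measure_decseq Q.finite_Lim_measure_decseq) auto
      then have "(\<lambda>n. \<delta> (R n)) \<longlonglongrightarrow> 0" by (simp add: Rint)
      then have "\<forall>\<^sub>F n in sequentially. \<delta> (R n) < e / 2" using e by (intro order_tendstoD) auto
      then obtain n where n: "\<delta> (R n) < e / 2" by (auto simp: eventually_sequentially)
      \<comment> \<open>The n approximations share the other half; n + 1 avoids division by zero
        when n = 0.\<close>
      define d where "d = e / (2 * (real n + 1))"
      have "d > 0" using e by (simp add: d_def)
      then have "\<forall>i. \<exists>B\<in>G. \<delta> (sym_diff (a i) B) < d" using Union.IH by blast
      then obtain B where B: "\<And>i. B i \<in> G" "\<And>i. \<delta> (sym_diff (a i) (B i)) < d" by metis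
      have sd: "sym_diff (a i) (B i) \<in> sets P" for i using a GP[OF B(1)] by auto
      have sums: "\<delta> (\<Union>i<k. sym_diff (a i) (B i)) \<le> real k * d" for k
      proof (induction k)
        case 0 then show ?case by (simp add: \<delta>_def)
      next
        case (Suc k)
        have "\<delta> (\<Union>i<Suc k. sym_diff (a i) (B i)) \<le> \<delta> (sym_diff (a k) (B k)) + \<delta> (\<Union>i<k. sym_diff (a i) (B i))"
          unfolding lessThan_Suc UN_insert using sd by (intro sub) auto
        also have "\<dots> \<le> real (Suc k) * d"
          using Suc B(2)[of k] by (simp add: distrib_right)
        finally show ?case .
      qed
      have "sym_diff (\<Union>(range a)) (\<Union>i<n. B i) \<subseteq> R n \<union> (\<Union>i<n. sym_diff (a i) (B i))"
        by (auto simp: R_def)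
      then have "\<delta> (sym_diff (\<Union>(range a)) (\<Union>i<n. B i)) \<le> \<delta> (R n \<union> (\<Union>i<n. sym_diff (a i) (B i)))"
        using R sd by (intro mono) auto
      also have "\<dots> \<le> \<delta> (R n) + \<delta> (\<Union>i<n. sym_diff (a i) (B i))" using R sd by (intro sub) auto
      also have "\<dots> < e / 2 + real n * d" using n sums[of n] by simp
      also have "real n * d \<le> e / 2" using e by (simp add: d_def field_simps)
      finally show "\<exists>B\<in>G. \<delta> (sym_diff (\<Union>(range a)) B) < e"
        using B(1) by (intro bexI[of _ "\<Union>i<n. B i"]) auto
    qed
  qed
  with e show ?thesis by (auto simp: \<delta>_def)
qed

lemma (in finite_measure) abs_measure_diff_le:
  assumes "A \<in> sets M" "B \<in> sets M"
  shows "\<bar>measure M A - measure M B\<bar> \<le> measure M (sym_diff A B)"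
proof -
  have "measure M A \<le> measure M (B \<union> sym_diff A B)" "measure M B \<le> measure M (A \<union> sym_diff A B)"
    using assms by (auto intro!: finite_measure_mono)
  moreover have "measure M (B \<union> sym_diff A B) \<le> measure M B + measure M (sym_diff A B)"
     "measure M (A \<union> sym_diff A B) \<le> measure M A + measure M (sym_diff A B)"
    using assms by (intro measure_Un_le; auto)+
  ultimately show ?thesis by linarith
qed

text \<open>Sets of \<open>G\<close> approximating disjoint sets need not be disjoint; hence the differences in the
  hypothesis.\<close>

lemma sum_tangent_le_by_generating_algebra:
  fixes C :: "nat \<Rightarrow> 'a set"
  assumes P: "finite_measure P" and Q: "finite_measure Q" and sets_eq: "sets Q = sets P"
    and G: "algebra (space P) G" "sigma_sets (space P) G = sets P"
    and C: "\<And>j. j \<in> {1..n} \<Longrightarrow> C j \<in> sets P" "disjoint_family_on C {1..n}"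
    and bound: "\<And>A. (\<And>j. A j \<in> G) \<Longrightarrow>
      ennreal (\<Sum>j\<in>{1..n}. tangent \<alpha> (r j) (measure P (A j - (\<Union>i\<in>{1..<j}. A i))) (measure Q (A j - (\<Union>i\<in>{1..<j}. A i)))) \<le> K"
  shows "ennreal (\<Sum>j\<in>{1..n}. tangent \<alpha> (r j) (measure P (C j)) (measure Q (C j))) \<le> K"
proof -
  interpret P: finite_measure P by fact
  interpret Q: finite_measure Q by fact
  interpret G: algebra "space P" G by fact
  have "\<forall>k j. \<exists>B\<in>G. j \<in> {1..n} \<longrightarrow> measure P (sym_diff (C j) B) + measure Q (sym_diff (C j) B) < 1 / (real k + 1)"
  proof (intro allI)
    fix k j
    show "\<exists>B\<in>G. j \<in> {1..n} \<longrightarrow> measure P (sym_diff (C j) B) + measure Q (sym_diff (C j) B) < 1 / (real k + 1)"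
    proof (cases "j \<in> {1..n}")
      case True
      then show ?thesis
        using approx_by_generating_algebra[OF P Q sets_eq G C(1)[OF True], of "1 / (real k + 1)"] by auto
    qed (auto intro: G.empty_sets)
  qed
  then obtain A where A: "\<And>k j. A k j \<in> G"
    "\<And>k j. j \<in> {1..n} \<Longrightarrow> measure P (sym_diff (C j) (A k j)) + measure Q (sym_diff (C j) (A k j)) < 1 / (real k + 1)"
    by metis
  define A' where "A' k j = A k j - (\<Union>i\<in>{1..<j}. A k i)" for k j
  have Am: "A k j \<in> sets P" for k j using A(1)[of k j] G(2) by auto
  have A'm: "A' k j \<in> sets P" for k j unfolding A'_def using Am by auto
  have lim: "(\<lambda>k. measure M (A' k j)) \<longlonglongrightarrow> measure M (C j)"
    if j: "j \<in> {1..n}" and M: "finite_measure M" "sets M = sets P"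
      and le: "\<And>k j. j \<in> {1..n} \<Longrightarrow> measure M (sym_diff (C j) (A k j)) \<le> 1 / (real k + 1)" for j M
  proof -
    interpret M: finite_measure M by fact
    have *: "\<bar>measure M (A' k j) - measure M (C j)\<bar> \<le> real n * (1 / (real k + 1))" for k
    proof -
      have "sym_diff (A' k j) (C j) \<subseteq> (\<Union>i\<in>{1..n}. sym_diff (C i) (A k i))"
      proof
        fix x assume x: "x \<in> sym_diff (A' k j) (C j)"
        show "x \<in> (\<Union>i\<in>{1..n}. sym_diff (C i) (A k i))"
        \<comment> \<open>A point of both \<open>C j\<close> and \<open>A k j\<close> is missing
          from \<open>A' k j\<close> only because of an earlier \<open>A k i\<close>; since the
          \<open>C\<close> are disjoint, it is an error point of index i.\<close>
        proof (cases "x \<in> C j \<and> x \<in> A k j")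
          case True
          then obtain i where i: "i \<in> {1..<j}" "x \<in> A k i" using x by (auto simp: A'_def)
          then have "x \<notin> C i" using True C(2) j unfolding disjoint_family_on_def by fastforce
          then show ?thesis using i j by auto
        qed (use x j in \<open>auto simp: A'_def\<close>)
      qed
      then have "measure M (sym_diff (A' k j) (C j)) \<le> measure M (\<Union>i\<in>{1..n}. sym_diff (C i) (A k i))"
        using C(1) Am M(2) by (intro M.finite_measure_mono) auto
      also have "\<dots> \<le> (\<Sum>i\<in>{1..n}. measure M (sym_diff (C i) (A k i)))"
        using C(1) Am M(2) by (intro M.finite_measure_subadditive_finite) auto
      also have "\<dots> \<le> (\<Sum>i\<in>{1..n}. 1 / (real k + 1))" by (intro sum_mono le)
      finally have "measure M (sym_diff (A' k j) (C j)) \<le> real n * (1 / (real k + 1))" by simp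
      with M.abs_measure_diff_le[of "A' k j" "C j"] A'm C(1)[OF j] M(2) show ?thesis by auto
    qed
    have "(\<lambda>k. real n * (1 / (real k + 1))) \<longlonglongrightarrow> 0"
      using tendsto_mult[OF tendsto_const[of "real n"] LIMSEQ_inverse_real_of_nat]
      by (simp add: divide_inverse add.commute)
    then have "(\<lambda>k. measure M (A' k j) - measure M (C j)) \<longlonglongrightarrow> 0"
      by (rule Lim_null_comparison[rotated]) (use * in auto)
    then show ?thesis by (simp add: LIM_zero_iff)
  qed
  have AP: "measure P (sym_diff (C j) (A k j)) \<le> 1 / (real k + 1)" if "j \<in> {1..n}" for k j
    using A(2)[OF that, of k] measure_nonneg[of Q "sym_diff (C j) (A k j)"] by linarith
  have AQ: "measure Q (sym_diff (C j) (A k j)) \<le> 1 / (real k + 1)" if "j \<in> {1..n}" for k j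
    using A(2)[OF that, of k] measure_nonneg[of P "sym_diff (C j) (A k j)"] by linarith
  \<comment> \<open>Tangents are continuous in the two measures; \<open>tsallis_term\<close> is not
    continuous at (0, 0) for \<alpha> > 1.\<close>
  have "(\<lambda>k. ennreal (\<Sum>j\<in>{1..n}. tangent \<alpha> (r j) (measure P (A' k j)) (measure Q (A' k j)))) \<longlonglongrightarrow>
      ennreal (\<Sum>j\<in>{1..n}. tangent \<alpha> (r j) (measure P (C j)) (measure Q (C j)))"
    unfolding tangent_def
    by (intro tendsto_ennrealI tendsto_intros lim P Q sets_eq refl) (use AP AQ in auto)
  then show ?thesis
    by (rule LIMSEQ_le_const2) (use bound[of "A _"] A(1) in \<open>auto simp: A'_def\<close>)
qed

section \<open>Products of Poisson distributions\<close>

text \<open>\<open>exp ((\<alpha> - 1) s)\<close> extended to \<open>s = \<infinity>\<close>.\<close>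

definition exp_order :: "real \<Rightarrow> ennreal \<Rightarrow> ennreal" where
  "exp_order \<alpha> s = (if s = \<infinity> then (if \<alpha> > 1 then \<infinity> else 0) else ennreal (exp ((\<alpha> - 1) * enn2real s)))"

lemma exp_order_0[simp]: "exp_order \<alpha> 0 = 1"
  by (simp add: exp_order_def)

lemma exp_order_add: "exp_order \<alpha> (s + t) = exp_order \<alpha> s * exp_order \<alpha> t"
proof (cases "s = \<infinity> \<or> t = \<infinity>")
  case True
  then show ?thesis by (auto simp: exp_order_def ennreal_mult_top ennreal_top_mult)
next
  case False
  then have "enn2real (s + t) = enn2real s + enn2real t"
    by (intro enn2real_plus) (auto simp: less_top)
  then show ?thesis using False
    by (simp add: exp_order_def distrib_left exp_add ennreal_mult)
qed

lemma exp_order_sum: "exp_order \<alpha> (\<Sum>i\<in>I. s i) = (\<Prod>i\<in>I. exp_order \<alpha> (s i))"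
  by (induction I rule: infinite_finite_induct) (auto simp: exp_order_add)

lemma exp_order_le_iff_lt_1:
  assumes "\<alpha> < 1"
  shows "exp_order \<alpha> s \<le> exp_order \<alpha> t \<longleftrightarrow> t \<le> s"
proof -
  have "(\<alpha> - 1) * a \<le> (\<alpha> - 1) * b \<longleftrightarrow> b \<le> a" for a b :: real
    using assms mult_le_cancel_left_neg[of "\<alpha> - 1" a b] by simp
  then show ?thesis using assms
    by (cases s; cases t) (auto simp: exp_order_def ennreal_le_iff top_unique)
qed

lemma exp_order_le_iff_gt_1:
  assumes "\<alpha> > 1"
  shows "exp_order \<alpha> s \<le> exp_order \<alpha> t \<longleftrightarrow> s \<le> t"
proof -
  have "(\<alpha> - 1) * a \<le> (\<alpha> - 1) * b \<longleftrightarrow> a \<le> b" for a b :: real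
    using assms mult_le_cancel_left_pos[of "\<alpha> - 1" a b] by simp
  then show ?thesis using assms
    by (cases s; cases t) (auto simp: exp_order_def ennreal_le_iff top_unique)
qed

lemma ex_exp_order_lt_1:
  assumes "\<alpha> < 1" "x \<le> 1"
  shows "\<exists>s. x = exp_order \<alpha> s"
proof (cases "x = 0")
  case True
  then show ?thesis using assms by (intro exI[of _ "\<infinity>"]) (simp add: exp_order_def)
next
  case False
  with assms obtain y where y: "x = ennreal y" "0 < y" "y \<le> 1"
    by (cases x) (auto simp: top_unique)
  then have "0 \<le> ln y / (\<alpha> - 1)" using assms by (simp add: zero_le_divide_iff)
  then show ?thesis using assms y by (intro exI[of _ "ennreal (ln y / (\<alpha> - 1))"]) (simp add: exp_order_def)
qed

lemma ex_exp_order_gt_1: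
  assumes "\<alpha> > 1" "1 \<le> x"
  shows "\<exists>s. x = exp_order \<alpha> s"
proof (cases "x = \<infinity>")
  case True
  then show ?thesis using assms by (intro exI[of _ "\<infinity>"]) (simp add: exp_order_def)
next
  case False
  with assms obtain y where y: "x = ennreal y" "1 \<le> y"
    by (cases x) (auto simp: top_unique simp flip: ennreal_1)
  then have "0 \<le> ln y / (\<alpha> - 1)" using assms by simp
  then show ?thesis using assms y by (intro exI[of _ "ennreal (ln y / (\<alpha> - 1))"]) (simp add: exp_order_def)
qed

lemma ln_exp_order:
  assumes "\<alpha> \<noteq> 1"
  shows "ereal (1 / (\<alpha> - 1)) * ln_ereal (enn2ereal (exp_order \<alpha> s)) = enn2ereal s"
proof (cases s)
  case (real t)
  then show ?thesis using assms
    by (simp add: exp_order_def ln_ereal_def enn2ereal_ennreal)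
next
  case top
  then show ?thesis using assms
    by (auto simp: exp_order_def ln_ereal_def zero_ennreal.rep_eq)
qed

text \<open>For infinite values this rests on \<infinity> * 0 = 0: if one factor is infinite and the
  other has first argument 0, the product of the first arguments is 0 as well.\<close>

lemma power_enn_mult:
  assumes "a \<ge> 0" "b \<ge> 0" "a' \<ge> 0" "b' \<ge> 0"
  shows "power_enn \<alpha> (a * a') (b * b') = power_enn \<alpha> a b * power_enn \<alpha> a' b'"
proof -
  have *: "ennreal (a powr \<alpha> * b powr (1 - \<alpha>)) = 0 \<longleftrightarrow> a = 0 \<or> b = 0" for a b
    by simp
  show ?thesis
    using assms by (auto simp: power_enn_def powr_mult ennreal_top_mult ennreal_mult_top * mult_ac simp flip: ennreal_mult)
qed

lemma power_enn_prod:
  assumes "\<And>i. i \<in> I \<Longrightarrow> 0 \<le> a i" "\<And>i. i \<in> I \<Longrightarrow> 0 \<le> b i"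
  shows "power_enn \<alpha> (\<Prod>i\<in>I. a i) (\<Prod>i\<in>I. b i) = (\<Prod>i\<in>I. power_enn \<alpha> (a i) (b i))"
  using assms
proof (induction I rule: infinite_finite_induct)
  case (insert i I)
  then show ?case by (simp add: power_enn_mult prod_nonneg)
qed (simp_all add: power_enn_def)

text \<open>Poisson laws on \<^typ>\<open>ennreal\<close> are described by their densities with respect to the law of rate \<open>1\<close>.\<close>

definition poisson_ref :: "ennreal measure" where
  "poisson_ref = distr (measure_pmf (poisson_pmf 1)) borel of_nat"

text \<open>Quotient of the Poisson weights of rates a and 1 at n, where the factorials cancel; 0^0
  = 1 makes it valid for a = 0. Rounding extends it to all of \<open>ennreal\<close>, while
  \<open>poisson_ref\<close> charges only natural numbers.\<close>

definition poisson_density :: "real \<Rightarrow> ennreal \<Rightarrow> real" where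
  "poisson_density a x = exp (1 - a) * a ^ nat \<lfloor>enn2real x\<rfloor>"

lemma prob_space_poisson_ref: "prob_space poisson_ref"
  unfolding poisson_ref_def by (intro prob_space.prob_space_distr) (auto intro: measure_pmf.prob_space_axioms)

lemma sets_poisson_ref[measurable_cong, simp]: "sets poisson_ref = sets borel"
  by (simp add: poisson_ref_def)

lemma space_poisson_ref[simp]: "space poisson_ref = UNIV"
  by (simp add: poisson_ref_def)

lemma measurable_poisson_density[measurable]: "poisson_density a \<in> borel_measurable borel"
  unfolding poisson_density_def by measurable

lemma poisson_density_nonneg: "a \<ge> 0 \<Longrightarrow> 0 \<le> poisson_density a x"
  by (simp add: poisson_density_def)

lemma poisson_density_of_nat: "poisson_density a (of_nat n) = exp (1 - a) * a ^ n"
  by (simp add: poisson_density_def ennreal_of_nat_eq_real_of_nat)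

lemma poisson_ennreal_eq_density:
  assumes "a \<ge> 0"
  shows "poisson_ennreal (ennreal a) = density poisson_ref (\<lambda>x. ennreal (poisson_density a x))"
proof -
  define p where "p = (if a = 0 then return_pmf 0 else poisson_pmf a)"
  have p: "pmf p n = a ^ n / fact n * exp (- a)" for n
    using assms by (auto simp: p_def indicator_def power_0_left)
  have "density poisson_ref (\<lambda>x. ennreal (poisson_density a x)) =
      distr (density (measure_pmf (poisson_pmf 1)) (\<lambda>n. ennreal (poisson_density a (of_nat n)))) borel of_nat"
    unfolding poisson_ref_def by (subst density_distr) auto
  also have "density (measure_pmf (poisson_pmf 1)) (\<lambda>n. ennreal (poisson_density a (of_nat n))) =
     density (count_space UNIV) (\<lambda>n. ennreal (pmf (poisson_pmf 1) n) * ennreal (poisson_density a (of_nat n)))"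
    by (subst measure_pmf_eq_density, subst density_density_eq) auto
  also have "(\<lambda>n. ennreal (pmf (poisson_pmf 1) n) * ennreal (poisson_density a (of_nat n))) = (\<lambda>n. ennreal (pmf p n))"
  proof
    fix n
    have "1 ^ n / fact n * exp (- 1) * (exp (1 - a) * a ^ n) = a ^ n / fact n * exp (- a)"
      by (simp add: exp_diff exp_minus field_simps)
    then show "ennreal (pmf (poisson_pmf 1) n) * ennreal (poisson_density a (of_nat n)) = ennreal (pmf p n)"
      using assms unfolding p poisson_density_of_nat by (subst ennreal_mult[symmetric]) auto
  qed
  also have "density (count_space UNIV) (\<lambda>n. ennreal (pmf p n)) = measure_pmf p"
    by (rule measure_pmf_eq_density[symmetric])
  also have "distr (measure_pmf p) borel of_nat = poisson_ennreal (ennreal a)"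
    using assms by (auto simp: poisson_ennreal_def p_def return_pmf.rep_eq distr_return)
  finally show ?thesis ..
qed

text \<open>With c = \<open>a powr \<alpha> * b powr (1 - \<alpha>)\<close> the exponential series
  gives exp (c - \<alpha> a - (1 - \<alpha>) b), whose exponent is \<alpha> - 1 times the Tsallis
  integrand. The exponential link between the two divergences originates here.\<close>

lemma nn_integral_power_poisson:
  assumes \<alpha>: "\<alpha> > 0" "\<alpha> \<noteq> 1" and ab: "a \<ge> 0" "b \<ge> 0"
  shows "(\<integral>\<^sup>+x. power_enn \<alpha> (poisson_density a x) (poisson_density b x) \<partial>poisson_ref) =
    exp_order \<alpha> (tsallis_term \<alpha> a b)"
proof -
  have "(\<integral>\<^sup>+x. power_enn \<alpha> (poisson_density a x) (poisson_density b x) \<partial>poisson_ref) =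
     (\<integral>\<^sup>+n. ennreal (pmf (poisson_pmf 1) n) * power_enn \<alpha> (poisson_density a (of_nat n)) (poisson_density b (of_nat n)) \<partial>count_space UNIV)"
    unfolding poisson_ref_def by (subst nn_integral_distr) (auto simp: nn_integral_measure_pmf)
  also have "\<dots> = (\<Sum>n. ennreal (exp (- 1) / fact n) * power_enn \<alpha> (exp (1 - a) * a ^ n) (exp (1 - b) * b ^ n))"
    by (simp add: nn_integral_count_space_nat poisson_density_of_nat)
  also have "\<dots> = exp_order \<alpha> (tsallis_term \<alpha> a b)"
  proof (cases "\<alpha> > 1 \<and> b = 0 \<and> a \<noteq> 0")
    case True
    let ?u = "\<lambda>n. ennreal (exp (- 1) / fact n) * power_enn \<alpha> (exp (1 - a) * a ^ n) (exp (1 - b) * b ^ n)"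
    \<comment> \<open>The law of rate 0 charges only n = 0, where the term is finite; n = 1 gives
      the first infinite term.\<close>
    have "?u 1 = \<infinity>" using True by (simp add: power_enn_def ennreal_mult_top)
    moreover have "?u 1 \<le> (\<Sum>n. ?u n)" using sum_le_suminf[of ?u "{1}"] by simp
    ultimately have "(\<Sum>n. ?u n) = \<infinity>" by (simp add: top_unique)
    then show ?thesis using True by (simp add: exp_order_def tsallis_term_def)
  next
    case False
    define c where "c = a powr \<alpha> * b powr (1 - \<alpha>)"
    define t where "t = (\<alpha> * a + (1 - \<alpha>) * b - c) / (1 - \<alpha>)"
    have t: "tsallis_term \<alpha> a b = ennreal t" using False \<alpha> by (auto simp: tsallis_term_def t_def c_def)
    have t0: "t \<ge> 0" unfolding t_def c_def by (rule tsallis_numerator_nonneg[OF \<alpha> ab False])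
    have c0: "c \<ge> 0" by (simp add: c_def)
    have pw: "(x ^ n) powr \<gamma> = (x powr \<gamma>) ^ n" if "x \<ge> 0" for x \<gamma> :: real and n
      using that by (induction n) (auto simp: powr_mult)
    have e: "power_enn \<alpha> (exp (1 - a) * a ^ n) (exp (1 - b) * b ^ n) = ennreal (exp (1 - \<alpha> * a - (1 - \<alpha>) * b) * c ^ n)" for n
    proof -
      have "(exp (1 - a) * a ^ n) powr \<alpha> * (exp (1 - b) * b ^ n) powr (1 - \<alpha>) =
         (exp (\<alpha> * (1 - a)) * exp ((1 - \<alpha>) * (1 - b))) * c ^ n"
        using ab by (simp add: powr_mult pw c_def power_mult_distrib exp_powr_real mult_ac)
      also have "exp (\<alpha> * (1 - a)) * exp ((1 - \<alpha>) * (1 - b)) = exp (1 - \<alpha> * a - (1 - \<alpha>) * b)"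
        by (simp add: algebra_simps flip: exp_add)
      finally show ?thesis using False by (auto simp: power_enn_def)
    qed
    have "(\<lambda>n. exp (- \<alpha> * a - (1 - \<alpha>) * b) * (c ^ n /\<^sub>R fact n)) sums (exp (- \<alpha> * a - (1 - \<alpha>) * b) * exp c)"
      by (intro sums_mult exp_converges)
    moreover have "exp (- 1) / fact n * (exp (1 - \<alpha> * a - (1 - \<alpha>) * b) * c ^ n) = exp (- \<alpha> * a - (1 - \<alpha>) * b) * (c ^ n /\<^sub>R fact n)" for n
    proof -
      have "exp (- 1) * exp (1 - \<alpha> * a - (1 - \<alpha>) * b) = exp (- \<alpha> * a - (1 - \<alpha>) * b)"
        by (simp add: algebra_simps flip: exp_add)
      then show ?thesis by (simp add: field_simps)
    qed
    ultimately have "(\<lambda>n. exp (- 1) / fact n * (exp (1 - \<alpha> * a - (1 - \<alpha>) * b) * c ^ n)) sums (exp (- \<alpha> * a - (1 - \<alpha>) * b) * exp c)"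
      by simp
    then have "(\<Sum>n. ennreal (exp (- 1) / fact n * (exp (1 - \<alpha> * a - (1 - \<alpha>) * b) * c ^ n))) =
       ennreal (exp (- \<alpha> * a - (1 - \<alpha>) * b) * exp c)"
      using c0 by (intro suminf_ennreal_eq) auto
    also have "exp (- \<alpha> * a - (1 - \<alpha>) * b) * exp c = exp ((\<alpha> - 1) * t)"
    proof -
      have "(1 - \<alpha>) * t = \<alpha> * a + (1 - \<alpha>) * b - c" using \<alpha> by (simp add: t_def)
      then have "(\<alpha> - 1) * t = - \<alpha> * a - (1 - \<alpha>) * b + c" by (simp add: algebra_simps)
      then show ?thesis by (simp only: exp_add)
    qed
    finally show ?thesis unfolding e t using t0 by (simp add: exp_order_def flip: ennreal_mult')
  qed
  finally show ?thesis .
qed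

lemma density_PiM:
  assumes I: "finite I" and M: "\<And>i. sigma_finite_measure (M i)" and N: "\<And>i. sigma_finite_measure (density (M i) (f i))"
    and f[measurable]: "\<And>i. f i \<in> borel_measurable (M i)"
  shows "density (PiM I M) (\<lambda>x. \<Prod>i\<in>I. f i (x i)) = PiM I (\<lambda>i. density (M i) (f i))"
proof -
  interpret M: product_sigma_finite M by (simp add: product_sigma_finite_def M)
  interpret N: product_sigma_finite "\<lambda>i. density (M i) (f i)" by (simp add: product_sigma_finite_def N)
  show ?thesis
  proof (rule N.PiM_eqI[OF I])
    show "sets (density (PiM I M) (\<lambda>x. \<Prod>i\<in>I. f i (x i))) = sets (PiM I (\<lambda>i. density (M i) (f i)))"
      by (simp, intro sets_PiM_cong) auto
    fix A assume A: "\<And>i. i \<in> I \<Longrightarrow> A i \<in> sets (density (M i) (f i))"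
    then have A'[measurable]: "\<And>i. i \<in> I \<Longrightarrow> A i \<in> sets (M i)" by simp
    have "emeasure (density (PiM I M) (\<lambda>x. \<Prod>i\<in>I. f i (x i))) (Pi\<^sub>E I A) =
      (\<integral>\<^sup>+x. (\<Prod>i\<in>I. f i (x i)) * indicator (Pi\<^sub>E I A) x \<partial>PiM I M)"
      using I by (subst emeasure_density) (auto intro!: sets_PiM_I_finite)
    also have "\<dots> = (\<integral>\<^sup>+x. (\<Prod>i\<in>I. f i (x i) * indicator (A i) (x i)) \<partial>PiM I M)"
    proof (intro nn_integral_cong)
      fix x assume "x \<in> space (PiM I M)"
      then have "indicator (Pi\<^sub>E I A) x = (\<Prod>i\<in>I. indicator (A i) (x i) :: ennreal)"
        using I by (auto simp: indicator_def space_PiM PiE_iff prod_zero_iff)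
      then show "(\<Prod>i\<in>I. f i (x i)) * indicator (Pi\<^sub>E I A) x = (\<Prod>i\<in>I. f i (x i) * indicator (A i) (x i))"
        by (simp add: prod.distrib)
    qed
    also have "\<dots> = (\<Prod>i\<in>I. \<integral>\<^sup>+x. f i x * indicator (A i) x \<partial>M i)"
      using I by (intro M.product_nn_integral_prod) auto
    also have "\<dots> = (\<Prod>i\<in>I. emeasure (density (M i) (f i)) (A i))"
      by (intro prod.cong) (auto simp: emeasure_density)
    finally show "emeasure (density (PiM I M) (\<lambda>x. \<Prod>i\<in>I. f i (x i))) (Pi\<^sub>E I A) = (\<Prod>i\<in>I. emeasure (density (M i) (f i)) (A i))" .
  qed
qed

section \<open>Cylinder events of point patterns\<close>

lemma point_pattern_algebra_cong:
  "sets S = sets S' \<Longrightarrow> point_pattern_algebra S = point_pattern_algebra S'"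
  by (simp add: point_pattern_algebra_def point_patterns_def)

lemma sets_point_pattern: "\<eta> \<in> point_patterns S \<Longrightarrow> sets \<eta> = sets S"
  by (simp add: point_patterns_def)

definition counts :: "'i set \<Rightarrow> ('i \<Rightarrow> 'a set) \<Rightarrow> 'a measure \<Rightarrow> 'i \<Rightarrow> ennreal" where
  "counts I A \<eta> = (\<lambda>i\<in>I. emeasure \<eta> (A i))"

text \<open>The index map lets the notion serve both a family of sets indexed by itself and the
  numbered families of \<open>poisson_pp\<close>.\<close>

definition cylinders :: "'a measure \<Rightarrow> 'i set \<Rightarrow> ('i \<Rightarrow> 'a set) \<Rightarrow> 'a measure set set" where
  "cylinders S I A = {counts I A -` E \<inter> point_patterns S |E. E \<in> sets (PiM I (\<lambda>_. borel))}"

lemma measurable_counts: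
  assumes "\<And>i. i \<in> I \<Longrightarrow> (\<lambda>\<eta>. emeasure \<eta> (A i)) \<in> borel_measurable V"
  shows "counts I A \<in> measurable V (PiM I (\<lambda>_. borel))"
  unfolding counts_def by (intro measurable_restrict assms)

lemma cylinders_subset_sets:
  assumes "space V = point_patterns S" "\<And>i. i \<in> I \<Longrightarrow> (\<lambda>\<eta>. emeasure \<eta> (A i)) \<in> borel_measurable V"
  shows "cylinders S I A \<subseteq> sets V"
  using measurable_sets[OF measurable_counts, of I A V] assms by (auto simp: cylinders_def)

lemma sets_vimage_counts:
  "sets (vimage_algebra (point_patterns S) (counts I A) (PiM I (\<lambda>_. borel))) = cylinders S I A"
  by (subst sets_vimage_algebra2) (auto simp: cylinders_def counts_def space_PiM)

lemma measurable_emeasure_vimage_counts: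
  assumes "i \<in> I"
  shows "(\<lambda>\<eta>. emeasure \<eta> (A i)) \<in> borel_measurable (vimage_algebra (point_patterns S) (counts I A) (PiM I (\<lambda>_. borel)))"
proof -
  have "(\<lambda>\<eta>. counts I A \<eta> i) \<in> borel_measurable (vimage_algebra (point_patterns S) (counts I A) (PiM I (\<lambda>_. borel)))"
    using assms by (intro measurable_compose[OF measurable_vimage_algebra1 measurable_component_singleton])
      (auto simp: counts_def space_PiM)
  then show ?thesis using assms by (simp add: counts_def)
qed

text \<open>Adding \<open>A\<close> cuts every piece into its parts inside and outside
  \<open>A\<close> and contributes the rest of \<open>A\<close> as a new piece. Staying in the ring
  \<open>R\<close> will keep the measures of the pieces finite.\<close>

lemma finite_disjoint_refinement:
  assumes "finite \<A>" "\<A> \<subseteq> R" "{} \<in> R"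
    and R: "\<And>a b. a \<in> R \<Longrightarrow> b \<in> R \<Longrightarrow> a \<inter> b \<in> R" "\<And>a b. a \<in> R \<Longrightarrow> b \<in> R \<Longrightarrow> a - b \<in> R"
      "\<And>a b. a \<in> R \<Longrightarrow> b \<in> R \<Longrightarrow> a \<union> b \<in> R"
  shows "\<exists>\<D>. finite \<D> \<and> \<D> \<noteq> {} \<and> \<D> \<subseteq> R \<and> disjoint \<D> \<and> (\<forall>A\<in>\<A>. \<exists>\<D>'\<subseteq>\<D>. A = \<Union>\<D>')"
  using assms(1,2)
proof induction
  case empty
  \<comment> \<open>Starting from \<open>{{}}\<close> keeps the family nonempty, because
    independence of counts is postulated for at least one set.\<close>
  then show ?case using assms(3) by (intro exI[of _ "{{}}"]) auto
next
  case (insert A \<A>)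
  then obtain \<D> where D: "finite \<D>" "\<D> \<noteq> {}" "\<D> \<subseteq> R" "disjoint \<D>" "\<forall>A\<in>\<A>. \<exists>\<D>'\<subseteq>\<D>. A = \<Union>\<D>'"
    by auto
  have A: "A \<in> R" using insert.prems by simp
  have UD: "\<Union>\<D> \<in> R" using D(1,3) assms(3) R(3) by (induction \<D>) auto
  define \<E> where "\<E> = (\<lambda>D. D \<inter> A) ` \<D> \<union> (\<lambda>D. D - A) ` \<D> \<union> {A - \<Union>\<D>}"
  have "disjoint \<E>"
  proof (rule disjointI)
    fix a b assume "a \<in> \<E>" "b \<in> \<E>" "a \<noteq> b"
    then show "a \<inter> b = {}" unfolding \<E>_def using disjointD[OF D(4)] by (elim UnE imageE singletonE) (simp_all, blast+)
  qed
  moreover have "\<exists>\<E>'\<subseteq>\<E>. B = \<Union>\<E>'" if B: "B \<in> insert A \<A>" for B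
  proof (cases "B = A")
    case True
    then show ?thesis
      by (intro exI[of _ "(\<lambda>D. D \<inter> A) ` \<D> \<union> {A - \<Union>\<D>}"]) (auto simp: \<E>_def)
  next
    case False
    with B have "B \<in> \<A>" by simp
    with D(5) obtain \<D>' where "\<D>' \<subseteq> \<D>" "B = \<Union>\<D>'" by (elim ballE exE conjE) blast+
    then show ?thesis
      by (intro exI[of _ "(\<lambda>D. D \<inter> A) ` \<D>' \<union> (\<lambda>D. D - A) ` \<D>'"]) (auto simp: \<E>_def)
  qed
  moreover have "\<E> \<subseteq> R" using D(3) A UD R by (auto simp: \<E>_def)
  ultimately show ?case using D(1) by (intro exI[of _ \<E>]) (auto simp: \<E>_def)
qed

locale poisson_pair = dominated_pair \<Lambda> \<mu> \<nu> f g for \<Lambda> \<mu> \<nu> :: "'a measure" and f g +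
  fixes P Q :: "'a measure measure"
  assumes sf_L: "sigma_finite_measure \<Lambda>" and sf_M: "sigma_finite_measure \<mu>"
    and ppP: "poisson_pp \<Lambda> P" and ppQ: "poisson_pp \<mu> Q"
begin

lemma sets_P[simp]: "sets P = sets (point_pattern_algebra \<nu>)" and sets_Q[simp]: "sets Q = sets (point_pattern_algebra \<nu>)"
  using ppP ppQ point_pattern_algebra_cong[OF sets_eq(1)] point_pattern_algebra_cong[OF sets_eq(2)] by (auto simp: poisson_pp_def)

lemma space_P[simp]: "space P = point_patterns \<nu>" and space_Q[simp]: "space Q = point_patterns \<nu>"
  using sets_eq_imp_space_eq[OF sets_P] sets_eq_imp_space_eq[OF sets_Q] by (auto simp: space_point_pattern_algebra)

sublocale PP: prob_space P using ppP by (simp add: poisson_pp_def)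
sublocale QQ: prob_space Q using ppQ by (simp add: poisson_pp_def)

text \<open>On these sets the counts have finite Poisson rates under both laws, hence densities with
  respect to \<open>poisson_ref\<close>; the point mass at \<infinity> has none.\<close>

definition fin_sets :: "'a set set" where
  "fin_sets = {B\<in>sets \<nu>. emeasure \<Lambda> B < \<infinity> \<and> emeasure \<mu> B < \<infinity>}"

lemma fin_sets_ring:
  "{} \<in> fin_sets" "\<And>a b. a \<in> fin_sets \<Longrightarrow> b \<in> fin_sets \<Longrightarrow> a \<inter> b \<in> fin_sets"
  "\<And>a b. a \<in> fin_sets \<Longrightarrow> b \<in> fin_sets \<Longrightarrow> a - b \<in> fin_sets"
  "\<And>a b. a \<in> fin_sets \<Longrightarrow> b \<in> fin_sets \<Longrightarrow> a \<union> b \<in> fin_sets"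
proof -
  have sub: "a \<in> fin_sets" if "a \<subseteq> b" "a \<in> sets \<nu>" "b \<in> fin_sets" for a b
    using that emeasure_mono[of a b \<Lambda>] emeasure_mono[of a b \<mu>] by (auto simp: fin_sets_def intro: le_less_trans)
  show "{} \<in> fin_sets" by (simp add: fin_sets_def)
  fix a b assume ab: "a \<in> fin_sets" "b \<in> fin_sets"
  then have [measurable]: "a \<in> sets \<nu>" "b \<in> sets \<nu>" by (auto simp: fin_sets_def)
  show "a \<inter> b \<in> fin_sets" "a - b \<in> fin_sets" using ab by (auto intro!: sub[of _ a])
  have "emeasure M (a \<union> b) \<le> emeasure M a + emeasure M b" if "sets M = sets \<nu>" for M
    using that by (intro emeasure_subadditive) auto
  from this[of \<Lambda>] this[of \<mu>] show "a \<union> b \<in> fin_sets"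
    using ab by (auto simp: fin_sets_def less_top[symmetric] top_unique)
qed

lemma exhaustion:
  obtains S :: "nat \<Rightarrow> 'a set" where "incseq S" "(\<Union>i. S i) = space \<nu>" "\<And>i. S i \<in> fin_sets"
  by (rule ex_common_exhaustion[OF sf_L sf_M]) (auto simp: fin_sets_def)

definition fin_cylinders :: "'a measure set set" where
  "fin_cylinders = (\<Union>\<A>\<in>{\<A>. finite \<A> \<and> \<A> \<subseteq> fin_sets}. cylinders \<nu> \<A> (\<lambda>B. B))"

lemma cylinders_mono:
  assumes "\<A> \<subseteq> \<B>"
  shows "cylinders \<nu> \<A> (\<lambda>B. B) \<subseteq> cylinders \<nu> \<B> (\<lambda>B. B)"
  unfolding sets_vimage_counts[of \<nu> \<B>, symmetric]
  using assms by (intro cylinders_subset_sets measurable_emeasure_vimage_counts[where A="\<lambda>B. B"]) auto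

lemma cylinders_subset_algebra:
  assumes "\<A> \<subseteq> fin_sets"
  shows "cylinders \<nu> \<A> (\<lambda>B. B) \<subseteq> sets (point_pattern_algebra \<nu>)"
  using assms by (intro cylinders_subset_sets measurable_point_pattern_eval space_point_pattern_algebra)
    (auto simp: fin_sets_def)

text \<open>Two events are brought to the union of their families, whose cylinders form a
  sigma-algebra. Countably many events would in general need an infinite family.\<close>

lemma algebra_fin_cylinders: "algebra (point_patterns \<nu>) fin_cylinders"
  unfolding algebra_iff_Un
proof (intro conjI ballI)
  show "fin_cylinders \<subseteq> Pow (point_patterns \<nu>)" by (auto simp: fin_cylinders_def cylinders_def)
  have sa: "sigma_algebra (point_patterns \<nu>) (cylinders \<nu> \<A> (\<lambda>B. B))" for \<A>
    using sets.sigma_algebra_axioms[of "vimage_algebra (point_patterns \<nu>) (counts \<A> (\<lambda>B. B)) (PiM \<A> (\<lambda>_. borel))"]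
    by (simp add: sets_vimage_counts)
  show "{} \<in> fin_cylinders"
    unfolding fin_cylinders_def cylinders_def by (intro UN_I[of "{}"] CollectI exI[of _ "{}"]) auto
  fix a assume a: "a \<in> fin_cylinders"
  then obtain \<A> where A: "finite \<A>" "\<A> \<subseteq> fin_sets" "a \<in> cylinders \<nu> \<A> (\<lambda>B. B)" by (auto simp: fin_cylinders_def)
  interpret A: sigma_algebra "point_patterns \<nu>" "cylinders \<nu> \<A> (\<lambda>B. B)" by (rule sa)
  show "point_patterns \<nu> - a \<in> fin_cylinders" using A unfolding fin_cylinders_def by (intro UN_I[of \<A>]) auto
  fix b assume b: "b \<in> fin_cylinders"
  then obtain \<B> where B: "finite \<B>" "\<B> \<subseteq> fin_sets" "b \<in> cylinders \<nu> \<B> (\<lambda>B. B)" by (auto simp: fin_cylinders_def)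
  interpret AB: sigma_algebra "point_patterns \<nu>" "cylinders \<nu> (\<A> \<union> \<B>) (\<lambda>B. B)" by (rule sa)
  have "a \<in> cylinders \<nu> (\<A> \<union> \<B>) (\<lambda>B. B)" "b \<in> cylinders \<nu> (\<A> \<union> \<B>) (\<lambda>B. B)"
    using A B cylinders_mono[of \<A> "\<A> \<union> \<B>"] cylinders_mono[of \<B> "\<A> \<union> \<B>"] by auto
  then show "a \<union> b \<in> fin_cylinders" using A B unfolding fin_cylinders_def by (intro UN_I[of "\<A> \<union> \<B>"]) auto
qed

text \<open>The hard inclusion needs measurability of counts on sets of infinite intensity; these
  are suprema of counts on \<open>B \<inter> S i\<close>, by continuity of each pattern from
  below.\<close>

lemma sigma_sets_fin_cylinders: "sigma_sets (point_patterns \<nu>) fin_cylinders = sets (point_pattern_algebra \<nu>)"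
proof
  have sub: "fin_cylinders \<subseteq> sets (point_pattern_algebra \<nu>)"
    using cylinders_subset_algebra by (auto simp: fin_cylinders_def)
  then show "sigma_sets (point_patterns \<nu>) fin_cylinders \<subseteq> sets (point_pattern_algebra \<nu>)"
    using sets.sigma_sets_subset[OF sub] by (simp add: space_point_pattern_algebra)
  define V where "V = sigma (point_patterns \<nu>) fin_cylinders"
  have Pow: "fin_cylinders \<subseteq> Pow (point_patterns \<nu>)" by (auto simp: fin_cylinders_def cylinders_def)
  have V[simp]: "space V = point_patterns \<nu>" "sets V = sigma_sets (point_patterns \<nu>) fin_cylinders"
    using Pow by (simp_all add: V_def)
  obtain S where S: "incseq S" "(\<Union>i::nat. S i) = space \<nu>" "\<And>i. S i \<in> fin_sets"
    using exhaustion by metis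
  have fin: "(\<lambda>\<eta>. emeasure \<eta> B) \<in> borel_measurable V" if B: "B \<in> fin_sets" for B
  proof -
    have "(\<lambda>\<eta>. emeasure \<eta> B) \<in> borel_measurable (vimage_algebra (point_patterns \<nu>) (counts {B} (\<lambda>B. B)) (PiM {B} (\<lambda>_. borel)))"
      by (rule measurable_emeasure_vimage_counts[where A="\<lambda>B. B"]) simp
    moreover have "cylinders \<nu> {B} (\<lambda>B. B) \<subseteq> fin_cylinders"
      using B unfolding fin_cylinders_def by (intro UN_upper) auto
    then have "cylinders \<nu> {B} (\<lambda>B. B) \<subseteq> sets V" by auto
    ultimately show ?thesis
      by (auto simp: measurable_def sets_vimage_counts)
  qed
  have "(\<lambda>\<eta>. emeasure \<eta> B) \<in> borel_measurable V" if B: "B \<in> sets \<nu>" for B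
  proof -
    have "emeasure \<eta> B = (SUP i. emeasure \<eta> (B \<inter> S i))" if "\<eta> \<in> space V" for \<eta>
    proof -
      have s: "sets \<eta> = sets \<nu>" using that by (simp add: sets_point_pattern)
      have "(SUP i. emeasure \<eta> (B \<inter> S i)) = emeasure \<eta> (\<Union>i. B \<inter> S i)"
        using S(1,3) B s by (intro SUP_emeasure_incseq) (auto simp: incseq_def fin_sets_def)
      also have "(\<Union>i. B \<inter> S i) = B" using S(2) sets.sets_into_space[OF B] by auto
      finally show ?thesis ..
    qed
    moreover have "B \<inter> S i \<in> fin_sets" for i
      using S(3)[of i] B emeasure_mono[of "B \<inter> S i" "S i" \<Lambda>] emeasure_mono[of "B \<inter> S i" "S i" \<mu>]
      by (auto simp: fin_sets_def intro: le_less_trans)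
    then have "(\<lambda>\<eta>. SUP i. emeasure \<eta> (B \<inter> S i)) \<in> borel_measurable V"
      by (intro borel_measurable_SUP fin) auto
    ultimately show ?thesis by (subst measurable_cong) auto
  qed
  then have "(\<lambda>x. x) \<in> measurable V (point_pattern_algebra \<nu>)"
    unfolding point_pattern_algebra_def
    by (intro measurable_Sup2) (auto intro!: measurable_vimage_algebra2)
  from measurable_sets[OF this] show "sets (point_pattern_algebra \<nu>) \<subseteq> sigma_sets (point_patterns \<nu>) fin_cylinders"
    using sets.sets_into_space[of _ "point_pattern_algebra \<nu>"] by (fastforce simp: space_point_pattern_algebra Int_absorb2)
qed

text \<open>All sets involved are refined to one disjoint family. The count of each original set is
  a finite sum of counts of pieces, so all events become events of a single vector of counts, with
  independent Poisson entries under both laws.\<close>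

lemma finitely_many_cylinders:
  assumes A: "\<And>j. j \<in> J \<Longrightarrow> A j \<in> fin_cylinders" and J: "finite J"
  obtains N :: nat and B E where "N \<ge> 1" "\<And>j. j \<in> {1..N} \<Longrightarrow> B j \<in> fin_sets" "disjoint_family_on B {1..N}"
    "\<And>j. j \<in> J \<Longrightarrow> E j \<in> sets (PiM {1..N} (\<lambda>_. borel))"
    "\<And>j. j \<in> J \<Longrightarrow> A j = counts {1..N} B -` E j \<inter> point_patterns \<nu>"
proof -
  have "\<forall>j\<in>J. \<exists>\<A>. finite \<A> \<and> \<A> \<subseteq> fin_sets \<and> A j \<in> cylinders \<nu> \<A> (\<lambda>B. B)"
    using A unfolding fin_cylinders_def by blast
  then obtain \<AA> where AA: "\<And>j. j \<in> J \<Longrightarrow> finite (\<AA> j)" "\<And>j. j \<in> J \<Longrightarrow> \<AA> j \<subseteq> fin_sets"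
    "\<And>j. j \<in> J \<Longrightarrow> A j \<in> cylinders \<nu> (\<AA> j) (\<lambda>B. B)" by metis
  define \<A> where "\<A> = (\<Union>j\<in>J. \<AA> j)"
  have "finite \<A>" "\<A> \<subseteq> fin_sets" using AA J by (auto simp: \<A>_def)
  from finite_disjoint_refinement[OF this fin_sets_ring]
  obtain \<D> where D': "finite \<D> \<and> \<D> \<noteq> {} \<and> \<D> \<subseteq> fin_sets \<and> disjoint \<D> \<and> (\<forall>A\<in>\<A>. \<exists>\<D>'\<subseteq>\<D>. A = \<Union>\<D>')"
    by (rule exE)
  then have D: "finite \<D>" "\<D> \<noteq> {}" "\<D> \<subseteq> fin_sets" "disjoint \<D>" by simp_all
  have D5: "\<exists>\<D>'\<subseteq>\<D>. A = \<Union>\<D>'" if "A \<in> \<A>" for A using D' that by simp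
  define N where "N = card \<D>"
  obtain B where B: "bij_betw B {1..N} \<D>" using ex_bij_betw_nat_finite_1[OF D(1)] unfolding N_def by blast
  have N: "N \<ge> 1" using D(1,2) by (simp add: N_def Suc_le_eq card_gt_0_iff)
  have B1: "B j \<in> fin_sets" if "j \<in> {1..N}" for j using bij_betw_apply[OF B that] D(3) by blast
  have disj: "disjoint_family_on B {1..N}"
    unfolding disjoint_family_on_def
  proof (intro ballI impI)
    fix m n assume mn: "m \<in> {1..N}" "n \<in> {1..N}" "m \<noteq> n"
    then have "B m \<noteq> B n" using B by (metis bij_betw_imp_inj_on inj_onD)
    then show "B m \<inter> B n = {}"
      by (rule disjointD[OF D(4) bij_betw_apply[OF B mn(1)] bij_betw_apply[OF B mn(2)]])
  qed
  let ?V = "vimage_algebra (point_patterns \<nu>) (counts {1..N} B) (PiM {1..N} (\<lambda>_. borel))"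
  have meas: "(\<lambda>\<eta>. emeasure \<eta> C) \<in> borel_measurable ?V" if C: "C \<in> \<A>" for C
  proof -
    obtain \<D>' where D': "\<D>' \<subseteq> \<D>" "C = \<Union>\<D>'" using D5[OF C] by blast
    have "emeasure \<eta> C = (\<Sum>D\<in>\<D>'. emeasure \<eta> D)" if "\<eta> \<in> space ?V" for \<eta>
    proof -
      have s: "sets \<eta> = sets \<nu>" using that by (simp add: sets_point_pattern)
      have "(\<Sum>D\<in>\<D>'. emeasure \<eta> D) = emeasure \<eta> (\<Union>D\<in>\<D>'. D)"
      proof (rule sum_emeasure)
        show "(\<lambda>D. D) ` \<D>' \<subseteq> sets \<eta>" using D'(1) D(3) s by (auto simp: fin_sets_def)
        show "disjoint_family_on (\<lambda>D. D) \<D>'"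
          using D'(1) disjointD[OF D(4)] unfolding disjoint_family_on_def by blast
        show "finite \<D>'" using D'(1) D(1) by (rule finite_subset)
      qed
      then show ?thesis using D' by simp
    qed
    moreover have "(\<lambda>\<eta>. \<Sum>D\<in>\<D>'. emeasure \<eta> D) \<in> borel_measurable ?V"
    proof (intro borel_measurable_sum)
      fix D assume "D \<in> \<D>'"
      then have "D \<in> B ` {1..N}" using D' bij_betw_imp_surj_on[OF B] by blast
      then obtain j where "j \<in> {1..N}" "D = B j" by blast
      then show "(\<lambda>\<eta>. emeasure \<eta> D) \<in> borel_measurable ?V" by (simp add: measurable_emeasure_vimage_counts)
    qed
    ultimately show ?thesis by (subst measurable_cong) auto
  qed
  have "A j \<in> cylinders \<nu> {1..N} B" if j: "j \<in> J" for j
  proof -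
    have "cylinders \<nu> (\<AA> j) (\<lambda>B. B) \<subseteq> sets ?V"
      using j by (intro cylinders_subset_sets meas) (auto simp: \<A>_def)
    then show ?thesis using AA(3)[OF j] by (auto simp: sets_vimage_counts)
  qed
  then have "\<forall>j\<in>J. \<exists>E. E \<in> sets (PiM {1..N} (\<lambda>_. borel)) \<and> A j = counts {1..N} B -` E \<inter> point_patterns \<nu>"
    unfolding cylinders_def by blast
  then obtain E where "\<And>j. j \<in> J \<Longrightarrow> E j \<in> sets (PiM {1..N} (\<lambda>_. borel))"
    "\<And>j. j \<in> J \<Longrightarrow> A j = counts {1..N} B -` E j \<inter> point_patterns \<nu>" by metis
  then show ?thesis using that[OF N B1 disj] by blast
qed

end

section \<open>Poisson point processes\<close>

lemma ennreal_le_divide_iff: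
  fixes c :: ennreal
  assumes c: "c \<noteq> 0" "c \<noteq> \<infinity>"
  shows "x \<le> y / c \<longleftrightarrow> c * x \<le> y"
proof
  have *: "z * c / c = z" for z using c by (intro ennreal_mult_divide_eq) auto
  assume "x \<le> y / c"
  then have "c * x \<le> c * (y / c)" by (intro mult_left_mono) auto
  also have "c * (y / c) = y" using *[of y] by (simp add: ennreal_times_divide mult.commute)
  finally show "c * x \<le> y" .
next
  have *: "z * c / c = z" for z using c by (intro ennreal_mult_divide_eq) auto
  assume "c * x \<le> y"
  then have "x * c / c \<le> y / c" by (intro divide_right_mono_ennreal) (simp add: mult.commute)
  then show "x \<le> y / c" by (simp only: *)
qed

lemma prob_space_density_poisson_ref:
  assumes "a \<ge> 0"
  shows "prob_space (density poisson_ref (\<lambda>x. ennreal (poisson_density a x)))"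
proof -
  have "prob_space (poisson_ennreal (ennreal a))"
    unfolding poisson_ennreal_def
    by (auto intro!: prob_space_return prob_space.prob_space_distr measure_pmf.prob_space_axioms)
  then show ?thesis by (simp add: poisson_ennreal_eq_density assms)
qed

lemma distr_counts_poisson:
  fixes B :: "nat \<Rightarrow> 'a set"
  assumes pp: "poisson_pp \<Lambda> P" and N: "N \<ge> 1" and B: "\<And>j. j \<in> {1..N} \<Longrightarrow> B j \<in> sets \<Lambda>"
    and fin: "\<And>j. j \<in> {1..N} \<Longrightarrow> emeasure \<Lambda> (B j) < \<infinity>" and disj: "disjoint_family_on B {1..N}"
  shows "distr P (PiM {1..N} (\<lambda>_. borel)) (counts {1..N} B) =
    density (PiM {1..N} (\<lambda>_. poisson_ref)) (\<lambda>x. ennreal (\<Prod>j\<in>{1..N}. poisson_density (measure \<Lambda> (B j)) (x j)))"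
proof -
  interpret prob_space P using pp by (simp add: poisson_pp_def)
  have sets_P: "sets P = sets (point_pattern_algebra \<Lambda>)" using pp by (simp add: poisson_pp_def)
  have rv: "(\<lambda>\<eta>. emeasure \<eta> (B j)) \<in> borel_measurable P" if "j \<in> {1..N}" for j
    using measurable_point_pattern_eval[OF B[OF that]] sets_P by (simp cong: measurable_cong_sets)
  have "indep_vars (\<lambda>_. borel) (\<lambda>i \<eta>. emeasure \<eta> (B i)) {1..N}"
    using pp N B disj unfolding poisson_pp_def by (auto simp: Pi_iff)
  then have "distr P (PiM {1..N} (\<lambda>_. borel)) (counts {1..N} B) = PiM {1..N} (\<lambda>i. distr P borel (\<lambda>\<eta>. emeasure \<eta> (B i)))"
    unfolding counts_def using N rv by (subst (asm) indep_vars_iff_distr_eq_PiM') auto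
  also have "\<dots> = PiM {1..N} (\<lambda>i. density poisson_ref (\<lambda>x. ennreal (poisson_density (measure \<Lambda> (B i)) x)))"
  proof (intro PiM_cong refl)
    fix i assume i: "i \<in> {1..N}"
    have "distr P borel (\<lambda>\<eta>. emeasure \<eta> (B i)) = poisson_ennreal (emeasure \<Lambda> (B i))"
      using pp B[OF i] by (simp add: poisson_pp_def)
    also have "emeasure \<Lambda> (B i) = ennreal (measure \<Lambda> (B i))" using fin[OF i] by (simp add: emeasure_eq_ennreal_measure)
    finally show "distr P borel (\<lambda>\<eta>. emeasure \<eta> (B i)) = density poisson_ref (\<lambda>x. ennreal (poisson_density (measure \<Lambda> (B i)) x))"
      by (simp add: poisson_ennreal_eq_density)
  qed
  also have "\<dots> = density (PiM {1..N} (\<lambda>_. poisson_ref)) (\<lambda>x. \<Prod>j\<in>{1..N}. ennreal (poisson_density (measure \<Lambda> (B j)) (x j)))"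
    by (rule density_PiM[symmetric])
      (auto intro!: prob_space_imp_sigma_finite prob_space_poisson_ref prob_space_density_poisson_ref)
  finally show ?thesis by (simp add: prod_ennreal poisson_density_nonneg)
qed

context poisson_pair
begin

lemma measurable_counts_fin_sets:
  assumes "sets V = sets (point_pattern_algebra \<nu>)" "\<And>i. i \<in> I \<Longrightarrow> B i \<in> fin_sets"
  shows "counts I B \<in> measurable V (PiM I (\<lambda>_. borel))"
  unfolding measurable_cong_sets[OF assms(1) refl]
  using assms(2) by (intro measurable_counts measurable_point_pattern_eval) (auto simp: fin_sets_def)

text \<open>Poisson laws of all finite rates are dominated by that of rate 1, so one product measure
  carries both joint laws. The integral factorises over it, and \<open>exp_order\<close> turns sums
  into products.\<close>

lemma
  fixes B :: "nat \<Rightarrow> 'a set"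
  assumes N: "N \<ge> 1" and B: "\<And>j. j \<in> {1..N} \<Longrightarrow> B j \<in> fin_sets" and disj: "disjoint_family_on B {1..N}"
  defines "p' \<equiv> \<lambda>x. \<Prod>j\<in>{1..N}. poisson_density (measure \<Lambda> (B j)) (x j)"
    and "q' \<equiv> \<lambda>x. \<Prod>j\<in>{1..N}. poisson_density (measure \<mu> (B j)) (x j)"
    and "m' \<equiv> PiM {1..N} (\<lambda>_. poisson_ref)"
  shows densities_of_counts: "dominated_prob_pair (distr P (PiM {1..N} (\<lambda>_. borel)) (counts {1..N} B))
       (distr Q (PiM {1..N} (\<lambda>_. borel)) (counts {1..N} B)) m' p' q'" (is "dominated_prob_pair ?P ?Q _ _ _")
    and power_integral_counts: "\<And>\<alpha>. \<alpha> > 0 \<Longrightarrow> \<alpha> \<noteq> 1 \<Longrightarrow> (\<integral>\<^sup>+x. power_enn \<alpha> (p' x) (q' x) \<partial>m') =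
      exp_order \<alpha> (\<Sum>j\<in>{1..N}. tsallis_term \<alpha> (measure \<Lambda> (B j)) (measure \<mu> (B j)))"
proof -
  interpret R: product_sigma_finite "\<lambda>_::nat. poisson_ref"
    by (simp add: product_sigma_finite_def prob_space_imp_sigma_finite prob_space_poisson_ref)
  have B': "j \<in> {1..N} \<Longrightarrow> B j \<in> sets \<Lambda>" "j \<in> {1..N} \<Longrightarrow> B j \<in> sets \<mu>"
    "j \<in> {1..N} \<Longrightarrow> emeasure \<Lambda> (B j) < \<infinity>" "j \<in> {1..N} \<Longrightarrow> emeasure \<mu> (B j) < \<infinity>" for j
    using B by (auto simp: fin_sets_def)
  have nonneg: "0 \<le> p' x" "0 \<le> q' x" for x
    unfolding p'_def q'_def by (intro prod_nonneg ballI poisson_density_nonneg measure_nonneg)+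
  have counts: "counts {1..N} B \<in> measurable P (PiM {1..N} (\<lambda>_. borel))" "counts {1..N} B \<in> measurable Q (PiM {1..N} (\<lambda>_. borel))"
    using B by (auto intro: measurable_counts_fin_sets)
  have meas: "p' \<in> borel_measurable m'" "q' \<in> borel_measurable m'"
    unfolding p'_def q'_def m'_def by measurable
  have "?P = density m' (\<lambda>x. ennreal (p' x))"
    unfolding m'_def p'_def by (rule distr_counts_poisson[OF ppP N B'(1) B'(3) disj])
  moreover have "?Q = density m' (\<lambda>x. ennreal (q' x))"
    unfolding m'_def q'_def by (rule distr_counts_poisson[OF ppQ N B'(2) B'(4) disj])
  moreover have "sigma_finite_measure m'"
    unfolding m'_def by (rule R.sigma_finite) simp
  ultimately have "densities_of ?P ?Q m' p' q'"
    unfolding densities_of_def using nonneg meas by blast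
  then show "dominated_prob_pair ?P ?Q m' p' q'"
    by (intro dominated_prob_pair.intro dominated_pair.intro PP.prob_space_distr QQ.prob_space_distr counts)
  fix \<alpha> :: real assume \<alpha>: "\<alpha> > 0" "\<alpha> \<noteq> 1"
  have "(\<integral>\<^sup>+x. power_enn \<alpha> (p' x) (q' x) \<partial>m') =
    (\<integral>\<^sup>+x. (\<Prod>j\<in>{1..N}. power_enn \<alpha> (poisson_density (measure \<Lambda> (B j)) (x j)) (poisson_density (measure \<mu> (B j)) (x j))) \<partial>m')"
    unfolding p'_def q'_def by (subst power_enn_prod) (auto intro: poisson_density_nonneg)
  also have "\<dots> = (\<Prod>j\<in>{1..N}. exp_order \<alpha> (tsallis_term \<alpha> (measure \<Lambda> (B j)) (measure \<mu> (B j))))"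
    unfolding m'_def using \<alpha>
    by (subst R.product_nn_integral_prod) (auto simp: nn_integral_power_poisson intro!: prod.cong)
  finally show "(\<integral>\<^sup>+x. power_enn \<alpha> (p' x) (q' x) \<partial>m') =
      exp_order \<alpha> (\<Sum>j\<in>{1..N}. tsallis_term \<alpha> (measure \<Lambda> (B j)) (measure \<mu> (B j)))"
    by (simp only: exp_order_sum)
qed

text \<open>Linear expressions on the pattern space are limits of expressions in cylinder events,
  and each of the latter lives on a single count vector, where Jensen's inequality bounds it by the
  divergence of the counts.\<close>

lemma tsallis_integral_le_by_counts:
  assumes \<alpha>: "\<alpha> > 0" "\<alpha> \<noteq> 1" and d: "densities_of P Q m p q"
    and bound: "\<And>N B m' p' q'. N \<ge> 1 \<Longrightarrow> (\<And>j. j \<in> {1..N::nat} \<Longrightarrow> B j \<in> fin_sets) \<Longrightarrow> disjoint_family_on B {1..N} \<Longrightarrow>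
      dominated_prob_pair (distr P (PiM {1..N} (\<lambda>_. borel)) (counts {1..N} B))
       (distr Q (PiM {1..N} (\<lambda>_. borel)) (counts {1..N} B)) m' p' q' \<Longrightarrow>
      (\<integral>\<^sup>+x. power_enn \<alpha> (p' x) (q' x) \<partial>m') =
        exp_order \<alpha> (\<Sum>j\<in>{1..N}. tsallis_term \<alpha> (measure \<Lambda> (B j)) (measure \<mu> (B j))) \<Longrightarrow>
      tsallis_integral \<alpha> m' p' q' \<le> K"
  shows "tsallis_integral \<alpha> m p q \<le> K"
proof -
  interpret D: dominated_pair P Q m p q by unfold_locales fact
  show ?thesis
  proof (rule D.tsallis_integral_le[OF \<alpha>])
    fix n and r :: "nat \<Rightarrow> real" and C :: "nat \<Rightarrow> 'a measure set"
    assume C: "\<And>j. j \<in> {1..n} \<Longrightarrow> C j \<in> sets m" "disjoint_family_on C {1..n}" and r: "\<And>j. 0 < r j"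
    show "ennreal (\<Sum>j\<in>{1..n}. tangent \<alpha> (r j) (measure P (C j)) (measure Q (C j))) \<le> K"
    proof (rule sum_tangent_le_by_generating_algebra[where G = fin_cylinders])
      show "algebra (space P) fin_cylinders" "sigma_sets (space P) fin_cylinders = sets P"
        using algebra_fin_cylinders sigma_sets_fin_cylinders by simp_all
      show "j \<in> {1..n} \<Longrightarrow> C j \<in> sets P" for j using C(1) D.sets_eq(1) by blast
      show "disjoint_family_on C {1..n}" by fact
      fix A assume A: "\<And>j::nat. A j \<in> fin_cylinders"
      obtain N :: nat and B E where NB: "N \<ge> 1" "\<And>j. j \<in> {1..N} \<Longrightarrow> B j \<in> fin_sets" "disjoint_family_on B {1..N}"
        and E: "\<And>j. j \<in> {1..n} \<Longrightarrow> E j \<in> sets (PiM {1..N} (\<lambda>_. borel))"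
        "\<And>j. j \<in> {1..n} \<Longrightarrow> A j = counts {1..N} B -` E j \<inter> point_patterns \<nu>"
        by (rule finitely_many_cylinders[of "{1..n}" A]) (use A in blast)+
      let ?X = "counts {1..N} B" and ?N = "PiM {1..N} (\<lambda>_. borel :: ennreal measure)"
      define m' where "m' = PiM {1..N} (\<lambda>_. poisson_ref)"
      define p' where "p' = (\<lambda>x. \<Prod>j\<in>{1..N}. poisson_density (measure \<Lambda> (B j)) (x j))"
      define q' where "q' = (\<lambda>x. \<Prod>j\<in>{1..N}. poisson_density (measure \<mu> (B j)) (x j))"
      have dd: "dominated_prob_pair (distr P ?N ?X) (distr Q ?N ?X) m' p' q'"
        unfolding m'_def p'_def q'_def by (rule densities_of_counts[OF NB])
      interpret D': dominated_prob_pair "distr P ?N ?X" "distr Q ?N ?X" m' p' q' by (rule dd)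
      \<comment> \<open>The differences are formed in the count space, which makes them disjoint
        there, and they pull back to the required differences of cylinders.\<close>
      define E' where "E' j = E j - (\<Union>i\<in>{1..<j}. E i)" for j
      have E'm: "E' j \<in> sets ?N" if "j \<in> {1..n}" for j
        using that E(1) unfolding E'_def by (intro sets.Diff sets.finite_UN) auto
      have E'A: "?X -` E' j \<inter> point_patterns \<nu> = A j - (\<Union>i\<in>{1..<j}. A i)" if j: "j \<in> {1..n}" for j
      proof -
        have "(\<Union>i\<in>{1..<j}. A i) = (\<Union>i\<in>{1..<j}. ?X -` E i \<inter> point_patterns \<nu>)"
          using j by (intro SUP_cong refl E(2)) auto
        then show ?thesis unfolding E'_def E(2)[OF j] by auto
      qed
      have X: "?X \<in> measurable P ?N" "?X \<in> measurable Q ?N"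
        using NB(2) by (auto intro: measurable_counts_fin_sets)
      have "ennreal (\<Sum>j\<in>{1..n}. tangent \<alpha> (r j) (measure P (A j - (\<Union>i\<in>{1..<j}. A i))) (measure Q (A j - (\<Union>i\<in>{1..<j}. A i))))
        = ennreal (\<Sum>j\<in>{1..n}. tangent \<alpha> (r j) (measure (distr P ?N ?X) (E' j)) (measure (distr Q ?N ?X) (E' j)))"
        using X E'm E'A by (intro arg_cong[where f = ennreal] sum.cong) (auto simp: measure_distr)
      also have "\<dots> \<le> (\<Sum>j\<in>{1..n}. tsallis_term \<alpha> (measure (distr P ?N ?X) (E' j)) (measure (distr Q ?N ?X) (E' j)))"
        using \<alpha> r by (intro sum_tangent_le) auto
      also have "\<dots> \<le> tsallis_integral \<alpha> m' p' q'"
      proof (rule D'.sum_tsallis_measure_le[OF \<alpha>])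
        show "j \<in> {1..n} \<Longrightarrow> E' j \<in> sets m'" for j using E'm D'.sets_eq(1) by simp
        show "emeasure (distr P ?N ?X) (E' j) < \<infinity>" "emeasure (distr Q ?N ?X) (E' j) < \<infinity>" for j
          using D'.P.emeasure_finite D'.Q.emeasure_finite by (simp_all add: less_top[symmetric])
        show "disjoint_family_on E' {1..n}"
          unfolding disjoint_family_on_def
        proof (intro ballI impI)
          fix i j assume "i \<in> {1..n}" "j \<in> {1..n}" "i \<noteq> j"
          then have "i \<in> {1..<j} \<or> j \<in> {1..<i}" by auto
          then show "E' i \<inter> E' j = {}" by (auto simp: E'_def)
        qed
      qed simp
      also have "\<dots> \<le> K"
        using bound[OF NB dd] power_integral_counts[OF NB \<alpha>] unfolding m'_def p'_def q'_def by blast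
      finally show "ennreal (\<Sum>j\<in>{1..n}. tangent \<alpha> (r j) (measure P (A j - (\<Union>i\<in>{1..<j}. A i))) (measure Q (A j - (\<Union>i\<in>{1..<j}. A i)))) \<le> K" .
    qed (simp_all add: PP.finite_measure_axioms QQ.finite_measure_axioms)
  qed (simp_all add: prob_space_imp_sigma_finite PP.prob_space_axioms QQ.prob_space_axioms)
qed

lemma tsallis_integral_le_by_sums:
  assumes \<alpha>: "\<alpha> > 0" "\<alpha> \<noteq> 1"
    and bound: "\<And>N B. N \<ge> 1 \<Longrightarrow> (\<And>j. j \<in> {1..N::nat} \<Longrightarrow> B j \<in> fin_sets) \<Longrightarrow> disjoint_family_on B {1..N} \<Longrightarrow>
      (\<Sum>j\<in>{1..N}. tsallis_term \<alpha> (measure \<Lambda> (B j)) (measure \<mu> (B j))) \<le> K"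
  shows "tsallis_integral \<alpha> \<nu> f g \<le> K"
proof (rule tsallis_integral_le[OF \<alpha> sf_L sf_M])
  fix n and r :: "nat \<Rightarrow> real" and C :: "nat \<Rightarrow> 'a set"
  assume C: "\<And>j. j \<in> {1..n} \<Longrightarrow> C j \<in> sets \<nu>" "\<And>j. j \<in> {1..n} \<Longrightarrow> emeasure \<Lambda> (C j) < \<infinity>"
    "\<And>j. j \<in> {1..n} \<Longrightarrow> emeasure \<mu> (C j) < \<infinity>" and r: "\<And>j. 0 < r j" and disj: "disjoint_family_on C {1..n}"
  show "ennreal (\<Sum>j\<in>{1..n}. tangent \<alpha> (r j) (measure \<Lambda> (C j)) (measure \<mu> (C j))) \<le> K"
  proof (cases "n = 0")
    case False
    have "ennreal (\<Sum>j\<in>{1..n}. tangent \<alpha> (r j) (measure \<Lambda> (C j)) (measure \<mu> (C j))) \<le>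
      (\<Sum>j\<in>{1..n}. tsallis_term \<alpha> (measure \<Lambda> (C j)) (measure \<mu> (C j)))"
      using \<alpha> r by (intro sum_tangent_le) auto
    also have "\<dots> \<le> K" using C disj False by (intro bound) (auto simp: fin_sets_def)
    finally show ?thesis .
  qed simp
qed

text \<open>Writing the integral as \<open>exp_order \<alpha> R\<close>, data processing gives \<open>T\<^sub>\<alpha>(\<Lambda>\<parallel>\<mu>) \<le> R\<close> and approximation by
  counts gives the converse, so no continuity of \<open>exp_order\<close> is needed.\<close>

lemma power_integral_poisson_pp:
  assumes \<alpha>: "\<alpha> > 0" "\<alpha> \<noteq> 1" and d: "densities_of P Q m p q"
  shows "(\<integral>\<^sup>+x. power_enn \<alpha> (p x) (q x) \<partial>m) = exp_order \<alpha> (tsallis_integral \<alpha> \<nu> f g)"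
proof -
  let ?T = "tsallis_integral \<alpha> \<nu> f g" and ?I = "\<integral>\<^sup>+x. power_enn \<alpha> (p x) (q x) \<partial>m"
  interpret D: dominated_prob_pair P Q m p q
    by (simp add: dominated_prob_pair_def dominated_pair_def d PP.prob_space_axioms QQ.prob_space_axioms)
  let ?s = "\<lambda>N B. \<Sum>j\<in>{1..N::nat}. tsallis_term \<alpha> (measure \<Lambda> (B j)) (measure \<mu> (B j))"
  let ?D = "tsallis_integral \<alpha> m p q"
  have s_le: "?s N B \<le> ?T" if "\<And>j. j \<in> {1..N} \<Longrightarrow> B j \<in> fin_sets" "disjoint_family_on B {1..N}" for N B
    using that by (intro sum_tsallis_measure_le[OF \<alpha>]) (auto simp: fin_sets_def)
  have counts: "\<exists>m' p' q'. dominated_prob_pair (distr P (PiM {1..N} (\<lambda>_. borel)) (counts {1..N} B))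
       (distr Q (PiM {1..N} (\<lambda>_. borel)) (counts {1..N} B)) m' p' q' \<and>
      (\<integral>\<^sup>+x. power_enn \<alpha> (p' x) (q' x) \<partial>m') = exp_order \<alpha> (?s N B) \<and> tsallis_integral \<alpha> m' p' q' \<le> ?D"
    if NB: "N \<ge> 1" "\<And>j. j \<in> {1..N} \<Longrightarrow> B j \<in> fin_sets" "disjoint_family_on B {1..N}" for N B
  proof -
    have "counts {1..N} B \<in> measurable m (PiM {1..N} (\<lambda>_. borel))"
      using NB(2) D.sets_eq(1) by (intro measurable_counts_fin_sets) auto
    from tsallis_integral_distr_le[OF \<alpha> D.dominated_prob_pair_axioms this]
    show ?thesis
      using densities_of_counts[OF NB] power_integral_counts[OF NB \<alpha>]
      unfolding dominated_prob_pair_def dominated_pair_def by blast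
  qed
  show ?thesis
  proof (cases "\<alpha> < 1")
    case True
    have rel: "ennreal (1 - \<alpha>) * ?D + ?I = 1" by (rule D.power_integral_lt_1[OF \<alpha>(1) True])
    have fin: "ennreal (1 - \<alpha>) * ?D \<noteq> \<infinity>" using rel by (metis ennreal_add_eq_top ennreal_one_neq_top infinity_ennreal_def)
    have "?I \<le> 1" using rel by (metis add.commute le_iff_add)
    then obtain R where R: "?I = exp_order \<alpha> R" using ex_exp_order_lt_1[OF True] by blast
    \<comment> \<open>By data processing the counts have a smaller Tsallis integral, hence for
      \<alpha> < 1 a larger power integral; the antitone \<open>exp_order\<close> turns this into a
      bound on exponents.\<close>
    have sR: "?s N B \<le> R" if NB: "N \<ge> 1" "\<And>j. j \<in> {1..N} \<Longrightarrow> B j \<in> fin_sets" "disjoint_family_on B {1..N}" for N B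
    proof -
      obtain m' p' q' where dp: "dominated_prob_pair (distr P (PiM {1..N} (\<lambda>_. borel)) (counts {1..N} B))
       (distr Q (PiM {1..N} (\<lambda>_. borel)) (counts {1..N} B)) m' p' q'"
       and I': "(\<integral>\<^sup>+x. power_enn \<alpha> (p' x) (q' x) \<partial>m') = exp_order \<alpha> (?s N B)" and D': "tsallis_integral \<alpha> m' p' q' \<le> ?D"
        using counts[OF NB] by blast
      have "ennreal (1 - \<alpha>) * ?D + ?I = ennreal (1 - \<alpha>) * tsallis_integral \<alpha> m' p' q' + exp_order \<alpha> (?s N B)"
        using dominated_prob_pair.power_integral_lt_1[OF dp \<alpha>(1) True] rel I' by simp
      also have "\<dots> \<le> ennreal (1 - \<alpha>) * ?D + exp_order \<alpha> (?s N B)"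
        by (intro add_right_mono mult_left_mono D') auto
      finally have "?I \<le> exp_order \<alpha> (?s N B)" using fin by (simp add: ennreal_add_left_cancel_le)
      then show ?thesis unfolding R exp_order_le_iff_lt_1[OF True] .
    qed
    have "?T \<le> R"
    proof (rule tsallis_integral_le_by_sums[OF \<alpha>])
      fix N :: nat and B
      assume "N \<ge> 1" "\<And>j. j \<in> {1..N} \<Longrightarrow> B j \<in> fin_sets" "disjoint_family_on B {1..N}"
      then show "?s N B \<le> R" by (rule sR)
    qed
    moreover have "R \<le> ?T"
    proof -
      have c: "ennreal (1 - \<alpha>) \<noteq> 0" "ennreal (1 - \<alpha>) \<noteq> \<infinity>" using True by auto
      \<comment> \<open>This is (1 - \<alpha>) T + I = 1 solved for T, because the approximation by
        counts bounds Tsallis integrals, while the available estimate says that no count vector has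
        a power integral below \<open>exp_order \<alpha> ?T\<close>.\<close>
      have "?D \<le> (1 - exp_order \<alpha> ?T) / ennreal (1 - \<alpha>)"
      proof (rule tsallis_integral_le_by_counts[OF \<alpha> d])
        fix N B m' p' q'
        assume NB: "N \<ge> 1" "\<And>j. j \<in> {1..N} \<Longrightarrow> B j \<in> fin_sets" "disjoint_family_on B {1..N}"
          and dp: "dominated_prob_pair (distr P (PiM {1..N} (\<lambda>_. borel)) (counts {1..N} B))
            (distr Q (PiM {1..N} (\<lambda>_. borel)) (counts {1..N} B)) m' p' q'"
          and I': "(\<integral>\<^sup>+x. power_enn \<alpha> (p' x) (q' x) \<partial>m') = exp_order \<alpha> (?s N B)"
        have "exp_order \<alpha> ?T \<le> exp_order \<alpha> (?s N B)"
          using s_le[OF NB(2,3)] exp_order_le_iff_lt_1[OF True] by simp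
        moreover have "ennreal (1 - \<alpha>) * tsallis_integral \<alpha> m' p' q' + exp_order \<alpha> (?s N B) = 1"
          using dominated_prob_pair.power_integral_lt_1[OF dp \<alpha>(1) True] I' by simp
        ultimately have le: "ennreal (1 - \<alpha>) * tsallis_integral \<alpha> m' p' q' + exp_order \<alpha> ?T \<le> 1"
          by (metis add_left_mono)
        have "exp_order \<alpha> ?T \<noteq> \<infinity>" using True by (auto simp: exp_order_def)
        then have "ennreal (1 - \<alpha>) * tsallis_integral \<alpha> m' p' q' \<le> 1 - exp_order \<alpha> ?T"
          using le by (metis add.commute ennreal_le_minus_iff infinity_ennreal_def)
        then show "tsallis_integral \<alpha> m' p' q' \<le> (1 - exp_order \<alpha> ?T) / ennreal (1 - \<alpha>)"
          by (simp only: ennreal_le_divide_iff[OF c])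
      qed
      then have "ennreal (1 - \<alpha>) * ?D \<le> 1 - exp_order \<alpha> ?T"
        unfolding ennreal_le_divide_iff[OF c] .
      then have "ennreal (1 - \<alpha>) * ?D + exp_order \<alpha> ?T \<le> (1 - exp_order \<alpha> ?T) + exp_order \<alpha> ?T"
        by (rule add_right_mono)
      also have "\<dots> = 1"
        using exp_order_le_iff_lt_1[OF True, of ?T 0] by (intro diff_add_cancel_ennreal) simp
      finally have "ennreal (1 - \<alpha>) * ?D + exp_order \<alpha> ?T \<le> ennreal (1 - \<alpha>) * ?D + ?I" unfolding rel .
      then have "exp_order \<alpha> ?T \<le> exp_order \<alpha> R" using fin R by (simp add: ennreal_add_left_cancel_le)
      then show ?thesis unfolding exp_order_le_iff_lt_1[OF True] .
    qed
    ultimately show ?thesis using R by simp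
  next
    case False
    with \<alpha> have a1: "\<alpha> > 1" by simp
    have rel: "?I = 1 + ennreal (\<alpha> - 1) * ?D" by (rule D.power_integral_gt_1[OF a1])
    then have "1 \<le> ?I" by simp
    then obtain R where R: "?I = exp_order \<alpha> R" using ex_exp_order_gt_1[OF a1] by blast
    \<comment> \<open>For \<alpha> > 1 the power integral increases with the Tsallis integral and
      \<open>exp_order\<close> is monotone, so neither comparison is reversed.\<close>
    have sR: "?s N B \<le> R" if NB: "N \<ge> 1" "\<And>j. j \<in> {1..N} \<Longrightarrow> B j \<in> fin_sets" "disjoint_family_on B {1..N}" for N B
    proof -
      obtain m' p' q' where dp: "dominated_prob_pair (distr P (PiM {1..N} (\<lambda>_. borel)) (counts {1..N} B))
       (distr Q (PiM {1..N} (\<lambda>_. borel)) (counts {1..N} B)) m' p' q'"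
       and I': "(\<integral>\<^sup>+x. power_enn \<alpha> (p' x) (q' x) \<partial>m') = exp_order \<alpha> (?s N B)" and D': "tsallis_integral \<alpha> m' p' q' \<le> ?D"
        using counts[OF NB] by blast
      have "exp_order \<alpha> (?s N B) = 1 + ennreal (\<alpha> - 1) * tsallis_integral \<alpha> m' p' q'"
        using dominated_prob_pair.power_integral_gt_1[OF dp a1] I' by simp
      also have "\<dots> \<le> ?I" unfolding rel by (intro add_left_mono mult_left_mono D') auto
      finally show ?thesis unfolding R exp_order_le_iff_gt_1[OF a1] .
    qed
    have "?T \<le> R"
    proof (rule tsallis_integral_le_by_sums[OF \<alpha>])
      fix N :: nat and B
      assume "N \<ge> 1" "\<And>j. j \<in> {1..N} \<Longrightarrow> B j \<in> fin_sets" "disjoint_family_on B {1..N}"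
      then show "?s N B \<le> R" by (rule sR)
    qed
    moreover have "R \<le> ?T"
    proof -
      have c: "ennreal (\<alpha> - 1) \<noteq> 0" "ennreal (\<alpha> - 1) \<noteq> \<infinity>" using a1 by auto
      have "?D \<le> (exp_order \<alpha> ?T - 1) / ennreal (\<alpha> - 1)"
      proof (rule tsallis_integral_le_by_counts[OF \<alpha> d])
        fix N B m' p' q'
        assume NB: "N \<ge> 1" "\<And>j. j \<in> {1..N} \<Longrightarrow> B j \<in> fin_sets" "disjoint_family_on B {1..N}"
          and dp: "dominated_prob_pair (distr P (PiM {1..N} (\<lambda>_. borel)) (counts {1..N} B))
            (distr Q (PiM {1..N} (\<lambda>_. borel)) (counts {1..N} B)) m' p' q'"
          and I': "(\<integral>\<^sup>+x. power_enn \<alpha> (p' x) (q' x) \<partial>m') = exp_order \<alpha> (?s N B)"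
        have "exp_order \<alpha> (?s N B) \<le> exp_order \<alpha> ?T"
          using s_le[OF NB(2,3)] exp_order_le_iff_gt_1[OF a1] by simp
        moreover have "exp_order \<alpha> (?s N B) = 1 + ennreal (\<alpha> - 1) * tsallis_integral \<alpha> m' p' q'"
          using dominated_prob_pair.power_integral_gt_1[OF dp a1] I' by simp
        ultimately have "1 + ennreal (\<alpha> - 1) * tsallis_integral \<alpha> m' p' q' \<le> exp_order \<alpha> ?T" by simp
        then have "ennreal (\<alpha> - 1) * tsallis_integral \<alpha> m' p' q' \<le> exp_order \<alpha> ?T - 1"
          by (simp add: ennreal_le_minus_iff add.commute)
        then show "tsallis_integral \<alpha> m' p' q' \<le> (exp_order \<alpha> ?T - 1) / ennreal (\<alpha> - 1)"
          by (simp only: ennreal_le_divide_iff[OF c])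
      qed
      then have "ennreal (\<alpha> - 1) * ?D \<le> exp_order \<alpha> ?T - 1"
        unfolding ennreal_le_divide_iff[OF c] .
      then have "?I \<le> 1 + (exp_order \<alpha> ?T - 1)" unfolding rel by (rule add_left_mono)
      also have "\<dots> = exp_order \<alpha> ?T"
        using exp_order_le_iff_gt_1[OF a1, of 0 ?T] by (subst add.commute, intro diff_add_cancel_ennreal) simp
      finally show ?thesis unfolding R exp_order_le_iff_gt_1[OF a1] .
    qed
    ultimately show ?thesis using R by simp
  qed
qed

section \<open>Divergences of the processes at orders other than 1, at order 1 and at order
  0\<close>

lemma renyi_eq_tsallis_order_neq_1:
  assumes \<alpha>: "\<alpha> > 0" "\<alpha> \<noteq> 1" and d: "dominated_prob_pair P Q m p q"
  shows "renyi_divergence \<alpha> P Q = enn2ereal (tsallis_integral \<alpha> \<nu> f g)"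
  using dominated_prob_pair.renyi_divergence_conv_power[OF d \<alpha>]
    power_integral_poisson_pp[OF \<alpha> dominated_pair.dens[OF dominated_prob_pair.axioms(1)[OF d]]] ln_exp_order[OF \<alpha>(2)]
  by simp

lemma tsallis_integral_poisson_pp:
  assumes \<alpha>: "0 < \<alpha>" "\<alpha> < 1" and d: "dominated_prob_pair P Q m p q"
  shows "tsallis_integral \<alpha> m p q = (1 - exp_order \<alpha> (tsallis_integral \<alpha> \<nu> f g)) / ennreal (1 - \<alpha>)"
proof -
  have "ennreal (1 - \<alpha>) * tsallis_integral \<alpha> m p q + exp_order \<alpha> (tsallis_integral \<alpha> \<nu> f g) = 1"
    using dominated_prob_pair.power_integral_lt_1[OF d \<alpha>] \<alpha>
      power_integral_poisson_pp[OF _ _ dominated_pair.dens[OF dominated_prob_pair.axioms(1)[OF d]]] by simp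
  then have "tsallis_integral \<alpha> m p q * ennreal (1 - \<alpha>) = 1 - exp_order \<alpha> (tsallis_integral \<alpha> \<nu> f g)"
    by (metis ennreal_add_diff_cancel_right ennreal_add_eq_top ennreal_one_neq_top mult.commute)
  then show ?thesis using \<alpha> by (metis diff_gt_0_iff_gt ennreal_eq_0_iff ennreal_mult_divide_eq ennreal_neq_top not_le)
qed

text \<open>With s = 1/(n + 2), \<open>D n\<close> is (1 - exp (- s T)) / s for T =
  \<open>T n\<close>, which is at most T as exp x is at least 1 + x. For the converse s and T vary
  together and T may be infinite; so a finite t below some \<open>T k\<close> is frozen,
  \<open>T\<close> only grows from k on, and the quotient with t tends to t.\<close>

lemma tsallis_integral_1_poisson_pp:
  assumes d: "dominated_prob_pair P Q m p q"
  shows "tsallis_integral 1 m p q = tsallis_integral 1 \<nu> f g"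
proof -
  interpret D: dominated_prob_pair P Q m p q by fact
  define \<alpha> where "\<alpha> n = 1 - 1 / (real n + 2)" for n
  have \<alpha>: "0 < \<alpha> n" "\<alpha> n < 1" for n by (auto simp: \<alpha>_def)
  define T where "T n = tsallis_integral (\<alpha> n) \<nu> f g" for n
  define D where "D n = tsallis_integral (\<alpha> n) m p q" for n
  have T1: "tsallis_integral 1 \<nu> f g = (SUP n. T n)" and Tinc: "incseq T"
    using tsallis_integral_SUP_1[OF meas_f meas_g f_nonneg g_nonneg] by (auto simp: T_def[abs_def] \<alpha>_def)
  have D1: "tsallis_integral 1 m p q = (SUP n. D n)"
    using tsallis_integral_SUP_1(1)[OF D.meas_f D.meas_g D.f_nonneg D.g_nonneg] by (auto simp: D_def \<alpha>_def)
  have DT: "D n = (1 - exp_order (\<alpha> n) (T n)) / ennreal (1 - \<alpha> n)" for n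
    unfolding D_def T_def by (rule tsallis_integral_poisson_pp[OF \<alpha> d])
  have fin: "(1 - exp_order (\<alpha> n) (ennreal t)) / ennreal (1 - \<alpha> n) = ennreal ((1 - exp (- (1 - \<alpha> n) * t)) / (1 - \<alpha> n))"
    if "t \<ge> 0" for t n
  proof -
    have "exp (- (1 - \<alpha> n) * t) \<le> 1" using that \<alpha>[of n] by (simp add: mult_nonpos_nonneg)
    then show ?thesis
      using that \<alpha>[of n] by (simp add: exp_order_def divide_ennreal ennreal_minus flip: ennreal_1)
  qed
  have "D n \<le> T n" for n
  proof (cases "T n")
    case (real t)
    have "1 - exp (- (1 - \<alpha> n) * t) \<le> (1 - \<alpha> n) * t"
      using exp_ge_add_one_self[of "- (1 - \<alpha> n) * t"] by (simp add: algebra_simps)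
    then have "(1 - exp (- (1 - \<alpha> n) * t)) / (1 - \<alpha> n) \<le> t"
      using \<alpha>[of n] by (simp add: divide_le_eq mult.commute)
    then show ?thesis using real fin[of t n] by (simp add: DT ennreal_leI)
  qed simp
  then have "(SUP n. D n) \<le> (SUP n. T n)" by (rule SUP_mono')
  moreover have "(SUP n. T n) \<le> (SUP n. D n)"
  proof (rule SUP_least, rule ccontr)
    fix k assume "\<not> T k \<le> (SUP n. D n)"
    then have lt: "(SUP n. D n) < T k" by simp
    then obtain x where x: "x \<ge> 0" "(SUP n. D n) = ennreal x" by (cases "SUP n. D n") (auto simp: less_top)
    \<comment> \<open>\<open>t\<close> exceeds the supposed supremum \<open>x\<close> but is finite
      and at most \<open>T k\<close>, even if \<open>T k\<close> is infinite.\<close>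
    obtain t where t: "x < t" "ennreal t \<le> T k"
    proof (cases "T k")
      case (real t)
      then show ?thesis using lt x by (intro that[of t]) (auto simp: ennreal_less_iff)
    next
      case top
      then show ?thesis by (intro that[of "x + 1"]) auto
    qed
    have t0: "t \<ge> 0" using t x by simp
    have "((\<lambda>s. 1 - exp (- s * t)) has_real_derivative t) (at 0)"
      by (auto intro!: derivative_eq_intros)
    then have d: "((\<lambda>s. (1 - exp (- s * t)) / s) \<longlongrightarrow> t) (at 0)"
      by (simp add: has_field_derivative_iff)
    have "(\<lambda>n. ennreal ((1 - exp (- (1 - \<alpha> n) * t)) / (1 - \<alpha> n))) \<longlonglongrightarrow> ennreal t"
      using filterlim_compose[OF d filterlim_inverse_at_0] by (intro tendsto_ennrealI) (simp add: \<alpha>_def)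
    then have "ennreal t \<le> (SUP n. D n)"
    proof (rule LIMSEQ_le_const2, intro exI[of _ k] allI impI)
      fix n assume "k \<le> n"
      then have "ennreal t \<le> T n" using t(2) incseqD[OF Tinc] by (meson order.trans)
      then have "exp_order (\<alpha> n) (T n) \<le> exp_order (\<alpha> n) (ennreal t)"
        using exp_order_le_iff_lt_1[OF \<alpha>(2)] by blast
      then have "(1 - exp_order (\<alpha> n) (ennreal t)) / ennreal (1 - \<alpha> n) \<le> D n"
        unfolding DT by (intro divide_right_mono_ennreal ennreal_minus_mono) auto
      then have "ennreal ((1 - exp (- (1 - \<alpha> n) * t)) / (1 - \<alpha> n)) \<le> D n"
        by (simp only: fin[OF t0])
      then show "ennreal ((1 - exp (- (1 - \<alpha> n) * t)) / (1 - \<alpha> n)) \<le> (SUP n. D n)"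
        by (rule order.trans) (rule SUP_upper, simp)
    qed
    then show False using t x by (simp add: ennreal_le_iff)
  qed
  ultimately show ?thesis unfolding T1 D1 by (rule antisym)
qed

text \<open>As the order tends to 0, the Tsallis integral of the laws tends to 1 - exp (-
  \<open>t 0\<close>), so {p > 0} has probability exp (- \<open>t 0\<close>) under \<open>Q\<close>.
  Finiteness at some order supplies the majorant for the limit.\<close>

lemma renyi_0_eq_tsallis_0:
  assumes d: "dominated_prob_pair P Q m p q" and \<alpha>: "0 < \<alpha>" and fin: "tsallis_integral \<alpha> \<nu> f g < \<infinity>"
  shows "renyi_divergence 0 P Q = enn2ereal (tsallis_integral 0 \<nu> f g)"
proof -
  interpret D: dominated_prob_pair P Q m p q by fact
  obtain \<beta> where \<beta>: "0 < \<beta>" "\<beta> < 1" "tsallis_integral \<beta> \<nu> f g < \<infinity>"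
  proof (cases "\<alpha> < 1")
    case False
    \<comment> \<open>Monotonicity through order 1 transfers finiteness from \<alpha> \<ge> 1 to an
      order below 1, where the exponential formula and the limit at 0 apply.\<close>
    have "tsallis_term (1 / 2) a b \<le> tsallis_term \<alpha> a b" if "a \<ge> 0" "b \<ge> 0" for a b
      using tsallis_term_le_1[of "1 / 2" a b] tsallis_term_1_le[of \<alpha> a b] False that
      by (cases "\<alpha> = 1") auto
    then have "tsallis_integral (1 / 2) \<nu> f g \<le> tsallis_integral \<alpha> \<nu> f g"
      unfolding tsallis_integral_def by (intro nn_integral_mono) (auto simp: f_nonneg g_nonneg)
    then show ?thesis using fin by (intro that[of "1 / 2"]) auto
  qed (use \<alpha> fin that in blast)
  define \<gamma> where "\<gamma> n = \<beta> / (real n + 1)" for n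
  have \<gamma>: "0 < \<gamma> n" "\<gamma> n \<le> \<beta>" for n using \<beta> by (auto simp: \<gamma>_def divide_simps)
  have \<gamma>1: "\<gamma> n < 1" for n using \<gamma>(2)[of n] \<beta>(2) by simp
  have \<gamma>0: "\<gamma> \<longlonglongrightarrow> 0"
    using tendsto_mult[OF tendsto_const[of \<beta>] LIMSEQ_inverse_real_of_nat]
    by (simp add: divide_inverse add.commute \<gamma>_def[abs_def])
  define T where "T \<alpha> = tsallis_integral \<alpha> \<nu> f g" for \<alpha>
  have Tfin: "T \<alpha> < \<infinity>" if "0 \<le> \<alpha>" "\<alpha> \<le> \<beta>" for \<alpha>
  proof -
    have "T \<alpha> \<le> T \<beta>"
      unfolding T_def tsallis_integral_def using that \<beta>
      by (intro nn_integral_mono tsallis_term_mono_lt_1) (auto simp: f_nonneg g_nonneg)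
    then show ?thesis using \<beta>(3) by (auto simp: T_def intro: le_less_trans)
  qed
  define t where "t \<alpha> = enn2real (T \<alpha>)" for \<alpha>
  have Tt: "T \<alpha> = ennreal (t \<alpha>)" "t \<alpha> \<ge> 0" if "0 \<le> \<alpha>" "\<alpha> \<le> \<beta>" for \<alpha>
    using Tfin[OF that] by (auto simp: t_def less_top)
  have "(\<lambda>n. T (\<gamma> n)) \<longlonglongrightarrow> T 0"
    unfolding T_def \<gamma>_def by (rule tsallis_integral_tendsto_0[OF meas_f meas_g f_nonneg g_nonneg \<beta>])
  then have tlim: "(\<lambda>n. t (\<gamma> n)) \<longlonglongrightarrow> t 0"
    using Tt(1)[of 0] Tt[of "\<gamma> _"] \<gamma> \<beta> unfolding t_def
    by (intro tendsto_enn2real) (auto simp: less_imp_le)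
  have Deq: "tsallis_integral \<alpha> m p q = ennreal ((1 - exp ((\<alpha> - 1) * t \<alpha>)) / (1 - \<alpha>))" if "0 < \<alpha>" "\<alpha> \<le> \<beta>" for \<alpha>
  proof -
    have "tsallis_integral \<alpha> m p q = (1 - ennreal (exp ((\<alpha> - 1) * t \<alpha>))) / ennreal (1 - \<alpha>)"
      using tsallis_integral_poisson_pp[OF _ _ d, of \<alpha>] that \<beta> Tt[of \<alpha>]
      by (simp add: exp_order_def T_def[symmetric])
    moreover have "exp ((\<alpha> - 1) * t \<alpha>) \<le> 1" using Tt(2)[of \<alpha>] that \<beta> by (simp add: mult_nonpos_nonneg)
    ultimately show ?thesis using that \<beta>
      by (simp add: ennreal_minus divide_ennreal flip: ennreal_1)
  qed
  have "(\<lambda>n. tsallis_integral (\<gamma> n) m p q) \<longlonglongrightarrow> tsallis_integral 0 m p q"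
    unfolding \<gamma>_def
    by (rule tsallis_integral_tendsto_0[OF D.meas_f D.meas_g D.f_nonneg D.g_nonneg \<beta>(1,2)])
      (use Deq[of \<beta>] \<beta> in auto)
  moreover have "(\<lambda>n. tsallis_integral (\<gamma> n) m p q) \<longlonglongrightarrow> ennreal ((1 - exp ((0 - 1) * t 0)) / (1 - 0))"
    unfolding Deq[OF \<gamma>] by (intro tendsto_ennrealI tendsto_intros \<gamma>0 tlim) auto
  ultimately have "tsallis_integral 0 m p q = ennreal (1 - exp (- t 0))"
    by (auto dest: LIMSEQ_unique)
  moreover have "exp (- t 0) \<le> 1" using Tt(2)[of 0] \<beta> by simp
  ultimately have "1 - tsallis_integral 0 m p q = ennreal (exp (- t 0))"
    by (simp add: ennreal_minus flip: ennreal_1)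
  then show ?thesis
    using D.renyi_divergence_0 Tt[of 0] \<beta>(1)
    by (simp add: ln_ereal_def enn2ereal_ennreal T_def)
qed

end

theorem theorem5p1:
  fixes \<Lambda> \<mu> :: "'a measure"
    and P\<^sub>\<Lambda> P\<^sub>\<mu> :: "'a measure measure"
  assumes "sigma_finite_measure \<Lambda>" and "sigma_finite_measure \<mu>"
    and "sets \<Lambda> = sets \<mu>"
    and "poisson_pp \<Lambda> P\<^sub>\<Lambda>" and "poisson_pp \<mu> P\<^sub>\<mu>"
  shows "(\<forall>\<alpha>::real. \<alpha> > 0 \<longrightarrow>
            renyi_divergence \<alpha> P\<^sub>\<Lambda> P\<^sub>\<mu> = tsallis_divergence \<alpha> \<Lambda> \<mu>) \<and>
         ((\<exists>\<alpha>::real. \<alpha> > 0 \<and> tsallis_divergence \<alpha> \<Lambda> \<mu> < \<infinity>) \<longrightarrow>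
            renyi_divergence 0 P\<^sub>\<Lambda> P\<^sub>\<mu> = tsallis_divergence 0 \<Lambda> \<mu>)"
proof -
  obtain \<nu> f g where d: "densities_of \<Lambda> \<mu> \<nu> f g"
    using densities_of_exists[OF assms(1-3)] by blast
  interpret poisson_pair \<Lambda> \<mu> \<nu> f g P\<^sub>\<Lambda> P\<^sub>\<mu>
    by (intro poisson_pair.intro dominated_pair.intro poisson_pair_axioms.intro d assms)
  obtain m p q where "densities_of P\<^sub>\<Lambda> P\<^sub>\<mu> m p q"
    using densities_of_exists[of P\<^sub>\<Lambda> P\<^sub>\<mu>] PP.sigma_finite_measure_axioms QQ.sigma_finite_measure_axioms
    by auto
  then have pq: "dominated_prob_pair P\<^sub>\<Lambda> P\<^sub>\<mu> m p q"
    by (simp add: dominated_prob_pair_def dominated_pair_def PP.prob_space_axioms QQ.prob_space_axioms)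
  have T: "tsallis_divergence \<alpha> \<Lambda> \<mu> = enn2ereal (tsallis_integral \<alpha> \<nu> f g)" if "\<alpha> \<ge> 0" for \<alpha>
    by (rule tsallis_divergence_conv[OF that d])
  have "renyi_divergence \<alpha> P\<^sub>\<Lambda> P\<^sub>\<mu> = tsallis_divergence \<alpha> \<Lambda> \<mu>" if "\<alpha> > 0" for \<alpha>
    using renyi_eq_tsallis_order_neq_1[OF that _ pq] dominated_prob_pair.renyi_divergence_1[OF pq]
      tsallis_integral_1_poisson_pp[OF pq] T[of \<alpha>] that by (cases "\<alpha> = 1") auto
  moreover have "renyi_divergence 0 P\<^sub>\<Lambda> P\<^sub>\<mu> = tsallis_divergence 0 \<Lambda> \<mu>"
    if "\<alpha> > 0" "tsallis_divergence \<alpha> \<Lambda> \<mu> < \<infinity>" for \<alpha>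
  proof -
    have "tsallis_integral \<alpha> \<nu> f g < \<infinity>"
      using that T[of \<alpha>] by (cases "tsallis_integral \<alpha> \<nu> f g") auto
    then show ?thesis using renyi_0_eq_tsallis_0[OF pq that(1)] T[of 0] by simp
  qed
  ultimately show ?thesis by blast
qed

end
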